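(* Let $K\ge1$ and $f\in\mathcal{S}_H^0(K)$. Then the following are equivalent: (i) $\Omega=f(\mathbb{D})$ is a radial John disk. (ii) There is an $x\in(0,1)$ such that $$\sup_{|\zeta|=1}\ \sup_{r\in(0,1)}\frac{(1-\rho^2)\|D_f(\rho\zeta)\|}{(1-r^2)\|D_f(r\zeta)\|}<1,\qquad\text{where } \rho=\frac{x+r}{1+xr}.$$ (iii) $\displaystyle \sup_{z\in\mathbb{D},\,w\in B(z)}\frac{|f(z)-f(w)|}{(1-|z|^2)\|D_f(z)\|}<\infty.$
   Context: $\mathbb{D}=\{z\in\mathbb{C}:|z|<1\}$. $\mathcal{S}_H$ is the family of sense-preserving harmonic univalent mappings $f=h+\overline{g}$ in $\mathbb{D}$, with $h,g$ analytic, $h(0)=g(0)=0$, $h'(0)=1$; $\mathcal{S}_H^0=\{f=h+\overline g\in\mathcal{S}_H: g'(0)=0\}$. Write $\|D_f\|=|f_z|+|f_{\overline z}|$. A sense-preserving homeomorphism $f$ of class $W^{1,2}_{loc}$ between domains is $K$-quasiconformal if $\|D_f(z)\|^2\le K\big||f_z|^2-|f_{\overline z}|^2\big|$, i.e. $\|D_f(z)\|\le K\big||f_z|-|f_{\overline z}|\big|$. $\mathcal{S}_H^0(K)$ denotes the set of $K$-quasiconformal $f\in\mathcal{S}_H^0$. For a domain $G$, $d_G(w)$ is the Euclidean distance from $w$ to $\partial G$. For univalent $f$ on $\mathbb{D}$, a bounded simply connected domain $G=f(\mathbb{D})$ is a radial $c$-John disk ($c\ge1$) with John center $f(0)$ if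 for every $z\in\mathbb{D}$ the curve $\gamma=f([0,z])$, joining $w_1=f(z)$ to $f(0)$, is rectifiable and satisfies: for every $w\in\gamma$, the Euclidean length of the subarc $\gamma[w_1,w]$ of $\gamma$ between $w_1$ and $w$ is at most $c\,d_G(w)$. $G$ is a radial John disk if it is a radial $c$-John disk for some $c\ge1$. For $z\in\mathbb{D}$, $B(z)=\{\zeta: |z|\le|\zeta|<1,\ |\arg z-\arg\zeta|\le\pi(1-|z|)\}$ (differences of arguments taken modulo $2\pi$; $B(0)=\mathbb{D}$). *)

theory Defs
  imports "HOL-Analysis.Analysis"
begin

abbreviation unit_disk :: "complex set" ("\<D>")
  where "\<D> \<equiv> ball 0 1"

section \<open>Wirtinger derivatives\<close>

definition dz :: "(complex \<Rightarrow> complex) \<Rightarrow> complex \<Rightarrow> complex" where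
  "dz f z = (frechet_derivative f (at z) 1 - \<i> * frechet_derivative f (at z) \<i>) / 2"

definition dzbar :: "(complex \<Rightarrow> complex) \<Rightarrow> complex \<Rightarrow> complex" where
  "dzbar f z = (frechet_derivative f (at z) 1 + \<i> * frechet_derivative f (at z) \<i>) / 2"

definition Dnorm :: "(complex \<Rightarrow> complex) \<Rightarrow> complex \<Rightarrow> real" where
  "Dnorm f z = norm (dz f z) + norm (dzbar f z)"

definition jacobian :: "(complex \<Rightarrow> complex) \<Rightarrow> complex \<Rightarrow> real" where
  "jacobian f z = (norm (dz f z))\<^sup>2 - (norm (dzbar f z))\<^sup>2"

section \<open>Normalized univalent harmonic mappings\<close>

definition canonical_decomposition ::
    "(complex \<Rightarrow> complex) \<Rightarrow> (complex \<Rightarrow> complex) \<Rightarrow> (complex \<Rightarrow> complex) \<Rightarrow> bool" where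
  "canonical_decomposition f h g \<longleftrightarrow>
     h holomorphic_on \<D> \<and> g holomorphic_on \<D> \<and> h 0 = 0 \<and> g 0 = 0 \<and>
     (\<forall>z\<in>\<D>. f z = h z + cnj (g z))"

definition sense_preserving_on :: "complex set \<Rightarrow> (complex \<Rightarrow> complex) \<Rightarrow> bool" where
  "sense_preserving_on G f \<longleftrightarrow> (\<forall>z\<in>G. jacobian f z > 0)"

definition S_H :: "(complex \<Rightarrow> complex) set" where
  "S_H = {f. inj_on f \<D> \<and> sense_preserving_on \<D> f \<and>
             (\<exists>h g. canonical_decomposition f h g \<and> deriv h 0 = 1)}"

definition S_H0 :: "(complex \<Rightarrow> complex) set" where
  "S_H0 = {f \<in> S_H. \<exists>h g. canonical_decomposition f h g \<and> deriv g 0 = 0}"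

section \<open>The Sobolev class and quasiconformality\<close>

definition locally_L2_on :: "complex set \<Rightarrow> (complex \<Rightarrow> complex) \<Rightarrow> bool" where
  "locally_L2_on G u \<longleftrightarrow> set_borel_measurable lborel G u \<and>
     (\<forall>C. compact C \<and> C \<subseteq> G \<longrightarrow> set_integrable lborel C (\<lambda>z. (norm (u z))\<^sup>2))"

text \<open>Test functions are taken of class \<open>C\<^sup>1\<close>; by mollification this gives the same weak
  derivatives as smooth test functions.\<close>

definition test_function_on :: "complex set \<Rightarrow> (complex \<Rightarrow> real) \<Rightarrow> bool" where
  "test_function_on G \<phi> \<longleftrightarrow>
     (\<forall>z. \<phi> differentiable (at z)) \<and>
     (\<forall>v. continuous_on UNIV (\<lambda>z. frechet_derivative \<phi> (at z) v)) \<and>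
     compact (closure {z. \<phi> z \<noteq> 0}) \<and> closure {z. \<phi> z \<noteq> 0} \<subseteq> G"

definition weak_directional_derivative ::
    "complex set \<Rightarrow> complex \<Rightarrow> (complex \<Rightarrow> complex) \<Rightarrow> (complex \<Rightarrow> complex) \<Rightarrow> bool" where
  "weak_directional_derivative G v f u \<longleftrightarrow>
     (\<forall>\<phi>. test_function_on G \<phi> \<longrightarrow>
        (LINT z:G|lborel. frechet_derivative \<phi> (at z) v *\<^sub>R f z) = - (LINT z:G|lborel. \<phi> z *\<^sub>R u z))"

definition W12_loc :: "complex set \<Rightarrow> (complex \<Rightarrow> complex) \<Rightarrow> bool" where
  "W12_loc G f \<longleftrightarrow> locally_L2_on G f \<and>
     (\<exists>u. locally_L2_on G u \<and> weak_directional_derivative G 1 f u) \<and>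
     (\<exists>u. locally_L2_on G u \<and> weak_directional_derivative G \<i> f u)"

text \<open>A planar homeomorphism of class \<open>W12_loc\<close> is differentiable almost everywhere and its
  classical partial derivatives represent the weak ones (Gehring--Lehto), so the distortion
  inequality is stated with the classical ones. As the absolute value of the Jacobian is used,
  the orientation is a separate condition, which here comes from \<open>S_H\<close>.\<close>

definition quasiconformal_on :: "real \<Rightarrow> complex set \<Rightarrow> (complex \<Rightarrow> complex) \<Rightarrow> bool" where
  "quasiconformal_on K G f \<longleftrightarrow>
     open G \<and> connected G \<and> open (f ` G) \<and> connected (f ` G) \<and>
     (\<exists>f'. homeomorphism G (f ` G) f f') \<and> W12_loc G f \<and>
     (AE z in lborel. z \<in> G \<longrightarrow>
        f differentiable (at z) \<and> (Dnorm f z)\<^sup>2 \<le> K * \<bar>jacobian f z\<bar>)"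

definition S_H0_qc :: "real \<Rightarrow> (complex \<Rightarrow> complex) set" where
  "S_H0_qc K = {f \<in> S_H0. quasiconformal_on K \<D> f}"

section \<open>Radial John disks\<close>

text \<open>Length of the restriction of \<open>\<gamma>\<close> to \<open>{a..b}\<close>, as the supremum over all partitions
  \<open>a = t 0 \<le> \<dots> \<le> t n = b\<close>.\<close>

definition curve_length :: "(real \<Rightarrow> complex) \<Rightarrow> real \<Rightarrow> real \<Rightarrow> ereal" where
  "curve_length \<gamma> a b =
     (SUP (n, t) \<in> {(n::nat, t::nat \<Rightarrow> real). t 0 = a \<and> t n = b \<and> (\<forall>i<n. t i \<le> t (Suc i))}.
        ereal (\<Sum>i<n. dist (\<gamma> (t i)) (\<gamma> (t (Suc i)))))"

definition boundary_dist :: "complex set \<Rightarrow> complex \<Rightarrow> real" where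
  "boundary_dist G w = infdist w (frontier G)"

text \<open>The curve \<open>f([0,z])\<close> is parametrized by \<open>s \<mapsto> f (s z)\<close> on \<open>{0..1}\<close>, so its subarc between
  \<open>f z\<close> and \<open>w = f (s z)\<close> is the restriction to \<open>{s..1}\<close>.\<close>

definition radial_c_John_disk :: "real \<Rightarrow> (complex \<Rightarrow> complex) \<Rightarrow> bool" where
  "radial_c_John_disk c f \<longleftrightarrow>
     (let G = f ` \<D> in
        open G \<and> simply_connected G \<and> bounded G \<and>
        (\<forall>z\<in>\<D>. let \<gamma> = (\<lambda>s. f (of_real s * z)) in
           curve_length \<gamma> 0 1 < \<infinity> \<and>
           (\<forall>s\<in>{0..1}. curve_length \<gamma> s 1 \<le> ereal (c * boundary_dist G (\<gamma> s)))))"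

definition radial_John_disk :: "(complex \<Rightarrow> complex) \<Rightarrow> bool" where
  "radial_John_disk f \<longleftrightarrow> (\<exists>c\<ge>1. radial_c_John_disk c f)"

section \<open>The boxes \<open>B(z)\<close>\<close>

text \<open>The integer \<open>k\<close> expresses that arguments are compared modulo \<open>2\<pi>\<close>. For \<open>z = 0\<close> the
  condition on the arguments is always satisfied, so \<open>B_box 0 = \<D>\<close>.\<close>

definition B_box :: "complex \<Rightarrow> complex set" where
  "B_box z = {\<zeta>. norm z \<le> norm \<zeta> \<and> norm \<zeta> < 1 \<and>
                (\<exists>k::int. \<bar>Arg z - Arg \<zeta> + 2 * pi * of_int k\<bar> \<le> pi * (1 - norm z))}"

end

theory Submission
  imports Defs "HOL-Complex_Analysis.Complex_Analysis"
begin

text \<open>Write \<open>f = h + cnj g\<close> with \<open>|g'| \<le> k |h'|\<close>, \<open>k < 1\<close>. Injectivity of \<open>f\<close> bounds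
  \<open>(1 - |z|) |h''/h'|\<close>: otherwise rescalings of \<open>f\<close> approach a real-linear image of \<open>exp\<close>, which
  is periodic. Hence \<open>v z = (1 - |z|) Dnorm f z\<close> satisfies Harnack inequalities and \<open>f\<close> has
  Koebe-type distortion at every scale comparable to \<open>1 - |z|\<close>. Each of the three conditions is
  equivalent to a bound of the length of \<open>f\<close>-images of radial segments by \<open>v\<close> at their inner end
  point. The two implications that do not follow from the Harnack inequalities compare areas of
  images of Carleson boxes: under (iii) these areas decay geometrically along each radius, and under
  (i) halving them repeatedly leads to a short path to the boundary, whence the distance to the
  boundary is at most a multiple of \<open>v\<close>.\<close>

section \<open>Rescaling and the bound for the logarithmic derivative\<close>

text \<open>Quasiconformality enters through \<open>k < 1\<close>. The rescalings approach
  \<open>E + cnj (b * E)\<close> up to a constant, where \<open>E\<close> is a multiple of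
  \<open>exp z - 1\<close> and \<open>norm b \<le> k\<close>. This is invertible in \<open>E\<close>
  with margin \<open>1 - (norm b)\<^sup>2\<close>, bounded below by \<open>1 - k\<^sup>2\<close>, so
  the coincidence of the values at 0 and 2 pi i survives a small perturbation; one rescaling with
  explicit errors takes the place of a limit. Areas are used because injectivity makes the images of
  disjoint boxes disjoint: areas add, while the values of \<open>v\<close> along a radius satisfy no
  additive relation of their own. For conformal maps the bound of the boundary distance by
  \<open>v\<close> is the Schwarz lemma for the inverse map. The inverse of a harmonic map is in
  general not harmonic, so that bound is drawn from the John condition itself.\<close>

lemma norm_exp_minus_one_le:
  fixes x :: complex
  assumes "norm x \<le> 1"
  shows "norm (exp x - 1) \<le> 3 * norm x"
proof -
  have "norm (exp x - exp 0) \<le> 3 * norm (x - 0)"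
  proof (rule field_differentiable_bound[where S = "cball 0 1"])
    fix z :: complex assume z: "z \<in> cball 0 1"
    show "(exp has_field_derivative exp z) (at z within cball 0 1)"
      by (auto intro!: derivative_eq_intros)
    have "norm (exp z) \<le> exp (norm z)" by (rule norm_exp)
    also have "\<dots> \<le> exp 1" using z by simp
    also have "\<dots> \<le> 3" by (rule exp_le)
    finally show "norm (exp z) \<le> 3" .
  qed (use assms in auto)
  then show ?thesis by simp
qed

lemma norm_exp_diff_le:
  fixes x y :: complex
  assumes "norm (x - y) \<le> 1"
  shows "norm (exp x - exp y) \<le> 3 * norm (x - y) * norm (exp y)"
proof -
  have "exp x - exp y = exp y * (exp (x - y) - 1)"
    by (simp add: algebra_simps flip: exp_add)
  then show ?thesis
    using norm_exp_minus_one_le[OF assms] by (simp add: norm_mult mult.commute mult_left_mono)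
qed

text \<open>If \<open>\<psi>\<close> were the identity and \<open>w\<close> the constant
  \<open>b\<close>, the values at 0 and 2 pi i would agree; Brouwer's theorem makes this survive the
  error \<open>\<eta>\<close>. The radius 8 leaves room for the points within 1 of 2 pi i. The
  constant 480 is 80 * 2 * 3: 80 from the error bound, 2 from inverting the real-linear map, 3 from
  the radius 1/3 of the disc on which Brouwer is applied.\<close>

lemma near_exp_not_injective:
  fixes H G \<psi> w :: "complex \<Rightarrow> complex"
  assumes "A \<noteq> 0"
    and H: "\<And>z. z \<in> cball 0 8 \<Longrightarrow> (H has_field_derivative A * exp (\<psi> z)) (at z)"
    and G: "\<And>z. z \<in> cball 0 8 \<Longrightarrow> (G has_field_derivative w z * (A * exp (\<psi> z))) (at z)"
    and \<psi>: "\<And>z. z \<in> cball 0 8 \<Longrightarrow> norm (\<psi> z - z) \<le> \<eta>"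
    and w: "\<And>z. z \<in> cball 0 8 \<Longrightarrow> norm (w z - b) \<le> \<eta>"
    and b: "norm b < 1" and "\<eta> \<le> 1" and \<eta>: "480 * exp 8 * \<eta> \<le> 1 - (norm b)\<^sup>2"
  shows "\<not> inj_on (\<lambda>z. H z + cnj (G z)) (cball 0 8)"
proof -
  define F where "F = (\<lambda>z. H z + cnj (G z))"
  define err where "err z = F z - F 0 - (A * (exp z - 1) + cnj (b * (A * (exp z - 1))))" for z
  have "0 \<le> \<eta>" using \<psi>[of 0] by (meson centre_in_cball norm_ge_zero order_trans zero_le_numeral)
  have ez: "norm (exp z) \<le> exp 8" if "z \<in> cball 0 8" for z :: complex
    using norm_exp[of z] that by (simp add: order_trans)
  have d: "norm (exp (\<psi> z) - exp z) \<le> 3 * \<eta> * exp 8" if "z \<in> cball 0 8" for z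
  proof -
    have "norm (exp (\<psi> z) - exp z) \<le> 3 * norm (\<psi> z - z) * norm (exp z)"
      using \<psi>[OF that] \<open>\<eta> \<le> 1\<close> by (intro norm_exp_diff_le) simp
    also have "\<dots> \<le> 3 * \<eta> * exp 8"
      using \<psi>[OF that] ez[OF that] \<open>0 \<le> \<eta>\<close> by (intro mult_mono) auto
    finally show ?thesis .
  qed
  \<comment> \<open>The derivatives of the analytic and the conjugated part deviate from the model
    by at most 3 and 7 times \<open>\<eta> * exp 8 * norm A\<close>; integration over a segment of
    length at most 8 gives 80.\<close>
  have err_le: "norm (err z) \<le> 80 * exp 8 * \<eta> * norm A" if z: "z \<in> cball 0 8" for z
  proof -
    have 1: "norm ((H z - A * exp z) - (H 0 - A * exp 0)) \<le> (3 * \<eta> * exp 8 * norm A) * norm (z - 0)"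
    proof (rule field_differentiable_bound[where S = "cball 0 8"])
      fix u :: complex assume u: "u \<in> cball 0 8"
      show "((\<lambda>z. H z - A * exp z) has_field_derivative A * exp (\<psi> u) - A * exp u)
              (at u within cball 0 8)"
        by (auto intro!: derivative_eq_intros DERIV_subset[OF H[OF u]])
      have "norm (A * exp (\<psi> u) - A * exp u) = norm A * norm (exp (\<psi> u) - exp u)"
        by (simp add: norm_mult flip: right_diff_distrib)
      then show "norm (A * exp (\<psi> u) - A * exp u) \<le> 3 * \<eta> * exp 8 * norm A"
        using d[OF u] by (simp add: mult.commute mult_left_mono)
    qed (use z in auto)
    have 2: "norm ((G z - b * (A * exp z)) - (G 0 - b * (A * exp 0))) \<le> (7 * \<eta> * exp 8 * norm A) * norm (z - 0)"
    proof (rule field_differentiable_bound[where S = "cball 0 8"])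
      fix u :: complex assume u: "u \<in> cball 0 8"
      show "((\<lambda>z. G z - b * (A * exp z)) has_field_derivative w u * (A * exp (\<psi> u)) - b * (A * exp u))
              (at u within cball 0 8)"
        by (auto intro!: derivative_eq_intros DERIV_subset[OF G[OF u]])
      have "norm (exp (\<psi> u)) \<le> norm (exp u) + norm (exp (\<psi> u) - exp u)"
        by (metis norm_triangle_sub)
      also have "\<dots> \<le> exp 8 + 3 * \<eta> * exp 8" by (rule add_mono[OF ez[OF u] d[OF u]])
      also have "\<dots> \<le> 4 * exp 8" using \<open>\<eta> \<le> 1\<close> by simp
      finally have e4: "norm (exp (\<psi> u)) \<le> 4 * exp 8" .
      have "w u * (A * exp (\<psi> u)) - b * (A * exp u)
          = A * ((w u - b) * exp (\<psi> u) + b * (exp (\<psi> u) - exp u))"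
        by (simp add: algebra_simps)
      then have eq: "norm (w u * (A * exp (\<psi> u)) - b * (A * exp u))
          = norm A * norm ((w u - b) * exp (\<psi> u) + b * (exp (\<psi> u) - exp u))"
        by (simp only: norm_mult)
      have "norm ((w u - b) * exp (\<psi> u) + b * (exp (\<psi> u) - exp u))
          \<le> norm (w u - b) * norm (exp (\<psi> u)) + norm b * norm (exp (\<psi> u) - exp u)"
        by (metis norm_mult norm_triangle_ineq)
      also have "\<dots> \<le> \<eta> * (4 * exp 8) + 1 * (3 * \<eta> * exp 8)"
        using w[OF u] e4 d[OF u] b \<open>0 \<le> \<eta>\<close> by (intro add_mono mult_mono) auto
      also have "\<dots> = 7 * \<eta> * exp 8" by simp
      finally show "norm (w u * (A * exp (\<psi> u)) - b * (A * exp u)) \<le> 7 * \<eta> * exp 8 * norm A"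
        unfolding eq by (metis mult.commute mult_left_mono norm_ge_zero)
    qed (use z in auto)
    have "err z = ((H z - A * exp z) - (H 0 - A * exp 0))
          + cnj ((G z - b * (A * exp z)) - (G 0 - b * (A * exp 0)))"
      unfolding err_def F_def by (simp add: algebra_simps)
    then have "norm (err z) \<le> norm ((H z - A * exp z) - (H 0 - A * exp 0))
          + norm ((G z - b * (A * exp z)) - (G 0 - b * (A * exp 0)))"
      by (metis norm_triangle_ineq complex_mod_cnj)
    also have "\<dots> \<le> (3 * \<eta> * exp 8 * norm A) * norm (z - 0) + (7 * \<eta> * exp 8 * norm A) * norm (z - 0)"
      using 1 2 by linarith
    also have "\<dots> = (10 * \<eta> * exp 8 * norm A) * norm z" by simp
    also have "\<dots> \<le> (10 * \<eta> * exp 8 * norm A) * 8"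
      using z \<open>0 \<le> \<eta>\<close> by (intro mult_left_mono) auto
    finally show ?thesis by (simp add: algebra_simps)
  qed
  define q where "q = 2 * of_real pi * \<i>"
  define \<beta> where "\<beta> = 1 - (norm b)\<^sup>2"
  have "\<beta> > 0" using b by (simp add: \<beta>_def abs_square_less_1)
  have nq: "norm q = 2 * pi" by (simp add: q_def norm_mult)
  \<comment> \<open>Near the period \<open>q\<close> the quantity \<open>t = exp z - 1\<close> is a
    coordinate with inverse \<open>P\<close>; in it the model is the real-linear map
    \<open>A * t + cnj (b * (A * t))\<close>.\<close>
  define P where "P t = q + Ln (1 + t)" for t
  have L: "norm (Ln (1 + t)) \<le> 1" if "t \<in> cball 0 (1/3)" for t :: complex
    using norm_Ln_le[of t] that by auto
  have P: "P t \<in> cball 0 8" if "t \<in> cball 0 (1/3)" for t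
    using L[OF that] norm_triangle_ineq[of q "Ln (1 + t)"] pi_less_4 pi_approx(2)
    by (simp add: P_def nq)
  have nonzero: "1 + t \<noteq> 0" "1 + t \<notin> \<real>\<^sub>\<le>\<^sub>0" if "t \<in> cball 0 (1/3)" for t :: complex
  proof -
    have "Re (1 + t) > 0" using that abs_Re_le_cmod[of t] by auto
    then show "1 + t \<notin> \<real>\<^sub>\<le>\<^sub>0" by (auto simp: complex_nonpos_Reals_iff)
    then show "1 + t \<noteq> 0" by auto
  qed
  have expP: "exp (P t) = 1 + t" if "t \<in> cball 0 (1/3)" for t
    using nonzero[OF that] by (simp add: P_def q_def exp_add exp_Ln)
  \<comment> \<open>The real-linear map \<open>x \<mapsto> x + cnj (b * x)\<close> has inverse \<open>y \<mapsto> (y - cnj (b * y)) / \<beta>\<close>, so a zero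
    of \<open>t \<mapsto> F (P t) - F 0\<close> is a fixed point of the following map.\<close>
  define T where "T t = - ((err (P t) - cnj (b * err (P t))) / of_real \<beta>) / A" for t
  have contF: "continuous_on (cball 0 8) F"
    unfolding F_def using H G
    by (intro continuous_intros continuous_at_imp_continuous_on ballI) (auto intro: DERIV_isCont)
  have contP: "continuous_on (cball 0 (1/3)) P"
    unfolding P_def using nonzero by (intro continuous_intros) auto
  have "continuous_on (cball 0 (1/3)) (\<lambda>t. F (P t))"
    by (rule continuous_on_compose2[OF contF contP]) (use P in auto)
  then have "continuous_on (cball 0 (1/3)) T"
    unfolding T_def err_def using \<open>A \<noteq> 0\<close> \<open>\<beta> > 0\<close> contP by (intro continuous_intros) auto
  moreover have "T \<in> cball 0 (1/3) \<rightarrow> cball 0 (1/3)"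
  proof
    fix t :: complex assume t: "t \<in> cball 0 (1/3)"
    have "norm (err (P t) - cnj (b * err (P t))) \<le> norm (err (P t)) + norm b * norm (err (P t))"
      by (metis norm_triangle_ineq4 complex_mod_cnj norm_mult)
    also have "\<dots> \<le> 2 * norm (err (P t))"
      using mult_right_mono[of "norm b" 1 "norm (err (P t))"] b by simp
    also have "\<dots> \<le> 160 * exp 8 * \<eta> * norm A" using err_le[OF P[OF t]] by linarith
    also have "\<dots> \<le> (\<beta> / 3) * norm A" using \<eta> by (intro mult_right_mono) (auto simp: \<beta>_def)
    finally have "norm (err (P t) - cnj (b * err (P t))) \<le> (\<beta> / 3) * norm A" .
    then show "T t \<in> cball 0 (1/3)"
      using \<open>A \<noteq> 0\<close> \<open>\<beta> > 0\<close> by (simp add: T_def norm_divide norm_mult norm_minus_commute field_simps)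
  qed
  ultimately obtain t where t: "t \<in> cball 0 (1/3)" "T t = t"
    by (rule brouwer_ball[rotated]) auto
  define y where "y = err (P t)"
  have bb: "b * cnj b = of_real (1 - \<beta>)" using complex_norm_square[of b] by (simp add: \<beta>_def)
  have At: "A * t * of_real \<beta> = - (y - cnj (b * y))"
    using t(2) \<open>A \<noteq> 0\<close> \<open>\<beta> > 0\<close> by (simp add: T_def y_def field_simps)
  have "(A * t + cnj (b * (A * t))) * of_real \<beta> = A * t * of_real \<beta> + cnj (b * (A * t * of_real \<beta>))"
    by (simp add: algebra_simps)
  also have "\<dots> = - (1 - b * cnj b) * y" unfolding At by (simp add: algebra_simps)
  also have "\<dots> = - (y * of_real \<beta>)" by (simp add: bb)
  finally have "(A * t + cnj (b * (A * t)) + y) * of_real \<beta> = 0" by (simp add: algebra_simps)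
  then have "A * t + cnj (b * (A * t)) + y = 0" using \<open>\<beta> > 0\<close> by simp
  moreover have "F (P t) - F 0 = A * t + cnj (b * (A * t)) + y"
    unfolding y_def err_def using expP[OF t(1)] by simp
  ultimately have "F (P t) = F 0" by simp
  \<comment> \<open>\<open>P t\<close> lies within 1 of \<open>q\<close>, whose modulus exceeds 6,
    so it is a second point with the value \<open>F 0\<close>.\<close>
  moreover have "P t \<noteq> 0"
  proof
    assume "P t = 0"
    then have "norm q = norm (Ln (1 + t))" unfolding P_def by (metis add_eq_0_iff2 norm_minus_cancel)
    then show False using L[OF t(1)] nq pi_gt3 by simp
  qed
  ultimately have "\<not> inj_on F (cball 0 8)"
    using P[OF t(1)] inj_onD[of F "cball 0 8" "P t" 0] by auto
  then show ?thesis by (simp add: F_def)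
qed

section \<open>Cauchy estimates\<close>

lemma norm_deriv_le_of_bounded:
  assumes "F holomorphic_on S" "cball z s \<subseteq> S" "0 < s" "\<And>u. u \<in> S \<Longrightarrow> norm (F u) \<le> B"
  shows "norm (deriv F z) \<le> B / s"
proof -
  have "F holomorphic_on cball z s" using assms by (rule_tac holomorphic_on_subset)
  then have "norm ((deriv ^^ 1) F z) \<le> fact 1 * B / s ^ 1"
  proof (intro Cauchy_inequality)
    show "norm (F x) \<le> B" if "norm (z - x) = s" for x
      using that assms(2,4) by (auto simp: dist_norm subset_eq)
  qed (use \<open>0 < s\<close> in \<open>auto intro: holomorphic_on_subset holomorphic_on_imp_continuous_on\<close>)
  then show ?thesis by simp
qed

lemma holomorphic_lipschitz_of_bounded:
  assumes "F holomorphic_on S" "open S" "0 < s" "\<And>u. u \<in> S \<Longrightarrow> norm (F u) \<le> B"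
    and "convex T" "\<And>u. u \<in> T \<Longrightarrow> cball u s \<subseteq> S" "z \<in> T" "w \<in> T"
  shows "norm (F w - F z) \<le> B / s * norm (w - z)"
proof (rule field_differentiable_bound[OF \<open>convex T\<close>])
  fix u assume u: "u \<in> T"
  then have "u \<in> S" using assms(3,6) by (meson centre_in_cball less_imp_le subset_iff)
  then show "(F has_field_derivative deriv F u) (at u within T)"
    using assms(1,2) holomorphic_derivI by blast
  show "norm (deriv F u) \<le> B / s"
    using norm_deriv_le_of_bounded assms u by blast
qed (use assms in auto)

text \<open>Kept apart from \<open>harmonic_qc\<close> because its formulas for the Wirtinger
  derivatives are what yields the dilatation bound assumed there.\<close>

locale harmonic_map =
  fixes f h g :: "complex \<Rightarrow> complex"
  assumes holh: "h holomorphic_on \<D>" and holg: "g holomorphic_on \<D>"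
    and f_eq: "\<And>z. z \<in> \<D> \<Longrightarrow> f z = h z + cnj (g z)"

locale harmonic_qc = harmonic_map f h g for f h g +
  fixes k :: real
  assumes inj_f: "inj_on f \<D>"
    and k: "0 \<le> k" "k < 1"
    and h'_nz: "\<And>z. z \<in> \<D> \<Longrightarrow> deriv h z \<noteq> 0"
    and dilat: "\<And>z. z \<in> \<D> \<Longrightarrow> norm (deriv g z) \<le> k * norm (deriv h z)"
begin

text \<open>In the coordinate \<open>z0 + a * z\<close> the logarithm of the derivative of
  \<open>h\<close> has derivative 1 at 0 and at most 2 on a disc of large radius \<open>R\<close>.
  Cauchy's estimate on discs of radius \<open>R / 2\<close> makes this derivative and the dilatation
  nearly constant on \<open>cball 0 8\<close>, which contradicts injectivity by
  \<open>near_exp_not_injective\<close>.\<close>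

lemma log_deriv_rescaled_bound:
  assumes hol\<phi>: "\<phi> holomorphic_on \<D>" and \<phi>: "\<And>z. z \<in> \<D> \<Longrightarrow> deriv h z = exp (\<phi> z)"
    and R: "384 * 480 * exp 8 \<le> R * (1 - k\<^sup>2)" and "a \<noteq> 0"
    and sub: "\<And>z. z \<in> ball 0 R \<Longrightarrow> z0 + a * z \<in> \<D>"
    and bd: "\<And>z. z \<in> ball 0 R \<Longrightarrow> norm (deriv \<phi> (z0 + a * z)) \<le> 2 / norm a"
    and a: "deriv \<phi> z0 * a = 1"
  shows False
proof -
  define \<omega> where "\<omega> z = deriv g z / deriv h z" for z
  have hol\<omega>: "\<omega> holomorphic_on \<D>"
    unfolding \<omega>_def using holh holg h'_nz by (intro holomorphic_intros) auto
  have \<omega>1: "norm (\<omega> z) \<le> k" if "z \<in> \<D>" for z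
    using dilat[OF that] h'_nz[OF that] by (simp add: \<omega>_def norm_divide divide_simps)
  have kk: "0 < 1 - k\<^sup>2" "1 - k\<^sup>2 \<le> 1" using k by (simp_all add: abs_square_less_1)
  have "(1::real) \<le> exp 8" by simp
  then have "384 * 480 \<le> R * (1 - k\<^sup>2)" using R by linarith
  moreover have "R > 0" using R kk
    by (metis exp_gt_zero less_le_trans mult_pos_pos zero_less_mult_pos2 zero_less_numeral)
  ultimately have "R \<ge> 384 * 480" using kk
    by (smt (verit) mult_left_le)
  \<comment> \<open>On \<open>cball 0 8\<close> the derivative of \<open>\<psi> z - z\<close> is at
    most \<open>32 / R\<close>, so \<open>\<psi>\<close> deviates from the identity by at most
    \<open>256 / R\<close>, and the dilatation from its central value by at most
    \<open>16 / R\<close>; \<open>384 / R\<close> covers both.\<close>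
  define \<eta> where "\<eta> = 384 / R"
  have \<eta>: "480 * exp 8 * \<eta> \<le> 1 - k\<^sup>2" using R \<open>R > 0\<close> by (simp add: \<eta>_def field_simps)
  define \<psi> where "\<psi> z = \<phi> (z0 + a * z) - \<phi> z0" for z
  define w where "w z = \<omega> (z0 + a * z)" for z
  let ?B = "ball (0::complex) R"
  let ?l = "\<lambda>z. z0 + a * z"
  have hol_l: "(F \<circ> ?l) holomorphic_on ?B" if "F holomorphic_on \<D>" for F
    by (rule holomorphic_on_compose_gen[OF _ that]) (use sub in \<open>auto intro!: holomorphic_intros\<close>)
  have c8: "cball u (R / 2) \<subseteq> ?B" if "u \<in> cball 0 8" for u :: complex
  proof
    fix v assume "v \<in> cball u (R / 2)"
    then have "norm (v - u) \<le> R / 2" by (simp add: dist_norm norm_minus_commute)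
    then show "v \<in> ?B"
      using that \<open>R \<ge> 384 * 480\<close> norm_triangle_sub[of v u] by simp
  qed
  then have c8': "cball 0 8 \<subseteq> ?B" using \<open>R > 0\<close>
    by (meson centre_in_cball half_gt_zero less_imp_le subset_iff)
  have w: "norm (w z - w 0) \<le> \<eta>" if "z \<in> cball 0 8" for z
  proof -
    have "norm (w z - w 0) \<le> k / (R / 2) * norm (z - 0)"
      by (rule holomorphic_lipschitz_of_bounded[where S = ?B and T = "cball 0 8"])
         (use hol_l[OF hol\<omega>] \<omega>1 sub \<open>R > 0\<close> that c8 in \<open>auto simp: w_def[abs_def] o_def\<close>)
    also have "\<dots> \<le> 1 / (R / 2) * 8"
      using that k \<open>R > 0\<close> by (intro mult_mono divide_right_mono) auto
    also have "\<dots> \<le> \<eta>" using \<open>R > 0\<close> by (simp add: \<eta>_def field_simps)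
    finally show ?thesis .
  qed
  have hol2: "(\<lambda>z. a * deriv \<phi> (?l z)) holomorphic_on ?B"
    using hol_l[OF holomorphic_deriv[OF hol\<phi>]] by (auto simp: o_def intro: holomorphic_intros)
  have bd2: "norm (a * deriv \<phi> (?l z)) \<le> 2" if "z \<in> ?B" for z
    using bd[OF that] \<open>a \<noteq> 0\<close> by (simp add: norm_mult field_simps)
  have d2: "norm (a * deriv \<phi> (?l z) - a * deriv \<phi> (?l 0)) \<le> 2 / (R / 2) * norm (z - 0)"
    if "z \<in> cball 0 8" for z
    by (rule holomorphic_lipschitz_of_bounded[OF hol2 open_ball _ bd2, where T = "cball 0 8"])
       (use \<open>R > 0\<close> that c8 in auto)
  have \<psi>: "norm (\<psi> z - z) \<le> \<eta>" if z: "z \<in> cball 0 8" for z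
  proof -
    have "norm ((\<psi> z - z) - (\<psi> 0 - 0)) \<le> 32 / R * norm (z - 0)"
    proof (rule field_differentiable_bound[where S = "cball 0 8"])
      fix u :: complex assume u: "u \<in> cball 0 8"
      have "(\<phi> has_field_derivative deriv \<phi> (?l u)) (at (?l u))"
        using hol\<phi> sub c8' u by (intro holomorphic_derivI[where S = \<D>]) auto
      then have "((\<lambda>z. \<phi> (?l z)) has_field_derivative deriv \<phi> (?l u) * a) (at u within cball 0 8)"
        by (rule DERIV_chain2[where g = ?l]) (auto intro!: derivative_eq_intros)
      then show "((\<lambda>z. \<psi> z - z) has_field_derivative a * deriv \<phi> (?l u) - 1) (at u within cball 0 8)"
        unfolding \<psi>_def by (auto intro!: derivative_eq_intros)
      have "norm (a * deriv \<phi> (?l u) - 1) \<le> 2 / (R / 2) * norm (u - 0)"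
        using d2[OF u] a by (simp add: mult.commute)
      also have "\<dots> \<le> 2 / (R / 2) * 8" using u \<open>R > 0\<close> by (intro mult_left_mono) auto
      finally show "norm (a * deriv \<phi> (?l u) - 1) \<le> 32 / R" by simp
    qed (use z in auto)
    also have "\<dots> \<le> 32 / R * 8" using z \<open>R > 0\<close> by (intro mult_left_mono) auto
    also have "\<dots> \<le> \<eta>" using \<open>R > 0\<close> by (simp add: \<eta>_def field_simps)
    finally show ?thesis by (simp add: \<psi>_def)
  qed
  have chain: "((\<lambda>z. F (?l z)) has_field_derivative deriv F (?l z) * a) (at z)"
    if "F holomorphic_on \<D>" "z \<in> cball 0 8" for F z
  proof -
    have "?l z \<in> \<D>" using sub c8' that by auto
    then have "(F has_field_derivative deriv F (?l z)) (at (?l z))"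
      using that(1) by (intro holomorphic_derivI[where S = \<D>]) auto
    then show ?thesis by (rule DERIV_chain2) (auto intro!: derivative_eq_intros)
  qed
  have eA: "deriv h (?l z) * a = (a * exp (\<phi> z0)) * exp (\<psi> z)" if "z \<in> cball 0 8" for z
    using \<phi>[of "?l z"] sub c8' that by (auto simp: \<psi>_def simp flip: exp_add)
  have "z0 \<in> \<D>" using sub[of 0] \<open>R > 0\<close> by simp
  have "norm (w 0) \<le> k" using \<omega>1[OF \<open>z0 \<in> \<D>\<close>] by (simp add: w_def)
  then have "(norm (w 0))\<^sup>2 \<le> k\<^sup>2" by (simp add: power_mono)
  have "\<not> inj_on (\<lambda>z. h (?l z) + cnj (g (?l z))) (cball 0 8)"
  proof (rule near_exp_not_injective[where A = "a * exp (\<phi> z0)" and \<psi> = \<psi> and w = w and b = "w 0" and \<eta> = \<eta>])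
    show "((\<lambda>z. h (?l z)) has_field_derivative a * exp (\<phi> z0) * exp (\<psi> z)) (at z)"
      if "z \<in> cball 0 8" for z
      using chain[OF holh that] eA[OF that] by simp
    show "((\<lambda>z. g (?l z)) has_field_derivative w z * (a * exp (\<phi> z0) * exp (\<psi> z))) (at z)"
      if z: "z \<in> cball 0 8" for z
    proof -
      have eq: "deriv g (?l z) * a = w z * (deriv h (?l z) * a)"
        using h'_nz[of "?l z"] sub c8' z by (auto simp: w_def \<omega>_def)
      show ?thesis using chain[OF holg z] unfolding eq eA[OF z] .
    qed
    show "480 * exp 8 * \<eta> \<le> 1 - (norm (w 0))\<^sup>2"
      using \<eta> \<open>(norm (w 0))\<^sup>2 \<le> k\<^sup>2\<close> by linarith
    show "\<eta> \<le> 1" using \<open>R \<ge> 384 * 480\<close> by (simp add: \<eta>_def)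
  qed (use \<psi> w \<open>norm (w 0) \<le> k\<close> k \<open>a \<noteq> 0\<close> in auto)
  moreover have "inj_on (\<lambda>z. h (?l z) + cnj (g (?l z))) (cball 0 8)"
  proof (rule inj_onI)
    fix x y assume xy: "x \<in> cball 0 8" "y \<in> cball 0 8"
      "h (?l x) + cnj (g (?l x)) = h (?l y) + cnj (g (?l y))"
    then have "?l x \<in> \<D>" "?l y \<in> \<D>" using sub c8' by auto
    then have "?l x = ?l y" using xy(3) f_eq inj_f by (metis inj_onD)
    then show "x = y" using \<open>a \<noteq> 0\<close> by simp
  qed
  ultimately show False by simp
qed

text \<open>Zalcman's rescaling at a maximum point of \<open>(r - |z|) |\<phi>' z|\<close>: if the bound failed, the
  rescaled mappings would approach a real-linear image of \<open>exp\<close>, which is not injective.\<close>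

lemma log_deriv_bound:
  assumes hol\<phi>: "\<phi> holomorphic_on \<D>" and \<phi>: "\<And>z. z \<in> \<D> \<Longrightarrow> deriv h z = exp (\<phi> z)"
  shows "\<exists>M>0. \<forall>z\<in>\<D>. (1 - norm z) * norm (deriv \<phi> z) \<le> M"
proof (rule ccontr)
  have kk: "0 < 1 - k\<^sup>2" using k by (simp add: abs_square_less_1)
  define R where "R = 384 * 480 * exp 8 / (1 - k\<^sup>2)"
  have R: "384 * 480 * exp 8 \<le> R * (1 - k\<^sup>2)" "R > 0" using kk by (simp_all add: R_def)
  assume "\<not> ?thesis"
  then obtain z1 where z1: "z1 \<in> \<D>" "(1 - norm z1) * norm (deriv \<phi> z1) > 2 * R"
    using \<open>R > 0\<close> by (meson linorder_not_le mult_pos_pos zero_less_numeral)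
  then have "norm (deriv \<phi> z1) > 0" using \<open>R > 0\<close> by (auto intro: ccontr)
  then have "norm z1 + 2 * R / norm (deriv \<phi> z1) < 1" using z1 by (simp add: field_simps)
  \<comment> \<open>The weight \<open>r - norm z\<close> lives on a compact disc and vanishes on its
    boundary circle, so the maximum exists and lies inside; \<open>r\<close> is close enough to 1 to
    keep the value at \<open>z1\<close> above \<open>2 * R\<close>.\<close>
  then obtain r where r: "norm z1 + 2 * R / norm (deriv \<phi> z1) < r" "r < 1"
    using dense by blast
  then have r1: "(r - norm z1) * norm (deriv \<phi> z1) > 2 * R"
    using \<open>norm (deriv \<phi> z1) > 0\<close> by (simp add: field_simps)
  have "2 * R / norm (deriv \<phi> z1) \<ge> 0" using \<open>R > 0\<close> by simp
  then have "norm z1 \<le> r" using r by linarith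
  have "continuous_on (cball 0 r) (\<lambda>z. (r - norm z) * norm (deriv \<phi> z))"
    using holomorphic_deriv[OF hol\<phi>] r
    by (intro continuous_intros continuous_on_subset[OF holomorphic_on_imp_continuous_on]) auto
  moreover have "cball (0::complex) r \<noteq> {}"
    using order_trans[OF norm_ge_zero \<open>norm z1 \<le> r\<close>] by simp
  ultimately obtain z0 where z0: "z0 \<in> cball 0 r"
    and max: "\<And>z. z \<in> cball 0 r \<Longrightarrow>
        (r - norm z) * norm (deriv \<phi> z) \<le> (r - norm z0) * norm (deriv \<phi> z0)"
    using continuous_attains_sup[OF compact_cball] by blast
  have m: "(r - norm z0) * norm (deriv \<phi> z0) > 2 * R"
    using max[of z1] r1 \<open>norm z1 \<le> r\<close> by simp
  then have nz: "deriv \<phi> z0 \<noteq> 0" "norm z0 < r" using \<open>R > 0\<close> z0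
    by (auto simp: less_le)
  define a where "a = inverse (deriv \<phi> z0)"
  have aR: "norm a * R < (r - norm z0) / 2"
    using m nz by (simp add: a_def norm_inverse norm_divide field_simps)
  \<comment> \<open>The rescaled disc stays where the weight is at least half of its value at
    \<open>z0\<close>; maximality then lets \<open>deriv \<phi>\<close> grow by a factor of at most
    2.\<close>
  have mod: "norm (z0 + a * z) \<le> norm z0 + (r - norm z0) / 2" if "z \<in> ball 0 R" for z
  proof -
    have "norm (a * z) \<le> norm a * R" using that by (simp add: norm_mult mult_left_mono)
    then show ?thesis using aR norm_triangle_ineq[of z0 "a * z"] by linarith
  qed
  show False
  proof (rule log_deriv_rescaled_bound[where a = a and ?z0.0 = z0, OF hol\<phi> \<phi> R(1)])
    fix z :: complex assume z: "z \<in> ball 0 R"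
    have lt: "norm (z0 + a * z) < r" using mod[OF z] nz by (simp add: field_simps)
    then show "z0 + a * z \<in> \<D>" using r by simp
    have "(r - norm z0) / 2 * norm (deriv \<phi> (z0 + a * z))
        \<le> (r - norm (z0 + a * z)) * norm (deriv \<phi> (z0 + a * z))"
      using mod[OF z] by (intro mult_right_mono) (simp_all add: field_simps)
    also have "\<dots> \<le> (r - norm z0) * norm (deriv \<phi> z0)" using max lt by simp
    finally have "(r - norm z0) * norm (deriv \<phi> (z0 + a * z)) \<le> (r - norm z0) * (2 * norm (deriv \<phi> z0))"
      by simp
    then have "norm (deriv \<phi> (z0 + a * z)) \<le> 2 * norm (deriv \<phi> z0)"
      using nz by (simp add: mult_le_cancel_left)
    then show "norm (deriv \<phi> (z0 + a * z)) \<le> 2 / norm a"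
      by (simp add: a_def norm_inverse divide_inverse)
  qed (use nz in \<open>auto simp: a_def\<close>)
qed

end

section \<open>Mappings with Koebe-type distortion\<close>

text \<open>\<open>D\<close> stands for \<open>Dnorm f\<close>. Analyticity is replaced by local
  bilipschitz bounds proportional to \<open>D\<close> on discs of radius a fixed fraction of
  \<open>1 - norm z\<close>, and by the bound of chords along a radius by the integral of
  \<open>D\<close>.\<close>

locale koebe_like =
  fixes f :: "complex \<Rightarrow> complex" and D :: "complex \<Rightarrow> real" and \<delta> c :: real
  assumes inj_f: "inj_on f \<D>" and cont_f: "continuous_on \<D> f" and cont_D: "continuous_on \<D> D"
    and D_pos: "\<And>z. z \<in> \<D> \<Longrightarrow> 0 < D z"
    and \<delta>: "0 < \<delta>" "\<delta> \<le> 1/4" and c: "0 < c" "c \<le> 1"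
    and near: "\<And>z w. z \<in> \<D> \<Longrightarrow> norm (w - z) \<le> \<delta> * (1 - norm z) \<Longrightarrow>
        D w \<le> 2 * D z \<and> D z \<le> 2 * D w \<and>
        c * D z * norm (w - z) \<le> norm (f w - f z) \<and> norm (f w - f z) \<le> 2 * D z * norm (w - z)"
    and radial: "\<And>u a b. norm u = 1 \<Longrightarrow> 0 \<le> a \<Longrightarrow> a \<le> b \<Longrightarrow> b < 1 \<Longrightarrow>
        norm (f (of_real b * u) - f (of_real a * u)) \<le> integral {a..b} (\<lambda>t. D (of_real t * u))"
begin

definition v :: "complex \<Rightarrow> real" where "v z = (1 - norm z) * D z"

abbreviation len :: "complex \<Rightarrow> real \<Rightarrow> real \<Rightarrow> real" where
  "len u a b \<equiv> integral {a..b} (\<lambda>t. D (of_real t * u))"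

text \<open>The hub of the equivalences. Integrating \<open>D\<close> dominates lengths without
  mentioning curves, and one constant for all \<open>R < 1\<close> stands for an improper integral
  up to the unit circle.\<close>

definition radial_decay :: bool where
  "radial_decay \<longleftrightarrow> (\<exists>C\<ge>0. \<forall>u r R. norm u = 1 \<longrightarrow> 0 \<le> r \<longrightarrow> r \<le> R \<longrightarrow> R < 1 \<longrightarrow>
      len u r R \<le> C * v (of_real r * u))"

text \<open>A Carleson box around the direction \<open>u\<close>. The angle is measured by the chord
  between \<open>z / norm z\<close> and \<open>u\<close>, multiplied through by
  \<open>norm z\<close>; this avoids arguments and division, and strict inequalities make the box
  open.\<close>

definition polar_box :: "real \<Rightarrow> complex \<Rightarrow> real \<Rightarrow> complex set" where
  "polar_box r u \<tau> = {z. r < norm z \<and> norm z < 1 \<and> norm (z - of_real (norm z) * u) < \<tau> * (1 - r) * norm z}"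

section \<open>Radii and the lengths of their images\<close>

lemma v_pos: "z \<in> \<D> \<Longrightarrow> 0 < v z"
  unfolding v_def using D_pos by simp

lemma radius_in_disk:
  assumes "norm u = 1" "0 \<le> r" "r < 1"
  shows "of_real r * u \<in> \<D>" "norm (of_real r * u) = r" "v (of_real r * u) = (1 - r) * D (of_real r * u)"
  using assms by (simp_all add: norm_mult v_def)

lemma D_radius_pos: "norm u = 1 \<Longrightarrow> 0 \<le> r \<Longrightarrow> r < 1 \<Longrightarrow> 0 < D (of_real r * u)"
  using radius_in_disk D_pos by blast

lemma v_radius_pos: "norm u = 1 \<Longrightarrow> 0 \<le> r \<Longrightarrow> r < 1 \<Longrightarrow> 0 < v (of_real r * u)"
  using radius_in_disk v_pos by blast

lemma integrable_D:
  assumes "norm u = 1" "0 \<le> a" "b < 1"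
  shows "(\<lambda>t. D (of_real t * u)) integrable_on {a..b}"
proof (rule integrable_continuous_interval)
  have "of_real t * u \<in> \<D>" if "t \<in> {a..b}" for t
    using radius_in_disk(1)[of u t] assms that by simp
  then show "continuous_on {a..b} (\<lambda>t. D (of_real t * u))"
    by (intro continuous_on_compose2[OF cont_D] continuous_intros) auto
qed

lemma len_combine:
  assumes "norm u = 1" "0 \<le> a" "a \<le> b" "b \<le> d" "d < 1"
  shows "len u a d = len u a b + len u b d"
  using Henstock_Kurzweil_Integration.integral_combine[OF assms(3,4) integrable_D] assms by simp

lemma len_nonneg:
  assumes "norm u = 1" "0 \<le> a" "b < 1"
  shows "0 \<le> len u a b"
  using assms D_radius_pos
  by (intro integral_nonneg integrable_D) (auto intro: less_imp_le)

lemma len_mono: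
  assumes "norm u = 1" "0 \<le> a" "a \<le> b" "b \<le> d" "d < 1"
  shows "len u a b \<le> len u a d"
  using len_combine[OF assms] len_nonneg[of u b d] assms by simp

lemma len_le:
  assumes "norm u = 1" "0 \<le> a" "a \<le> b" "b < 1" "\<And>t. a \<le> t \<Longrightarrow> t \<le> b \<Longrightarrow> D (of_real t * u) \<le> B"
  shows "len u a b \<le> B * (b - a)"
proof -
  have "len u a b \<le> integral {a..b} (\<lambda>t. B)"
    using assms by (intro integral_le integrable_D integrable_const_ivl) auto
  then show ?thesis using assms by (simp add: mult.commute)
qed

lemma len_ge:
  assumes "norm u = 1" "0 \<le> a" "a \<le> b" "b < 1" "\<And>t. a \<le> t \<Longrightarrow> t \<le> b \<Longrightarrow> B \<le> D (of_real t * u)"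
  shows "B * (b - a) \<le> len u a b"
proof -
  have "integral {a..b} (\<lambda>t. B) \<le> len u a b"
    using assms by (intro integral_le integrable_D integrable_const_ivl) auto
  then show ?thesis using assms by (simp add: mult.commute)
qed

text \<open>One use of \<open>near\<close> moves the radius \<open>r\<close> to
  \<open>r + \<delta> * (1 - r)\<close>, which multiplies \<open>1 - r\<close> by
  \<open>1 - \<delta>\<close> and costs a factor 2; the last hypothesis says that \<open>n\<close>
  such moves reach \<open>\<rho>\<close>.\<close>

lemma harnack_power:
  assumes "norm u = 1" "0 \<le> r" "r \<le> \<rho>" "\<rho> < 1" "(1 - \<delta>) ^ n * (1 - r) \<le> 1 - \<rho>"
  shows "D (of_real \<rho> * u) \<le> 2 ^ n * D (of_real r * u) \<and> D (of_real r * u) \<le> 2 ^ n * D (of_real \<rho> * u)"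
  using assms(2-)
proof (induction n arbitrary: r)
  case 0
  then have "r = \<rho>" by simp
  then show ?case by simp
next
  case (Suc n)
  have pos: "0 < D (of_real r * u)" "0 < D (of_real \<rho> * u)"
    using D_radius_pos assms(1) Suc.prems by auto
  have step: "D (of_real b * u) \<le> 2 * D (of_real r * u) \<and> D (of_real r * u) \<le> 2 * D (of_real b * u)"
    if "r \<le> b" "b - r \<le> \<delta> * (1 - r)" for b
  proof -
    have "norm (of_real b * u - of_real r * u) = b - r"
      using that assms(1) by (simp add: norm_mult flip: left_diff_distrib of_real_diff)
    then show ?thesis
      using near[of "of_real r * u" "of_real b * u"] that radius_in_disk[OF assms(1), of r] Suc.prems by simp
  qed
  show ?case
  proof (cases "\<rho> - r \<le> \<delta> * (1 - r)")
    case True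
    have "2 * D (of_real r * u) \<le> 2 ^ Suc n * D (of_real r * u)"
         "2 * D (of_real \<rho> * u) \<le> 2 ^ Suc n * D (of_real \<rho> * u)"
      using pos by simp_all
    then show ?thesis using step[OF \<open>r \<le> \<rho>\<close> True] by linarith
  next
    case False
    define b where "b = r + \<delta> * (1 - r)"
    have b: "r \<le> b" "b \<le> \<rho>" "b - r \<le> \<delta> * (1 - r)" using False Suc.prems \<delta> by (simp_all add: b_def)
    have "(1 - \<delta>) ^ n * (1 - b) \<le> 1 - \<rho>" using Suc.prems by (simp add: b_def algebra_simps)
    then have "D (of_real \<rho> * u) \<le> 2 ^ n * D (of_real b * u)" "D (of_real b * u) \<le> 2 ^ n * D (of_real \<rho> * u)"
      using Suc.IH[of b] b Suc.prems by auto
    then have "D (of_real \<rho> * u) \<le> 2 ^ n * (2 * D (of_real r * u))"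
         "D (of_real r * u) \<le> 2 * (2 ^ n * D (of_real \<rho> * u))"
      using step[OF b(1,3)] by (meson mult_left_mono order_trans zero_le_numeral zero_le_power)+
    then show ?thesis by (simp add: algebra_simps)
  qed
qed

lemma harnack:
  assumes "0 < \<kappa>"
  obtains C where "1 \<le> C" "\<And>u r \<rho>. norm u = 1 \<Longrightarrow> 0 \<le> r \<Longrightarrow> r \<le> \<rho> \<Longrightarrow> \<rho> < 1 \<Longrightarrow> \<kappa> * (1 - r) \<le> 1 - \<rho> \<Longrightarrow>
      D (of_real \<rho> * u) \<le> C * D (of_real r * u) \<and> D (of_real r * u) \<le> C * D (of_real \<rho> * u)"
proof -
  obtain n where n: "(1 - \<delta>) ^ n < \<kappa>"
    using real_arch_pow_inv[OF \<open>0 < \<kappa>\<close>, of "1 - \<delta>"] \<delta> by auto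
  show thesis
  proof (rule that[of "2 ^ n"])
    fix u :: complex and r \<rho> :: real
    assume *: "norm u = 1" "0 \<le> r" "r \<le> \<rho>" "\<rho> < 1" "\<kappa> * (1 - r) \<le> 1 - \<rho>"
    have "(1 - \<delta>) ^ n * (1 - r) \<le> \<kappa> * (1 - r)" using n * by (intro mult_right_mono) auto
    then show "D (of_real \<rho> * u) \<le> 2 ^ n * D (of_real r * u) \<and> D (of_real r * u) \<le> 2 ^ n * D (of_real \<rho> * u)"
      using * by (intro harnack_power) linarith+
  qed simp
qed

text \<open>The angle pi * (1 - r) is the one in \<open>B_box\<close>. The arc has length at most pi
  * (1 - r), so the number of \<open>near\<close> steps that cover it depends on
  \<open>\<delta>\<close> only.\<close>

lemma angular_harnack:
  obtains C where "0 \<le> C" "\<And>u r a. norm u = 1 \<Longrightarrow> 0 \<le> r \<Longrightarrow> r < 1 \<Longrightarrow> \<bar>a\<bar> \<le> pi * (1 - r) \<Longrightarrow>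
      D (of_real r * (u * cis a)) \<le> C * D (of_real r * u) \<and>
      norm (f (of_real r * (u * cis a)) - f (of_real r * u)) \<le> C * v (of_real r * u)"
proof -
  obtain N :: nat where N: "pi / \<delta> < real N" "N > 0"
    using reals_Archimedean2[of "pi / \<delta>"] \<delta> pi_gt_zero
    by (metis divide_pos_pos less_trans of_nat_0_less_iff)
  \<comment> \<open>The next step moves the image by at most
    \<open>2 ^ (j + 1) * v (of_real r * u)\<close>, which is the bound reached by all previous steps
    together; so the bound for the total displacement doubles.\<close>
  have main: "D (of_real r * (u * cis (real j * b))) \<le> 2 ^ j * D (of_real r * u) \<and>
      norm (f (of_real r * (u * cis (real j * b))) - f (of_real r * u)) \<le> 2 ^ (j + 1) * v (of_real r * u)"
    if u: "norm u = 1" and r: "0 \<le> r" "r < 1" and b: "\<bar>b\<bar> \<le> \<delta> * (1 - r)" for u r b j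
  proof (induction j)
    case 0
    show ?case using v_radius_pos[OF u r] by simp
  next
    case (Suc j)
    let ?p = "\<lambda>j. of_real r * (u * cis (real j * b))"
    have nu: "norm (u * cis (real j * b)) = 1" using u by (simp add: norm_mult)
    have "?p (Suc j) - ?p j = of_real r * (u * cis (real j * b)) * (cis b - 1)"
      by (simp add: algebra_simps cis_mult)
    then have "norm (?p (Suc j) - ?p j) = r * norm (cis b - 1)"
      using u r by (simp add: norm_mult)
    also have "\<dots> \<le> 1 * \<bar>b\<bar>"
    proof (intro mult_mono)
      have "norm (cis b - 1) = 2 * \<bar>sin (b / 2)\<bar>"
        using dist_exp_i_1[of b] by (simp add: cis_conv_exp)
      also have "\<dots> \<le> \<bar>b\<bar>" using abs_sin_x_le_abs_x[of "b / 2"] by simp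
      finally show "norm (cis b - 1) \<le> \<bar>b\<bar>" .
    qed (use r in auto)
    finally have d: "norm (?p (Suc j) - ?p j) \<le> \<delta> * (1 - r)" using b by simp
    note nr = near[OF radius_in_disk(1)[OF nu r], of "?p (Suc j)"]
    have *: "D (?p (Suc j)) \<le> 2 * D (?p j)"
      "norm (f (?p (Suc j)) - f (?p j)) \<le> 2 * D (?p j) * norm (?p (Suc j) - ?p j)"
      using nr d radius_in_disk(2)[OF nu r] by auto
    have "2 * D (?p j) * norm (?p (Suc j) - ?p j) \<le> 2 * (2 ^ j * D (of_real r * u)) * (1 - r)"
    proof (intro mult_mono mult_left_mono)
      have "\<delta> * (1 - r) \<le> 1 * (1 - r)" using \<delta> r by (intro mult_right_mono) auto
      then show "norm (?p (Suc j) - ?p j) \<le> 1 - r" using d by simp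
    qed (use Suc.IH D_radius_pos[OF u r] D_radius_pos[OF nu r] in auto)
    also have "\<dots> = 2 ^ (j + 1) * v (of_real r * u)"
      using radius_in_disk(3)[OF u r] by simp
    finally have "norm (f (?p (Suc j)) - f (?p j)) \<le> 2 ^ (j + 1) * v (of_real r * u)" using *(2) by linarith
    then have "norm (f (?p (Suc j)) - f (of_real r * u)) \<le> 2 ^ (Suc j + 1) * v (of_real r * u)"
      using Suc.IH norm_triangle_le[of "f (?p (Suc j)) - f (?p j)" "f (?p j) - f (of_real r * u)"]
      by simp
    then show ?case using * Suc.IH by simp
  qed
  show thesis
  proof (rule that[of "2 ^ (N + 1)"])
    fix u :: complex and r a :: real
    assume *: "norm u = 1" "0 \<le> r" "r < 1" "\<bar>a\<bar> \<le> pi * (1 - r)"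
    have aN: "real N * (a / real N) = a" using N by simp
    have "\<bar>a / real N\<bar> \<le> pi * (1 - r) / real N" using * N by (simp add: divide_right_mono)
    also have "\<dots> \<le> \<delta> * (1 - r)"
    proof -
      have "pi \<le> \<delta> * real N" using N \<delta> by (simp add: field_simps)
      then have "pi * (1 - r) \<le> \<delta> * real N * (1 - r)" using * by (intro mult_right_mono) auto
      then show ?thesis using N by (simp add: field_simps)
    qed
    finally have "D (of_real r * (u * cis (real N * (a / real N)))) \<le> 2 ^ N * D (of_real r * u) \<and>
      norm (f (of_real r * (u * cis (real N * (a / real N)))) - f (of_real r * u)) \<le> 2 ^ (N + 1) * v (of_real r * u)"
      using main[OF *(1-3)] by blast
    moreover have "2 ^ N * D (of_real r * u) \<le> 2 ^ (N + 1) * D (of_real r * u)"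
      using D_radius_pos[OF *(1-3)] by simp
    ultimately show "D (of_real r * (u * cis a)) \<le> 2 ^ (N + 1) * D (of_real r * u) \<and>
      norm (f (of_real r * (u * cis a)) - f (of_real r * u)) \<le> 2 ^ (N + 1) * v (of_real r * u)"
      unfolding aN by (blast intro: order_trans)
  qed simp
qed

section \<open>Image discs and the distance to the boundary\<close>

lemma open_image: "U \<subseteq> \<D> \<Longrightarrow> open U \<Longrightarrow> open (f ` U)"
  using invariance_of_domain continuous_on_subset[OF cont_f] inj_on_subset[OF inj_f] by blast

text \<open>The lower bound in \<open>near\<close> keeps the image of the circle of radius
  \<open>s\<close> at distance at least \<open>c * D z * s\<close> from \<open>f z\<close>, and an
  open map then covers the disc of that radius.\<close>

lemma ball_subset_image_ball:
  assumes "z \<in> \<D>" "0 < s" "s \<le> \<delta> * (1 - norm z)"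
  shows "ball (f z) (c * D z * s) \<subseteq> f ` ball z s"
proof -
  have "\<delta> * (1 - norm z) < 1 * (1 - norm z)" using \<delta> assms by (intro mult_strict_right_mono) auto
  then have "s < 1 - norm z" using assms by simp
  then have sub: "cball z s \<subseteq> \<D>"
    by (auto simp: subset_iff dist_norm intro: le_less_trans[OF norm_triangle_sub[of _ z]] simp: norm_minus_commute)
  show ?thesis
  proof (rule ball_subset_open_map_image)
    show "continuous_on (closure (ball z s)) f"
      using continuous_on_subset[OF cont_f sub] assms by simp
    show "open (f ` interior (ball z s))"
      using open_image[OF order_trans[OF ball_subset_cball sub]] by (simp add: interior_open)
    show "c * D z * s \<le> norm (f w - f z)" if "w \<in> frontier (ball z s)" for w
    proof -
      have "norm (w - z) = s" using that assms by (simp add: dist_norm norm_minus_commute)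
      then show ?thesis using near[OF assms(1), of w] assms by auto
    qed
  qed (use assms c D_pos in auto)
qed

text \<open>The counterpart of the Koebe quarter theorem. Boundedness makes the frontier nonempty;
  \<open>infdist\<close> to an empty set would be 0 by convention.\<close>

lemma boundary_dist_ge:
  assumes "z \<in> \<D>" "bounded (f ` \<D>)"
  shows "c * \<delta> * v z \<le> boundary_dist (f ` \<D>) (f z)"
proof -
  let ?G = "f ` \<D>"
  have "?G \<noteq> {}" "?G \<noteq> UNIV" using assms(1) not_bounded_UNIV assms(2) by auto
  then have ne: "frontier ?G \<noteq> {}" by (simp add: frontier_eq_empty)
  have "open ?G" by (rule open_image) auto
  have s: "0 < \<delta> * (1 - norm z)" using \<delta> assms by simp
  have "\<delta> * (1 - norm z) \<le> 1 * (1 - norm z)" using \<delta> assms by (intro mult_right_mono) auto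
  then have "ball z (\<delta> * (1 - norm z)) \<subseteq> \<D>"
    by (auto simp: subset_iff dist_norm norm_minus_commute intro: le_less_trans[OF norm_triangle_sub[of _ z]])
  then have "ball (f z) (c * D z * (\<delta> * (1 - norm z))) \<subseteq> ?G"
    using ball_subset_image_ball[OF assms(1) s] by blast
  then have "\<not> dist (f z) y < c * D z * (\<delta> * (1 - norm z))" if "y \<in> frontier ?G" for y
    using that \<open>open ?G\<close> by (auto simp: frontier_def interior_open subset_iff)
  then have "c * D z * (\<delta> * (1 - norm z)) \<le> infdist (f z) (frontier ?G)"
    using ne by (simp add: infdist_notempty cINF_greatest not_less)
  then show ?thesis by (simp add: boundary_dist_def v_def algebra_simps)
qed

end

section \<open>Distortion of harmonic quasiconformal mappings\<close>

lemma diff_minus_linear_bound: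
  assumes "F holomorphic_on S" "open S" "convex T" "T \<subseteq> S" "z \<in> T" "w \<in> T"
    and "\<And>u. u \<in> T \<Longrightarrow> norm (deriv F u - a) \<le> B"
  shows "norm (F w - F z - a * (w - z)) \<le> B * norm (w - z)"
proof -
  have "norm ((F w - a * w) - (F z - a * z)) \<le> B * norm (w - z)"
  proof (rule field_differentiable_bound[OF \<open>convex T\<close>])
    fix u assume u: "u \<in> T"
    then have "(F has_field_derivative deriv F u) (at u within T)"
      using assms(1,2,4) holomorphic_derivI by blast
    then show "((\<lambda>x. F x - a * x) has_field_derivative deriv F u - a) (at u within T)"
      by (auto intro!: derivative_eq_intros)
  qed (use assms in auto)
  then show ?thesis by (simp add: algebra_simps)
qed

section \<open>Derivatives of harmonic mappings\<close>

context harmonic_map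
begin

lemma f_has_derivative:
  assumes z: "z \<in> \<D>"
  shows "(f has_derivative (\<lambda>v. deriv h z * v + cnj (deriv g z * v))) (at z)"
proof -
  have "(h has_derivative (*) (deriv h z)) (at z)" "(g has_derivative (*) (deriv g z)) (at z)"
    using holomorphic_derivI[OF holh open_ball z] holomorphic_derivI[OF holg open_ball z]
    by (auto dest: has_field_derivative_imp_has_derivative)
  then have "((\<lambda>z. h z + cnj (g z)) has_derivative (\<lambda>v. deriv h z * v + cnj (deriv g z * v))) (at z)"
    by (intro has_derivative_add has_derivative_cnj)
  then show ?thesis
    by (rule has_derivative_transform_within_open[OF _ open_ball z]) (simp add: f_eq)
qed

lemma Wirtinger_derivatives:
  assumes z: "z \<in> \<D>"
  shows "dz f z = deriv h z" "dzbar f z = cnj (deriv g z)"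
proof -
  have "frechet_derivative f (at z) = (\<lambda>v. deriv h z * v + cnj (deriv g z * v))"
    using frechet_derivative_at[OF f_has_derivative[OF z]] by simp
  then show "dz f z = deriv h z" "dzbar f z = cnj (deriv g z)"
    by (simp_all add: dz_def dzbar_def algebra_simps)
qed

lemma Dnorm_eq: "z \<in> \<D> \<Longrightarrow> Dnorm f z = norm (deriv h z) + norm (deriv g z)"
  by (simp add: Dnorm_def Wirtinger_derivatives)

lemma jacobian_eq: "z \<in> \<D> \<Longrightarrow> jacobian f z = (norm (deriv h z))\<^sup>2 - (norm (deriv g z))\<^sup>2"
  by (simp add: jacobian_def Wirtinger_derivatives)

end

context harmonic_qc
begin

lemma continuous_on_f: "continuous_on \<D> f"
  using f_has_derivative by (meson continuous_at_imp_continuous_on has_derivative_continuous)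

lemma continuous_on_Dnorm: "continuous_on \<D> (Dnorm f)"
proof -
  have "continuous_on \<D> (\<lambda>z. norm (deriv h z) + norm (deriv g z))"
    using holh holg
    by (intro continuous_intros holomorphic_on_imp_continuous_on holomorphic_deriv) auto
  then show ?thesis by (rule continuous_on_eq) (simp add: Dnorm_eq)
qed

lemma dist_le_integral_Dnorm:
  assumes u: "norm u = 1" and ab: "0 \<le> a" "a \<le> b" "b < 1"
  shows "norm (f (of_real b * u) - f (of_real a * u)) \<le> integral {a..b} (\<lambda>t. Dnorm f (of_real t * u))"
proof -
  let ?d = "\<lambda>t. deriv h (of_real t * u) * u + cnj (deriv g (of_real t * u) * u)"
  have ind: "of_real t * u \<in> \<D>" if "t \<in> {a..b}" for t
    using that ab u by (simp add: norm_mult)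
  have der: "((\<lambda>t. f (of_real t * u)) has_vector_derivative ?d t) (at t within {a..b})" if "t \<in> {a..b}" for t
  proof -
    have "((\<lambda>t. of_real t * u) has_derivative (\<lambda>t. of_real t * u)) (at t within {a..b})"
      by (auto intro!: derivative_eq_intros)
    then have "((\<lambda>t. f (of_real t * u)) has_derivative
        (\<lambda>s. deriv h (of_real t * u) * (of_real s * u) + cnj (deriv g (of_real t * u) * (of_real s * u))))
        (at t within {a..b})"
      by (rule has_derivative_compose[where f = "\<lambda>t. of_real t * u", OF _ f_has_derivative[OF ind[OF that]]])
    then show ?thesis
      unfolding has_vector_derivative_def by (simp add: scaleR_conv_of_real algebra_simps)
  qed
  have *: "(?d has_integral (f (of_real b * u) - f (of_real a * u))) {a..b}"
    using fundamental_theorem_of_calculus[OF \<open>a \<le> b\<close> der] .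
  have "continuous_on {a..b} (\<lambda>t. Dnorm f (of_real t * u))"
    using ind by (intro continuous_on_compose2[OF continuous_on_Dnorm] continuous_intros) auto
  then have "(\<lambda>t. Dnorm f (of_real t * u)) integrable_on {a..b}"
    by (rule integrable_continuous_interval)
  moreover have "norm (?d t) \<le> Dnorm f (of_real t * u)" if "t \<in> {a..b}" for t
  proof -
    have "norm (?d t) \<le> norm (deriv h (of_real t * u) * u) + norm (cnj (deriv g (of_real t * u) * u))"
      by (rule norm_triangle_ineq)
    then show ?thesis using Dnorm_eq[OF ind[OF that]] u by (simp add: norm_mult)
  qed
  ultimately have "norm (integral {a..b} ?d) \<le> integral {a..b} (\<lambda>t. Dnorm f (of_real t * u))"
    using * by (intro integral_norm_bound_integral) auto
  then show ?thesis using integral_unique[OF *] by simp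
qed

text \<open>\<open>log_deriv_bound\<close> makes the logarithm of \<open>deriv h\<close> Lipschitz
  at the scale \<open>1 - norm z\<close>, and the dilatation \<open>\<omega>\<close> is Lipschitz at
  that scale because it is bounded. Both errors are measured by \<open>deriv h\<close>, since
  \<open>deriv g\<close> may vanish.\<close>

lemma derivatives_nearly_constant:
  assumes "0 < e" "e \<le> 1"
  obtains \<delta> where "0 < \<delta>" "\<delta> \<le> 1/4"
    "\<And>z w. z \<in> \<D> \<Longrightarrow> norm (w - z) \<le> \<delta> * (1 - norm z) \<Longrightarrow>
       norm (deriv h w - deriv h z) \<le> e * norm (deriv h z) \<and>
       norm (deriv g w - deriv g z) \<le> 2 * e * norm (deriv h z)"
proof -
  obtain \<phi> where hol\<phi>: "\<phi> holomorphic_on \<D>" and \<phi>: "\<And>z. z \<in> \<D> \<Longrightarrow> deriv h z = exp (\<phi> z)"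
    using contractible_imp_holomorphic_log[OF holomorphic_deriv[OF holh open_ball]
        convex_imp_contractible[OF convex_ball] h'_nz] by metis
  obtain M where "M > 0" and M: "\<And>z. z \<in> \<D> \<Longrightarrow> (1 - norm z) * norm (deriv \<phi> z) \<le> M"
    using log_deriv_bound[OF hol\<phi> \<phi>] by blast
  define \<omega> where "\<omega> z = deriv g z / deriv h z" for z
  have hol\<omega>: "\<omega> holomorphic_on \<D>"
    unfolding \<omega>_def using holh holg h'_nz by (intro holomorphic_intros) auto
  have \<omega>1: "norm (\<omega> z) \<le> k" if "z \<in> \<D>" for z
    using dilat[OF that] h'_nz[OF that] by (simp add: \<omega>_def norm_divide divide_simps)
  \<comment> \<open>\<open>6 * M * \<delta> \<le> e\<close> serves the exponential: 3 comes from
    \<open>norm_exp_diff_le\<close>, and \<open>2 * M * \<delta>\<close> bounds the variation of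
    \<open>\<phi>\<close>. The other bound, \<open>4 * \<delta> \<le> e\<close>, absorbs the
    variation of \<open>\<omega>\<close>.\<close>
  define \<delta> where "\<delta> = min (e / 4) (e / (6 * M))"
  have d1: "0 < \<delta>" "\<delta> \<le> e / 4" "6 * M * \<delta> \<le> e"
    using assms \<open>M > 0\<close> by (auto simp: \<delta>_def min_def field_simps)
  then have d2: "\<delta> \<le> 1/4" using assms by simp
  show thesis
  proof (rule that[OF d1(1) d2])
    fix z w assume z: "z \<in> \<D>" and w: "norm (w - z) \<le> \<delta> * (1 - norm z)"
    \<comment> \<open>\<open>T\<close> stays within modulus \<open>norm z + s / 2\<close>, so discs
      of radius \<open>s\<close> about its points remain in \<open>\<D>\<close>, as
      \<open>norm z + 2 * s = 1\<close>.\<close>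
    define s where "s = (1 - norm z) / 2"
    have "s > 0" using z by (simp add: s_def)
    have "2 * s = 1 - norm z" by (simp add: s_def)
    then have w': "norm (w - z) \<le> \<delta> * (2 * s)" using w by simp
    define T where "T = cball z (\<delta> * (1 - norm z))"
    have mod: "norm u \<le> norm z + s / 2" if "u \<in> T" for u
    proof -
      have "norm (u - z) \<le> \<delta> * (1 - norm z)" using that by (simp add: T_def dist_norm norm_minus_commute)
      also have "\<dots> \<le> 1/4 * (1 - norm z)" using d2 z by (intro mult_right_mono) auto
      finally show ?thesis using norm_triangle_sub[of u z] by (simp add: s_def field_simps)
    qed
    have "norm z + s / 2 < 1" using z by (simp add: s_def field_simps)
    then have T: "T \<subseteq> \<D>" "convex T" "z \<in> T" "w \<in> T"
      using mod d1 z w by (force, auto simp: T_def dist_norm norm_minus_commute)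
    have "norm (\<phi> w - \<phi> z) \<le> M / s * norm (w - z)"
    proof (rule field_differentiable_bound[OF T(2)])
      fix u assume u: "u \<in> T"
      then have "u \<in> \<D>" using T by blast
      then show "(\<phi> has_field_derivative deriv \<phi> u) (at u within T)"
        using hol\<phi> holomorphic_derivI by blast
      have "s * norm (deriv \<phi> u) \<le> (1 - norm u) * norm (deriv \<phi> u)"
        using mod[OF u] \<open>s > 0\<close> by (intro mult_right_mono) (auto simp: s_def field_simps)
      then show "norm (deriv \<phi> u) \<le> M / s"
        using M[OF \<open>u \<in> \<D>\<close>] \<open>s > 0\<close> by (simp add: field_simps)
    qed (use T in auto)
    also have "\<dots> \<le> M / s * (\<delta> * (2 * s))"
      using w' \<open>M > 0\<close> \<open>s > 0\<close> by (intro mult_left_mono) auto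
    also have "\<dots> = 2 * M * \<delta>" using \<open>s > 0\<close> by simp
    finally have \<phi>d: "norm (\<phi> w - \<phi> z) \<le> 2 * M * \<delta>" .
    then have "norm (\<phi> w - \<phi> z) \<le> 1" using d1 assms \<open>M > 0\<close> by simp
    then have "norm (exp (\<phi> w) - exp (\<phi> z)) \<le> 3 * norm (\<phi> w - \<phi> z) * norm (exp (\<phi> z))"
      by (rule norm_exp_diff_le)
    also have "\<dots> \<le> e * norm (exp (\<phi> z))"
      using \<phi>d d1 by (intro mult_right_mono) auto
    finally have h: "norm (deriv h w - deriv h z) \<le> e * norm (deriv h z)"
      using \<phi> T z by (simp add: subset_iff)
    have "norm (\<omega> w - \<omega> z) \<le> k / s * norm (w - z)"
    proof (rule holomorphic_lipschitz_of_bounded[OF hol\<omega> open_ball \<open>s > 0\<close> \<omega>1 T(2) _ T(3,4)])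
      fix u assume "u \<in> T"
      show "cball u s \<subseteq> \<D>"
      proof
        fix x assume "x \<in> cball u s"
        then have "norm (x - u) \<le> s" by (simp add: dist_norm norm_minus_commute)
        then have "norm x \<le> norm z + s / 2 + s"
          using mod[OF \<open>u \<in> T\<close>] norm_triangle_sub[of x u] by linarith
        then show "x \<in> \<D>" using z by (simp add: s_def field_simps)
      qed
    qed
    also have "\<dots> \<le> 1 / s * (\<delta> * (2 * s))"
      using w' k \<open>s > 0\<close> by (intro mult_mono divide_right_mono) auto
    also have "\<dots> = 2 * \<delta>" using \<open>s > 0\<close> by simp
    finally have \<omega>d: "norm (\<omega> w - \<omega> z) \<le> 2 * \<delta>" .
    have "norm (deriv h w) \<le> norm (deriv h z) + e * norm (deriv h z)"
      using h norm_triangle_sub[of "deriv h w" "deriv h z"] by linarith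
    also have "\<dots> \<le> 2 * norm (deriv h z)"
      using mult_right_mono[of e 1 "norm (deriv h z)"] assms by simp
    finally have h2: "norm (deriv h w) \<le> 2 * norm (deriv h z)" .
    have "deriv h z \<noteq> 0" "deriv h w \<noteq> 0" using h'_nz T by blast+
    then have "deriv g w - deriv g z = (\<omega> w - \<omega> z) * deriv h w + \<omega> z * (deriv h w - deriv h z)"
      by (simp add: \<omega>_def field_simps)
    then have "norm (deriv g w - deriv g z)
        \<le> norm (\<omega> w - \<omega> z) * norm (deriv h w) + norm (\<omega> z) * norm (deriv h w - deriv h z)"
      by (metis norm_mult norm_triangle_ineq)
    also have "\<dots> \<le> 2 * \<delta> * (2 * norm (deriv h z)) + 1 * (e * norm (deriv h z))"
      using \<omega>d h2 h \<omega>1[OF z] k d1 by (intro add_mono mult_mono) auto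
    also have "\<dots> = (4 * \<delta> + e) * norm (deriv h z)" by (simp add: algebra_simps)
    also have "\<dots> \<le> 2 * e * norm (deriv h z)"
      using d1 by (intro mult_right_mono) auto
    finally show "norm (deriv h w - deriv h z) \<le> e * norm (deriv h z) \<and>
       norm (deriv g w - deriv g z) \<le> 2 * e * norm (deriv h z)"
      using h by simp
  qed
qed

lemma koebe_like_Dnorm: "\<exists>\<delta>. koebe_like f (Dnorm f) \<delta> ((1 - k) / 4)"
proof -
  \<comment> \<open>With \<open>m = norm (deriv h z)\<close>, the linearization errors of
    \<open>h\<close> and \<open>g\<close> add up to \<open>3 * e * m\<close>, which takes 3/8 of the
    least stretch \<open>(1 - k) * m\<close>. The remaining 5/8 exceed
    \<open>(1 - k) / 4 * Dnorm f z\<close> because \<open>Dnorm f z \<le> 2 * m\<close>.\<close>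
  define e where "e = (1 - k) / 8"
  have e: "0 < e" "e \<le> 1" using k by (simp_all add: e_def)
  obtain \<delta> where \<delta>: "0 < \<delta>" "\<delta> \<le> 1/4" and near: "\<And>z w. z \<in> \<D> \<Longrightarrow> norm (w - z) \<le> \<delta> * (1 - norm z) \<Longrightarrow>
       norm (deriv h w - deriv h z) \<le> e * norm (deriv h z) \<and>
       norm (deriv g w - deriv g z) \<le> 2 * e * norm (deriv h z)"
    using derivatives_nearly_constant[OF e] by blast
  have "koebe_like f (Dnorm f) \<delta> ((1 - k) / 4)"
  proof
    fix z w assume z: "z \<in> \<D>" and w: "norm (w - z) \<le> \<delta> * (1 - norm z)"
    define m where "m = norm (deriv h z)"
    define T where "T = cball z (\<delta> * (1 - norm z))"
    have "\<delta> * (1 - norm z) < 1 * (1 - norm z)" using \<delta> z by (intro mult_strict_right_mono) auto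
    then have "norm u < 1" if "norm (u - z) \<le> \<delta> * (1 - norm z)" for u
      using norm_triangle_sub[of u z] that by argo
    then have T: "T \<subseteq> \<D>" "convex T" "z \<in> T" "w \<in> T"
      using w \<delta> z by (auto simp: T_def dist_norm norm_minus_commute)
    then have "w \<in> \<D>" by blast
    have bd: "norm (deriv h u - deriv h z) \<le> e * m" "norm (deriv g u - deriv g z) \<le> 2 * e * m"
      if "u \<in> T" for u
      using near[OF z, of u] that by (auto simp: T_def m_def dist_norm norm_minus_commute)
    define eh where "eh = h w - h z - deriv h z * (w - z)"
    define eg where "eg = g w - g z - deriv g z * (w - z)"
    have eh: "norm eh \<le> e * m * norm (w - z)"
      unfolding eh_def using bd by (intro diff_minus_linear_bound[OF holh open_ball T(2,1,3,4)]) auto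
    have eg: "norm eg \<le> 2 * e * m * norm (w - z)"
      unfolding eg_def using bd by (intro diff_minus_linear_bound[OF holg open_ball T(2,1,3,4)]) auto
    have "f w - f z = deriv h z * (w - z) + (cnj (deriv g z * (w - z)) + (eh + cnj eg))"
      using f_eq z \<open>w \<in> \<D>\<close> by (simp add: eh_def eg_def algebra_simps)
    then obtain rest where rest: "f w - f z = deriv h z * (w - z) + rest"
      and "norm rest \<le> norm (deriv g z) * norm (w - z) + (norm eh + norm eg)"
      by (metis (no_types, lifting) add_mono complex_mod_cnj norm_mult norm_triangle_ineq norm_triangle_le order_refl)
    then have nr: "norm rest \<le> norm (deriv g z) * norm (w - z) + 3 * e * m * norm (w - z)"
      using eh eg by linarith
    have nl: "norm (deriv h z * (w - z)) = m * norm (w - z)" by (simp add: m_def norm_mult)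
    have up: "norm (f w - f z) \<le> m * norm (w - z) + norm rest"
      unfolding rest nl[symmetric] by (rule norm_triangle_ineq)
    have lo: "m * norm (w - z) - norm rest \<le> norm (f w - f z)"
      unfolding rest nl[symmetric] by (rule norm_diff_ineq)
    have g: "norm (deriv g z) \<le> k * m" using dilat[OF z] by (simp add: m_def)
    have D: "Dnorm f z = m + norm (deriv g z)" "m \<le> Dnorm f z" using Dnorm_eq[OF z] by (simp_all add: m_def)
    have "m > 0" using h'_nz[OF z] by (simp add: m_def)
    have em: "3 * e * m \<le> m / 2" using k \<open>m > 0\<close> by (simp add: e_def field_simps)
    have nh: "\<bar>norm (deriv h w) - m\<bar> \<le> e * m" "\<bar>norm (deriv g w) - norm (deriv g z)\<bar> \<le> 2 * e * m"
      using bd[OF T(4)] norm_triangle_ineq3[of "deriv h w" "deriv h z"]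
        norm_triangle_ineq3[of "deriv g w" "deriv g z"] by (auto simp: m_def)
    have "Dnorm f w \<le> Dnorm f z + 3 * e * m" "Dnorm f z \<le> Dnorm f w + 3 * e * m"
      using nh Dnorm_eq[OF z] Dnorm_eq[OF \<open>w \<in> \<D>\<close>] by (auto simp: m_def abs_le_iff)
    moreover have "norm (f w - f z) \<le> 2 * Dnorm f z * norm (w - z)"
    proof -
      have "norm (f w - f z) \<le> (Dnorm f z + 3 * e * m) * norm (w - z)"
        using up nr D by (simp add: algebra_simps)
      also have "\<dots> \<le> 2 * Dnorm f z * norm (w - z)"
      proof (rule mult_right_mono)
        show "Dnorm f z + 3 * e * m \<le> 2 * Dnorm f z" using em D(2) \<open>m > 0\<close> by linarith
      qed simp
      finally show ?thesis .
    qed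
    moreover have "(1 - k) / 4 * Dnorm f z * norm (w - z) \<le> norm (f w - f z)"
    proof -
      have "(1 - k) / 4 * Dnorm f z \<le> (1 - k) / 4 * (2 * m)"
      proof (rule mult_left_mono)
        have "k * m \<le> m" using k \<open>m > 0\<close> by simp
        then show "Dnorm f z \<le> 2 * m" using D g by simp
      qed (use k in simp)
      also have "\<dots> \<le> m - k * m - 3 * e * m"
        using k \<open>m > 0\<close> by (simp add: e_def field_simps)
      also have "\<dots> \<le> m - norm (deriv g z) - 3 * e * m" using g by simp
      finally have "(1 - k) / 4 * Dnorm f z * norm (w - z) \<le> (m - norm (deriv g z) - 3 * e * m) * norm (w - z)"
        by (rule mult_right_mono) simp
      also have "\<dots> \<le> norm (f w - f z)" using lo nr by (simp add: algebra_simps)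
      finally show ?thesis .
    qed
    ultimately show "Dnorm f w \<le> 2 * Dnorm f z \<and> Dnorm f z \<le> 2 * Dnorm f w \<and>
        (1 - k) / 4 * Dnorm f z * norm (w - z) \<le> norm (f w - f z) \<and>
        norm (f w - f z) \<le> 2 * Dnorm f z * norm (w - z)"
      using em D \<open>m > 0\<close> by (intro conjI) linarith+
  next
    show "0 < Dnorm f z" if "z \<in> \<D>" for z
      using Dnorm_eq[OF that] h'_nz[OF that] by (simp add: add_pos_nonneg)
  qed (use inj_f continuous_on_f continuous_on_Dnorm dist_le_integral_Dnorm \<delta> k in auto)
  then show ?thesis by blast
qed

end

section \<open>Contraction along radii\<close>

text \<open>\<open>\<rho>\<close> is the image of \<open>r\<close> under the hyperbolic translation
  along the diameter that sends 0 to \<open>x\<close>; hence \<open>1 - \<rho>\<close> is comparable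
  to \<open>1 - r\<close> with constants depending on \<open>x\<close> only.\<close>

lemma hyperbolic_translation:
  fixes x r :: real
  assumes "0 < x" "x < 1" "0 \<le> r" "r < 1"
  defines "\<rho> \<equiv> (x + r) / (1 + x * r)"
  shows "r \<le> \<rho>" "\<rho> < 1" "(1 - x) / 2 * (1 - r) \<le> 1 - \<rho>" "1 - \<rho> \<le> (1 - x) * (1 - r)"
proof -
  have pos: "1 + x * r > 0" "0 \<le> x * r" using assms by (simp_all add: add_pos_nonneg)
  have "1 + x * r \<le> 2" using assms mult_mono[of x 1 r 1] by simp
  have eq: "1 - \<rho> = (1 - x) * (1 - r) / (1 + x * r)"
    unfolding \<rho>_def using pos by (simp add: field_simps)
  have n: "0 < (1 - x) * (1 - r)" using assms by simp
  show "\<rho> < 1" using divide_pos_pos[OF n pos(1)] eq by simp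
  show "1 - \<rho> \<le> (1 - x) * (1 - r)"
    unfolding eq using n pos by (simp add: divide_le_eq mult_le_cancel_left1)
  have "(1 - x) * (1 - r) / 2 \<le> (1 - x) * (1 - r) / (1 + x * r)"
    using n pos \<open>1 + x * r \<le> 2\<close> by (intro divide_left_mono) auto
  then show "(1 - x) / 2 * (1 - r) \<le> 1 - \<rho>" unfolding eq by simp
  have "(1 - x) * (1 - r) \<le> 1 * (1 - r)" using assms by (intro mult_right_mono) auto
  then show "r \<le> \<rho>" using \<open>1 - \<rho> \<le> (1 - x) * (1 - r)\<close> by simp
qed

section \<open>Radii that successively halve the distance to 1\<close>

definition dyadic :: "real \<Rightarrow> nat \<Rightarrow> real" where
  "dyadic r n = 1 - (1 - r) / 2 ^ n"

lemma dyadic_0 [simp]: "dyadic r 0 = r"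
  by (simp add: dyadic_def)

lemma dyadic_Suc: "1 - dyadic r (Suc n) = (1 - dyadic r n) / 2"
  by (simp add: dyadic_def)

lemma dyadic_bounds:
  assumes "0 \<le> r" "r < 1"
  shows "dyadic r n < 1" "dyadic r n \<le> dyadic r (Suc n)" "m \<le> n \<Longrightarrow> dyadic r m \<le> dyadic r n"
    "0 \<le> dyadic r n"
proof -
  show lt: "dyadic r n < 1" for n using assms by (simp add: dyadic_def)
  show step: "dyadic r n \<le> dyadic r (Suc n)" for n using dyadic_Suc[of r n] lt[of n] by simp
  show mono: "dyadic r m \<le> dyadic r n" if "m \<le> n" for m n
    using lift_Suc_mono_le[of "dyadic r"] step that by blast
  show "0 \<le> dyadic r n" using mono[of 0 n] assms(1) by simp
qed

lemma dyadic_exceeds: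
  assumes "r < 1" "0 \<le> r" "R < 1"
  shows "\<exists>n. R \<le> dyadic r n"
proof -
  obtain n where "(1/2::real) ^ n < 1 - R"
    using real_arch_pow_inv[of "1 - R" "1/2"] assms by auto
  moreover have "(1 - r) / 2 ^ n \<le> (1/2) ^ n"
    using assms by (simp add: power_one_over divide_right_mono field_simps)
  ultimately show ?thesis unfolding dyadic_def by (intro exI[of _ n]) linarith
qed

context koebe_like
begin

text \<open>Condition (ii) with \<open>q\<close> as bound of the supremum and the quotient
  multiplied out; as there, \<open>r = 0\<close> is excluded.\<close>

definition contraction :: "real \<Rightarrow> real \<Rightarrow> bool" where
  "contraction x q \<longleftrightarrow> (\<forall>u r. norm u = 1 \<longrightarrow> 0 < r \<longrightarrow> r < 1 \<longrightarrow>
     (let \<rho> = (x + r) / (1 + x * r) in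
        (1 - \<rho>\<^sup>2) * D (of_real \<rho> * u) \<le> q * ((1 - r\<^sup>2) * D (of_real r * u))))"

lemma weight_bounds:
  assumes "norm u = 1" "0 \<le> r" "r < 1"
  shows "v (of_real r * u) \<le> (1 - r\<^sup>2) * D (of_real r * u)"
    "(1 - r\<^sup>2) * D (of_real r * u) \<le> 2 * v (of_real r * u)"
proof -
  have "1 - r\<^sup>2 = (1 + r) * (1 - r)" by (simp add: power2_eq_square algebra_simps)
  then have "1 - r \<le> 1 - r\<^sup>2" "1 - r\<^sup>2 \<le> 2 * (1 - r)"
    using assms mult_right_mono[of 1 "1 + r" "1 - r"] mult_right_mono[of "1 + r" 2 "1 - r"] by auto
  then show "v (of_real r * u) \<le> (1 - r\<^sup>2) * D (of_real r * u)"
    "(1 - r\<^sup>2) * D (of_real r * u) \<le> 2 * v (of_real r * u)"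
    using radius_in_disk(3)[OF assms] D_radius_pos[OF assms]
    by (auto simp: mult.assoc[symmetric] intro!: mult_right_mono)
qed

lemma len_le_v:
  assumes C: "\<And>t. r \<le> t \<Longrightarrow> t \<le> R \<Longrightarrow> D (of_real t * u) \<le> C * D (of_real r * u)"
    and "norm u = 1" "0 \<le> r" "r \<le> R" "R < 1" "0 \<le> C"
  shows "len u r R \<le> C * v (of_real r * u)"
proof -
  have "len u r R \<le> C * D (of_real r * u) * (R - r)"
    using assms by (intro len_le) auto
  also have "\<dots> \<le> C * D (of_real r * u) * (1 - r)"
    using assms D_radius_pos[of u r] by (intro mult_left_mono) auto
  also have "\<dots> = C * v (of_real r * u)"
    using radius_in_disk(3)[of u r] assms by (simp add: mult.commute mult.left_commute)
  finally show ?thesis .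
qed

text \<open>Iterating the translation cuts a radius into segments of equal hyperbolic length. By
  Harnack each has image length at most a multiple of the weight at its inner end, and these weights
  decrease at least like the powers of \<open>q\<close>.\<close>

lemma contraction_imp_radial_decay:
  assumes x: "0 < x" "x < 1" and q: "0 \<le> q" "q < 1" and con: "contraction x q"
  shows radial_decay
proof -
  define T where "T r = (x + r) / (1 + x * r)" for r
  have T: "r \<le> T r" "T r < 1" "(1 - x) / 2 * (1 - r) \<le> 1 - T r" "1 - T r \<le> (1 - x) * (1 - r)"
    if "0 \<le> r" "r < 1" for r
    unfolding T_def using hyperbolic_translation[OF x that] by auto
  define W where "W u r = (1 - r\<^sup>2) * D (of_real r * u)" for u r
  have W: "W u (T r) \<le> q * W u r" if "norm u = 1" "0 < r" "r < 1" for u r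
    using con that unfolding contraction_def W_def T_def Let_def by blast
  obtain C where C: "1 \<le> C" and har: "\<And>u r \<rho>. norm u = 1 \<Longrightarrow> 0 \<le> r \<Longrightarrow> r \<le> \<rho> \<Longrightarrow> \<rho> < 1 \<Longrightarrow>
      (1 - x) / 2 * (1 - r) \<le> 1 - \<rho> \<Longrightarrow> D (of_real \<rho> * u) \<le> C * D (of_real r * u) \<and> D (of_real r * u) \<le> C * D (of_real \<rho> * u)"
    using harnack[of "(1 - x) / 2"] x by auto
  have step: "len u r (T r) \<le> C * v (of_real r * u)" if "norm u = 1" "0 \<le> r" "r < 1" for u r
  proof (rule len_le_v)
    fix t assume t: "r \<le> t" "t \<le> T r"
    have "(1 - x) / 2 * (1 - r) \<le> 1 - t" using T(3)[OF that(2,3)] t by linarith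
    then show "D (of_real t * u) \<le> C * D (of_real r * u)"
      using har[of u r t] that t T(2)[of r] by linarith
  qed (use T[of r] C that in auto)
  have iter: "0 < (T ^^ m) r \<and> r \<le> (T ^^ m) r \<and> (T ^^ m) r < 1 \<and> 1 - (T ^^ m) r \<le> (1 - x) ^ m * (1 - r)"
    if "0 < r" "r < 1" for r m
  proof (induction m)
    case (Suc m)
    have "1 - T ((T ^^ m) r) \<le> (1 - x) * (1 - (T ^^ m) r)" using T Suc by simp
    also have "\<dots> \<le> (1 - x) * ((1 - x) ^ m * (1 - r))" using Suc x by (intro mult_left_mono) auto
    finally show ?case using Suc T[of "(T ^^ m) r"] by (auto simp: mult.assoc)
  qed (use that in simp)
  \<comment> \<open>The constant \<open>X = C / (1 - q)\<close> solves \<open>X = C + q * X\<close>,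
    so splitting off the first segment reproduces it.\<close>
  have total: "len u r ((T ^^ m) r) \<le> C / (1 - q) * W u r" if "norm u = 1" "0 < r" "r < 1" for u r m
    using that(2,3)
  proof (induction m arbitrary: r)
    case 0
    then show ?case using C q weight_bounds(1)[of u r] v_radius_pos[of u r] that(1) by (simp add: W_def)
  next
    case (Suc m)
    have Tr: "0 < T r" "T r < 1" "r \<le> T r" using T[of r] Suc.prems by auto
    have "len u r ((T ^^ Suc m) r) = len u r ((T ^^ m) (T r))" by (simp add: funpow_swap1)
    also have "\<dots> = len u r (T r) + len u (T r) ((T ^^ m) (T r))"
      using iter[of "T r" m] Tr Suc.prems that(1) by (intro len_combine) auto
    also have "\<dots> \<le> C * W u r + C / (1 - q) * (q * W u r)"
    proof (intro add_mono)
      show "len u r (T r) \<le> C * W u r"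
        using step[of u r] weight_bounds(1)[of u r] C Suc.prems that(1)
        by (smt (verit) W_def mult_left_mono)
      have "len u (T r) ((T ^^ m) (T r)) \<le> C / (1 - q) * W u (T r)" using Suc.IH Tr by simp
      also have "\<dots> \<le> C / (1 - q) * (q * W u r)"
        using W[of u r] Suc.prems that(1) C q by (intro mult_left_mono) auto
      finally show "len u (T r) ((T ^^ m) (T r)) \<le> C / (1 - q) * (q * W u r)" .
    qed
    also have "\<dots> = C / (1 - q) * W u r" using q by (simp add: field_simps)
    finally show ?case .
  qed
  define B where "B = 2 * C / (1 - q)"
  have "0 \<le> B" using C q by (simp add: B_def)
  have main: "len u r R \<le> B * v (of_real r * u)" if "norm u = 1" "0 < r" "r \<le> R" "R < 1" for u r R
  proof -
    have "0 < 1 - R" using that by simp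
    then obtain m where m: "(1 - x) ^ m < 1 - R"
      using real_arch_pow_inv[of "1 - R" "1 - x"] x by auto
    have "(1 - x) ^ m * (1 - r) \<le> (1 - x) ^ m * 1" using that x by (intro mult_left_mono) auto
    then have "R \<le> (T ^^ m) r" using iter[of r m] m that by linarith
    then have "len u r R \<le> len u r ((T ^^ m) r)"
      using iter[of r m] that by (intro len_mono) auto
    also have "\<dots> \<le> C / (1 - q) * W u r" using total that by simp
    also have "\<dots> \<le> C / (1 - q) * (2 * v (of_real r * u))"
      using weight_bounds(2)[of u r] that C q by (intro mult_left_mono) (auto simp: W_def)
    also have "\<dots> = B * v (of_real r * u)" by (simp add: B_def)
    finally show ?thesis .
  qed
  obtain C2 where C2: "1 \<le> C2" and har2: "\<And>u r \<rho>. norm u = 1 \<Longrightarrow> 0 \<le> r \<Longrightarrow> r \<le> \<rho> \<Longrightarrow> \<rho> < 1 \<Longrightarrow>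
      1/2 * (1 - r) \<le> 1 - \<rho> \<Longrightarrow> D (of_real \<rho> * u) \<le> C2 * D (of_real r * u) \<and> D (of_real r * u) \<le> C2 * D (of_real \<rho> * u)"
    using harnack[of "1/2"] by auto
  show ?thesis
    unfolding radial_decay_def
  proof (intro exI[of _ "C2 + B * C2"] conjI allI impI)
    show "0 \<le> C2 + B * C2" using C2 \<open>0 \<le> B\<close> by simp
    fix u :: complex and r R :: real
    assume u: "norm u = 1" and rR: "0 \<le> r" "r \<le> R" "R < 1"
    have vp: "0 < v (of_real r * u)" using v_radius_pos u rR by simp
    have "B * 1 \<le> B * C2" using C2 \<open>0 \<le> B\<close> by (intro mult_left_mono) auto
    then have le: "B * v (of_real r * u) \<le> (C2 + B * C2) * v (of_real r * u)"
      using C2 vp by (intro mult_right_mono) auto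
    show "len u r R \<le> (C2 + B * C2) * v (of_real r * u)"
    proof (cases "r = 0")
      case False
      then show ?thesis using order_trans[OF main[OF u] le] rR by simp
    next
      case True
      \<comment> \<open>\<open>contraction\<close> says nothing at \<open>r = 0\<close>; up to 1/2
        Harnack suffices, and from 1/2 on \<open>main\<close> applies.\<close>
      have short: "len u 0 b \<le> C2 * v (of_real 0 * u)" if "0 \<le> b" "b \<le> 1/2" for b
      proof (rule len_le_v)
        fix t assume "0 \<le> t" "t \<le> b"
        then show "D (of_real t * u) \<le> C2 * D (of_real 0 * u)"
          using har2[OF u, of 0 t] that by simp
      qed (use that C2 u in auto)
      have vh: "v (of_real (1/2) * u) \<le> C2 * v (of_real 0 * u)"
      proof -
        have "v (of_real (1/2) * u) \<le> D (of_real (1/2) * u)"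
          using radius_in_disk(3)[OF u, of "1/2"] D_radius_pos[OF u, of "1/2"] by simp
        also have "\<dots> \<le> C2 * D (of_real 0 * u)" using har2[OF u, of 0 "1/2"] by simp
        finally show ?thesis by (simp add: v_def)
      qed
      show ?thesis
      proof (cases "R \<le> 1/2")
        case True
        have "0 \<le> B * C2 * v (of_real r * u)" using \<open>0 \<le> B\<close> C2 vp by simp
        then show ?thesis using short[of R] True rR \<open>r = 0\<close> by (simp add: algebra_simps)
      next
        case False
        have "len u 0 R = len u 0 (1/2) + len u (1/2) R"
          using False rR u by (intro len_combine) auto
        also have "\<dots> \<le> C2 * v (of_real 0 * u) + B * v (of_real (1/2) * u)"
          using short[of "1/2"] main[of u "1/2" R] False rR u by (intro add_mono) auto
        also have "\<dots> \<le> C2 * v (of_real 0 * u) + B * (C2 * v (of_real 0 * u))"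
          using vh \<open>0 \<le> B\<close> by (intro add_left_mono mult_left_mono)
        finally show ?thesis using \<open>r = 0\<close> by (simp add: algebra_simps)
      qed
    qed
  qed
qed

text \<open>The last term belongs to every tail, so \<open>a N \<le> C * a j\<close> for all
  \<open>j \<le> N\<close>; summing over \<open>j\<close> gains the factor \<open>N + 1\<close>.
  This decay of order 1/N is enough to get below any given fraction.\<close>

lemma tail_dominated_le:
  fixes a :: "nat \<Rightarrow> real"
  assumes "0 \<le> C" "\<And>n. 0 \<le> a n" and tail: "\<And>m. m \<le> N \<Longrightarrow> (\<Sum>j=m..N. a j) \<le> C * a m"
  shows "real (N + 1) * a N \<le> C\<^sup>2 * a 0"
proof -
  have "real (N + 1) * a N = (\<Sum>j=0..N. a N)" by simp
  also have "\<dots> \<le> (\<Sum>j=0..N. C * a j)"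
  proof (rule sum_mono)
    fix j assume j: "j \<in> {0..N}"
    have "a N \<le> (\<Sum>i=j..N. a i)" using j assms(2) by (intro member_le_sum) auto
    also have "\<dots> \<le> C * a j" using tail j by simp
    finally show "a N \<le> C * a j" .
  qed
  also have "\<dots> \<le> C * (C * a 0)"
    using tail[of 0] \<open>0 \<le> C\<close> by (simp add: mult_left_mono flip: sum_distrib_left)
  finally show ?thesis by (simp add: power2_eq_square)
qed

text \<open>The lengths of the dyadic pieces of a radius are comparable to \<open>v\<close> at their
  inner ends, and sums of consecutive pieces are again lengths; thus \<open>radial_decay\<close> is
  the tail condition of \<open>tail_dominated_le\<close>.\<close>

lemma radial_decay_imp_contraction:
  assumes radial_decay
  shows "\<exists>x. 0 < x \<and> x < 1 \<and> contraction x (1/2)"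
proof -
  obtain C1 where C1: "0 \<le> C1" and dec: "\<And>u r R. norm u = 1 \<Longrightarrow> 0 \<le> r \<Longrightarrow> r \<le> R \<Longrightarrow> R < 1 \<Longrightarrow>
      len u r R \<le> C1 * v (of_real r * u)"
    using assms unfolding radial_decay_def by blast
  obtain H where H: "1 \<le> H" and har: "\<And>u r \<rho>. norm u = 1 \<Longrightarrow> 0 \<le> r \<Longrightarrow> r \<le> \<rho> \<Longrightarrow> \<rho> < 1 \<Longrightarrow>
      1/2 * (1 - r) \<le> 1 - \<rho> \<Longrightarrow> D (of_real \<rho> * u) \<le> H * D (of_real r * u) \<and> D (of_real r * u) \<le> H * D (of_real \<rho> * u)"
    using harnack[of "1/2"] by auto
  define C where "C = 2 * H * C1"
  define B where "B = 2 * H * C\<^sup>2 * H"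
  have "0 \<le> C" using C1 H by (simp add: C_def)
  have decay: "real (N + 1) * v (of_real (dyadic r N) * u) \<le> B * v (of_real r * u)"
    if u: "norm u = 1" and r: "0 \<le> r" "r < 1" for u r N
  proof -
    define \<rho> where "\<rho> = dyadic r"
    note \<rho>S = dyadic_Suc[of r, folded \<rho>_def]
    note \<rho>1 = dyadic_bounds(1)[OF r, folded \<rho>_def] and \<rho>le = dyadic_bounds(2)[OF r, folded \<rho>_def]
      and mono = dyadic_bounds(3)[OF r, folded \<rho>_def] and \<rho>0 = dyadic_bounds(4)[OF r, folded \<rho>_def]
    define a where "a n = len u (\<rho> n) (\<rho> (Suc n))" for n
    have a0: "0 \<le> a n" for n unfolding a_def using \<rho>0 \<rho>1 u by (intro len_nonneg) auto
    have har_t: "D (of_real t * u) \<le> H * D (of_real (\<rho> n) * u) \<and> D (of_real (\<rho> n) * u) \<le> H * D (of_real t * u)"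
      if "\<rho> n \<le> t" "t \<le> \<rho> (Suc n)" for t n
      using har[OF u \<rho>0[of n] that(1)] that \<rho>1[of "Suc n"] \<rho>S[of n] by simp
    have a_le: "a n \<le> H * v (of_real (\<rho> n) * u)" for n
      unfolding a_def by (rule len_le_v) (use har_t \<rho>0 \<rho>1 \<rho>le u H in auto)
    have v_le: "v (of_real (\<rho> n) * u) \<le> 2 * H * a n" for n
    proof -
      have "D (of_real (\<rho> n) * u) / H * (\<rho> (Suc n) - \<rho> n) \<le> a n"
        unfolding a_def
      proof (rule len_ge)
        fix t assume "\<rho> n \<le> t" "t \<le> \<rho> (Suc n)"
        then show "D (of_real (\<rho> n) * u) / H \<le> D (of_real t * u)"
          using har_t[of n t] H by (simp add: divide_le_eq mult.commute)
      qed (use \<rho>0 \<rho>1 \<rho>le u in auto)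
      moreover have "\<rho> (Suc n) - \<rho> n = (1 - \<rho> n) / 2" using \<rho>S[of n] by simp
      ultimately have "(1 - \<rho> n) * D (of_real (\<rho> n) * u) \<le> 2 * H * a n"
        using H by (simp add: field_simps)
      then show ?thesis using radius_in_disk(3)[OF u \<rho>0 \<rho>1] by simp
    qed
    have sum_eq: "(\<Sum>j=m..m+i. a j) = len u (\<rho> m) (\<rho> (Suc (m + i)))" for m i
    proof (induction i)
      case (Suc i)
      then show ?case
        using len_combine[OF u \<rho>0 mono \<rho>le \<rho>1, of m "Suc (m + i)"] by (simp add: a_def)
    qed (simp add: a_def)
    have "(\<Sum>j=m..N. a j) \<le> C * a m" if "m \<le> N" for m
    proof -
      have "(\<Sum>j=m..N. a j) = len u (\<rho> m) (\<rho> (Suc N))" using sum_eq[of m "N - m"] that by simp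
      also have "\<dots> \<le> C1 * v (of_real (\<rho> m) * u)"
        using dec[OF u \<rho>0 mono \<rho>1] that by simp
      also have "\<dots> \<le> C1 * (2 * H * a m)" using v_le C1 by (intro mult_left_mono)
      finally show ?thesis by (simp add: C_def algebra_simps)
    qed
    from tail_dominated_le[OF \<open>0 \<le> C\<close> a0 this] have "real (N + 1) * a N \<le> C\<^sup>2 * a 0" .
    then have "2 * H * (real (N + 1) * a N) \<le> 2 * H * (C\<^sup>2 * a 0)" using H by (intro mult_left_mono) auto
    also have "\<dots> \<le> 2 * H * (C\<^sup>2 * (H * v (of_real (\<rho> 0) * u)))"
      using a_le[of 0] H by (intro mult_left_mono) auto
    also have "\<dots> = B * v (of_real r * u)" by (simp add: B_def \<rho>_def)
    finally have "2 * H * (real (N + 1) * a N) \<le> B * v (of_real r * u)" .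
    moreover have "real (N + 1) * v (of_real (\<rho> N) * u) \<le> real (N + 1) * (2 * H * a N)"
      using v_le by (intro mult_left_mono) auto
    ultimately show ?thesis by (simp add: \<rho>_def algebra_simps)
  qed
  \<comment> \<open>In \<open>4 * H * B\<close>, the factor \<open>B\<close> comes from
    \<open>decay\<close>, \<open>H\<close> from comparing \<open>\<rho>\<close> with a dyadic point,
    one 2 from passing between \<open>1 - r\<^sup>2\<close> and \<open>1 - r\<close>, the other from
    the target 1/2.\<close>
  obtain N :: nat where N: "4 * H * B < real N" using reals_Archimedean2 by blast
  have "0 \<le> B" using H by (simp add: B_def)
  then have "N > 0" using N H by (metis less_le_trans mult_nonneg_nonneg not_gr_zero of_nat_0 order.strict_iff_not order_trans zero_le_numeral zero_le_one)
  \<comment> \<open>With this \<open>x\<close> the product \<open>(1 - x) * (1 - r)\<close> is the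
    distance of \<open>dyadic r N\<close> from 1, so the translated radius lies between that point
    and the next dyadic one.\<close>
  define x where "x = (1 - 1 / 2 ^ N :: real)"
  have "(2::real) ^ N > 1" using \<open>N > 0\<close> by simp
  then have x: "0 < x" "x < 1" by (simp_all add: x_def)
  have "contraction x (1/2)"
    unfolding contraction_def Let_def
  proof (intro allI impI)
    fix u :: complex and r :: real
    assume u: "norm u = 1" and r: "0 < r" "r < 1"
    define \<rho> where "\<rho> = (x + r) / (1 + x * r)"
    define b where "b = dyadic r N"
    note tr = hyperbolic_translation[OF x less_imp_le[OF r(1)] r(2), folded \<rho>_def]
    have eq: "1 - b = (1 - x) * (1 - r)" by (simp add: b_def x_def dyadic_def)
    have b: "0 \<le> b" "b < 1" using dyadic_bounds(4,1)[of r N] r by (simp_all add: b_def)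
    have "b \<le> \<rho>" "1/2 * (1 - b) \<le> 1 - \<rho>" using tr(3,4) eq by auto
    then have "D (of_real \<rho> * u) \<le> H * D (of_real b * u)" using har[OF u b(1)] tr by blast
    have "v (of_real \<rho> * u) = (1 - \<rho>) * D (of_real \<rho> * u)" using radius_in_disk(3)[OF u] tr r by simp
    also have "\<dots> \<le> (1 - b) * (H * D (of_real b * u))"
      using \<open>b \<le> \<rho>\<close> \<open>D (of_real \<rho> * u) \<le> _\<close> tr r b D_radius_pos[OF u, of \<rho>] by (intro mult_mono) auto
    also have "\<dots> = H * v (of_real b * u)" using radius_in_disk(3)[OF u b] by simp
    finally have vb: "v (of_real \<rho> * u) \<le> H * v (of_real b * u)" .
    have vr: "0 < v (of_real r * u)" using v_radius_pos[OF u] r by simp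
    have "real (N + 1) * (1 - \<rho>\<^sup>2) * D (of_real \<rho> * u) \<le> real (N + 1) * (2 * v (of_real \<rho> * u))"
      using weight_bounds(2)[OF u, of \<rho>] tr r by (simp add: mult.assoc mult_left_mono)
    also have "\<dots> \<le> real (N + 1) * (2 * (H * v (of_real b * u)))"
      using vb by (intro mult_left_mono) auto
    also have "\<dots> = 2 * H * (real (N + 1) * v (of_real b * u))" by simp
    also have "\<dots> \<le> 2 * H * (B * v (of_real r * u))"
      using decay[OF u less_imp_le[OF r(1)] r(2), of N] H unfolding b_def by (intro mult_left_mono) auto
    also have "\<dots> = (2 * H * B) * v (of_real r * u)" by simp
    also have "\<dots> \<le> (real (N + 1) / 2) * v (of_real r * u)" using N vr by (intro mult_right_mono) auto
    also have "\<dots> \<le> (real (N + 1) / 2) * ((1 - r\<^sup>2) * D (of_real r * u))"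
      using weight_bounds(1)[OF u, of r] r by (intro mult_left_mono) auto
    finally have "real (N + 1) * ((1 - \<rho>\<^sup>2) * D (of_real \<rho> * u))
        \<le> real (N + 1) * (1/2 * ((1 - r\<^sup>2) * D (of_real r * u)))"
      by (simp add: algebra_simps)
    then show "(1 - ((x + r) / (1 + x * r))\<^sup>2) * D (of_real ((x + r) / (1 + x * r)) * u)
        \<le> 1/2 * ((1 - r\<^sup>2) * D (of_real r * u))"
      unfolding \<rho>_def[symmetric] by (simp only: mult_le_cancel_left)
  qed
  then show ?thesis using x by blast
qed

end

section \<open>Areas of images of boxes\<close>

lemma area_ball:
  fixes a :: complex
  assumes "0 \<le> r"
  shows "measure lebesgue (ball a r) = measure lebesgue (ball (0::complex) 1) * r\<^sup>2"
  using content_ball_conv_unit_ball[OF assms, of a] by (simp add: mult.commute)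

lemma area_unit_ball_pos: "0 < measure lebesgue (ball (0::complex) 1)"
  using content_ball_pos[of 1 "0::complex"] by simp

lemma area_add_le:
  fixes A B C :: "complex set"
  assumes "open A" "open B" "open C" "bounded C" "A \<subseteq> C" "B \<subseteq> C" "A \<inter> B = {}"
  shows "measure lebesgue A + measure lebesgue B \<le> measure lebesgue C"
proof -
  have m: "A \<in> lmeasurable" "B \<in> lmeasurable" "C \<in> lmeasurable"
    using assms bounded_subset[OF assms(4)] by (auto intro!: lmeasurable_open)
  have "measure lebesgue (A \<union> B) \<le> measure lebesgue C"
    using m assms by (intro measure_mono_fmeasurable) auto
  then show ?thesis using measure_Un3[OF m(1,2)] assms by simp
qed

lemma area_mono:
  fixes A B :: "complex set"
  assumes "open A" "open B" "bounded B" "A \<subseteq> B"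
  shows "measure lebesgue A \<le> measure lebesgue B"
  using area_add_le[of A "{}" B] assms by simp

context koebe_like
begin

lemma polar_box_subset_disk: "polar_box r u \<tau> \<subseteq> \<D>"
  by (auto simp: polar_box_def)

lemma open_polar_box: "open (polar_box r u \<tau>)"
  unfolding polar_box_def by (intro open_Collect_conj open_Collect_less continuous_intros)

lemma open_image_box: "open (f ` polar_box r u \<tau>)"
  by (rule open_image[OF polar_box_subset_disk open_polar_box])

lemma polar_box_mono: "0 \<le> \<tau> \<Longrightarrow> r \<le> r' \<Longrightarrow> polar_box r' u \<tau> \<subseteq> polar_box r u \<tau>"
  unfolding polar_box_def by (smt (verit) Collect_mono mult_left_mono mult_right_mono norm_ge_zero)

text \<open>A disc about the axis point at radius \<open>r + \<delta> * (1 - r)\<close> fits into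
  the inner part of the box, and \<open>ball_subset_image_ball\<close> carries it over to the image.
  Keeping the modulus at least \<open>\<delta> / 2\<close> matters near \<open>r = 0\<close>, where
  the box narrows towards 0.\<close>

lemma image_box_contains_ball:
  assumes u: "norm u = 1" and r: "0 \<le> r" "r < 1" and \<tau>: "0 < \<tau>" "\<tau> \<le> 1"
  shows "\<exists>y. ball y (c * \<delta> * \<tau> / 8 * v (of_real r * u)) \<subseteq> f ` {z \<in> polar_box r u \<tau>. norm z < (1 + r) / 2}"
proof -
  define b where "b = r + \<delta> * (1 - r)"
  define p where "p = of_real b * u"
  \<comment> \<open>Points of the disc are off the axis by less than
    \<open>2 * s = \<tau> * (1 - r) * (\<delta> / 2)\<close>, while the box allows
    \<open>\<tau> * (1 - r) * norm z\<close>.\<close>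
  define s where "s = \<delta> * \<tau> * (1 - r) / 4"
  have dr: "0 < \<delta> * (1 - r)" "\<delta> * (1 - r) \<le> (1 - r) / 4"
    using \<delta> r mult_right_mono[of \<delta> "1/4" "1 - r"] by auto
  have "\<tau> * (\<delta> * (1 - r)) \<le> 1 * (\<delta> * (1 - r))" using \<tau> dr by (intro mult_right_mono) auto
  then have s: "0 < s" "s \<le> \<delta> * (1 - r) / 4" using dr \<tau> \<delta> r by (simp_all add: s_def mult_ac)
  have b: "0 \<le> b" "b < 1" "\<delta> \<le> b" "b - r = \<delta> * (1 - r)"
    using dr r \<delta> mult_right_mono[of \<delta> 1 r] by (simp_all add: b_def algebra_simps)
  note p = radius_in_disk[OF u b(1,2), folded p_def]
  have "norm (p - of_real r * u) = \<delta> * (1 - r)"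
    using u dr \<delta> by (simp add: p_def norm_mult b_def flip: left_diff_distrib of_real_diff)
  then have Dp: "D (of_real r * u) \<le> 2 * D p"
    using near[OF radius_in_disk(1)[OF u r], of p] radius_in_disk(2)[OF u r] by simp
  have "s \<le> \<delta> * (1 - norm p)"
  proof -
    have "1 - norm p = (1 - \<delta>) * (1 - r)" using p by (simp add: b_def algebra_simps)
    moreover have "\<delta> * (1/4 * (1 - r)) \<le> \<delta> * ((1 - \<delta>) * (1 - r))"
      using \<delta> r by (intro mult_left_mono mult_right_mono) auto
    ultimately show ?thesis using s by simp
  qed
  from ball_subset_image_ball[OF p(1) s(1) this]
  have 1: "ball (f p) (c * D p * s) \<subseteq> f ` ball p s" .
  have 2: "ball p s \<subseteq> {z \<in> polar_box r u \<tau>. norm z < (1 + r) / 2}"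
  proof
    fix z assume "z \<in> ball p s"
    then have zp: "norm (z - p) < s" by (simp add: dist_norm norm_minus_commute)
    then have nz: "\<bar>norm z - b\<bar> < s" using norm_triangle_ineq3[of z p] p by simp
    have "s \<le> (1 - r) / 16" "b \<le> r + (1 - r) / 4" "norm z < b + s"
      using s(2) dr(2) b(4) nz by (auto simp: abs_less_iff field_simps)
    then have "norm z < (1 + r) / 2" using r by (simp add: field_simps)
    moreover have "r < norm z" "\<delta> / 2 \<le> norm z"
      using nz s dr b \<delta> mult_left_mono[of "1 - r" 1 \<delta>] r by (auto simp: abs_less_iff)
    ultimately have 3: "r < norm z" "norm z < (1 + r) / 2" "\<delta> / 2 \<le> norm z" by auto
    have "norm (p - of_real (norm z) * u) = \<bar>b - norm z\<bar>"
      using u by (simp add: p_def norm_mult flip: left_diff_distrib of_real_diff)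
    then have "norm (z - of_real (norm z) * u) < s + s"
      using zp nz norm_triangle_ineq[of "z - p" "p - of_real (norm z) * u"] by simp
    also have "s + s = \<tau> * (1 - r) * (\<delta> / 2)" by (simp add: s_def)
    also have "\<dots> \<le> \<tau> * (1 - r) * norm z" using 3 \<tau> r by (intro mult_left_mono) auto
    finally show "z \<in> {z \<in> polar_box r u \<tau>. norm z < (1 + r) / 2}"
      using 3 r by (simp add: polar_box_def)
  qed
  have "c * \<delta> * \<tau> / 8 * v (of_real r * u) = c * (D (of_real r * u) / 2) * s"
    using radius_in_disk(3)[OF u r] by (simp add: s_def)
  also have "\<dots> \<le> c * D p * s" using Dp c s by (intro mult_right_mono mult_left_mono) auto
  finally have "ball (f p) (c * \<delta> * \<tau> / 8 * v (of_real r * u)) \<subseteq> ball (f p) (c * D p * s)"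
    by (rule subset_ball)
  then show ?thesis using 1 2 by blast
qed

text \<open>The image disc comes from moduli below \<open>(1 + r) / 2\<close>, where the smaller box
  begins, so injectivity keeps the two images disjoint. The disc is the area lost in one dyadic
  step.\<close>

lemma image_box_area_ge:
  assumes u: "norm u = 1" and r: "0 \<le> r" "r < 1" and \<tau>: "0 < \<tau>" "\<tau> \<le> 1"
    and bd: "bounded (f ` polar_box r u \<tau>)"
  shows "measure lebesgue (ball (0::complex) 1) * (c * \<delta> * \<tau> / 8 * v (of_real r * u))\<^sup>2
      + measure lebesgue (f ` polar_box ((1 + r) / 2) u \<tau>) \<le> measure lebesgue (f ` polar_box r u \<tau>)"
proof -
  obtain y where y: "ball y (c * \<delta> * \<tau> / 8 * v (of_real r * u)) \<subseteq> f ` {z \<in> polar_box r u \<tau>. norm z < (1 + r) / 2}"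
    using image_box_contains_ball[OF u r \<tau>] by blast
  have "f ` {z \<in> polar_box r u \<tau>. norm z < (1 + r) / 2} \<inter> f ` polar_box ((1 + r) / 2) u \<tau>
      = f ` ({z \<in> polar_box r u \<tau>. norm z < (1 + r) / 2} \<inter> polar_box ((1 + r) / 2) u \<tau>)"
    using polar_box_subset_disk by (intro inj_on_image_Int[OF inj_f, symmetric]) blast+
  also have "\<dots> = {}" by (auto simp: polar_box_def)
  finally have disj: "ball y (c * \<delta> * \<tau> / 8 * v (of_real r * u)) \<inter> f ` polar_box ((1 + r) / 2) u \<tau> = {}"
    using y by blast
  have "measure lebesgue (ball y (c * \<delta> * \<tau> / 8 * v (of_real r * u)))
      + measure lebesgue (f ` polar_box ((1 + r) / 2) u \<tau>) \<le> measure lebesgue (f ` polar_box r u \<tau>)"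
  proof (rule area_add_le[OF open_ball open_image_box open_image_box bd _ _ disj])
    show "f ` polar_box ((1 + r) / 2) u \<tau> \<subseteq> f ` polar_box r u \<tau>"
      using polar_box_mono[of \<tau> r "(1 + r) / 2" u] \<tau> r by (intro image_mono) auto
  qed (use y in blast)
  then show ?thesis
    using area_ball[of "c * \<delta> * \<tau> / 8 * v (of_real r * u)" y] c \<delta> \<tau> v_radius_pos[OF u r] by simp
qed

section \<open>Boxes and the growth of the mapping\<close>

lemma radial_decayD:
  assumes radial_decay
  obtains C where "0 \<le> C" "\<And>u r R. norm u = 1 \<Longrightarrow> 0 \<le> r \<Longrightarrow> r \<le> R \<Longrightarrow> R < 1 \<Longrightarrow>
      len u r R \<le> C * v (of_real r * u)"
  using assms unfolding radial_decay_def by blast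

text \<open>Area estimates control \<open>v\<close> only at the dyadic radii; Harnack turns these
  values into lengths of the pieces between them, which are summed as a geometric series.\<close>

lemma geometric_imp_radial_decay:
  assumes "0 \<le> K" "0 \<le> \<theta>" "\<theta> < 1"
    and geo: "\<And>u r n. norm u = 1 \<Longrightarrow> 0 \<le> r \<Longrightarrow> r < 1 \<Longrightarrow>
        v (of_real (dyadic r n) * u) \<le> K * \<theta> ^ n * v (of_real r * u)"
  shows radial_decay
proof -
  obtain H where H: "1 \<le> H" and har: "\<And>u r \<rho>. norm u = 1 \<Longrightarrow> 0 \<le> r \<Longrightarrow> r \<le> \<rho> \<Longrightarrow> \<rho> < 1 \<Longrightarrow>
      1/2 * (1 - r) \<le> 1 - \<rho> \<Longrightarrow> D (of_real \<rho> * u) \<le> H * D (of_real r * u) \<and> D (of_real r * u) \<le> H * D (of_real \<rho> * u)"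
    using harnack[of "1/2"] by auto
  show ?thesis
    unfolding radial_decay_def
  proof (intro exI[of _ "H * K / (1 - \<theta>)"] conjI allI impI)
    show "0 \<le> H * K / (1 - \<theta>)" using assms H by simp
    fix u :: complex and r R :: real
    assume u: "norm u = 1" and rR: "0 \<le> r" "r \<le> R" "R < 1"
    then have r: "0 \<le> r" "r < 1" by auto
    obtain N where N: "R \<le> dyadic r N" using dyadic_exceeds[of r R] rR by auto
    note dy = dyadic_bounds[OF r]
    have step: "len u (dyadic r n) (dyadic r (Suc n)) \<le> H * v (of_real (dyadic r n) * u)" for n
    proof (rule len_le_v)
      fix t assume t: "dyadic r n \<le> t" "t \<le> dyadic r (Suc n)"
      then have "1/2 * (1 - dyadic r n) \<le> 1 - t" using dyadic_Suc[of r n] by simp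
      then show "D (of_real t * u) \<le> H * D (of_real (dyadic r n) * u)"
        using har[OF u dy(4) t(1)] t dy(1)[of "Suc n"] by simp
    qed (use dy u H in auto)
    have "len u r (dyadic r n) \<le> H * (\<Sum>j<n. K * \<theta> ^ j * v (of_real r * u))" for n
    proof (induction n)
      case (Suc n)
      have "len u r (dyadic r (Suc n)) = len u r (dyadic r n) + len u (dyadic r n) (dyadic r (Suc n))"
        using dy(3)[of 0 n] dy(1,2) r u by (intro len_combine) auto
      also have "len u (dyadic r n) (dyadic r (Suc n)) \<le> H * (K * \<theta> ^ n * v (of_real r * u))"
        using step[of n] geo[OF u r, of n] H by (smt (verit) mult_left_mono)
      finally show ?case using Suc.IH by (simp add: distrib_left)
    qed simp
    from this[of N] have "len u r R \<le> H * (\<Sum>j<N. K * \<theta> ^ j * v (of_real r * u))"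
      using len_mono[OF u r(1) rR(2) N dy(1)] by simp
    also have "\<dots> = H * K * v (of_real r * u) * (\<Sum>j<N. \<theta> ^ j)"
      by (simp add: sum_distrib_left sum_distrib_right mult_ac)
    also have "\<dots> \<le> H * K * v (of_real r * u) * (1 / (1 - \<theta>))"
    proof (intro mult_left_mono)
      have "(\<Sum>j<N. \<theta> ^ j) \<le> (\<Sum>j. \<theta> ^ j)"
        using assms by (intro sum_le_suminf summable_geometric) auto
      then show "(\<Sum>j<N. \<theta> ^ j) \<le> 1 / (1 - \<theta>)" using assms by (simp add: suminf_geometric)
    qed (use H assms v_radius_pos[OF u r] in auto)
    finally show "len u r R \<le> H * K / (1 - \<theta>) * v (of_real r * u)" by (simp add: mult_ac)
  qed
qed

text \<open>A point of \<open>B_box z\<close> is reached from \<open>z\<close> by an arc of the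
  circle through \<open>z\<close>, handled by \<open>angular_harnack\<close>, followed by a radial
  segment, handled by the decay.\<close>

lemma radial_decay_imp_B_box_bound:
  assumes radial_decay
  shows "\<exists>C. \<forall>z\<in>\<D>. \<forall>w\<in>B_box z. norm (f z - f w) \<le> C * v z"
proof -
  obtain C1 where C1: "0 \<le> C1" and dec: "\<And>u r R. norm u = 1 \<Longrightarrow> 0 \<le> r \<Longrightarrow> r \<le> R \<Longrightarrow> R < 1 \<Longrightarrow>
      len u r R \<le> C1 * v (of_real r * u)"
    using radial_decayD[OF assms] by blast
  obtain C2 where C2: "0 \<le> C2" and ang: "\<And>u r a. norm u = 1 \<Longrightarrow> 0 \<le> r \<Longrightarrow> r < 1 \<Longrightarrow> \<bar>a\<bar> \<le> pi * (1 - r) \<Longrightarrow>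
      D (of_real r * (u * cis a)) \<le> C2 * D (of_real r * u) \<and>
      norm (f (of_real r * (u * cis a)) - f (of_real r * u)) \<le> C2 * v (of_real r * u)"
    using angular_harnack by blast
  show ?thesis
  proof (intro exI ballI)
    fix z w assume z: "z \<in> \<D>" and "w \<in> B_box z"
    then obtain k :: int where w: "norm z \<le> norm w" "norm w < 1"
      and k: "\<bar>Arg z - Arg w + 2 * pi * of_int k\<bar> \<le> pi * (1 - norm z)"
      unfolding B_box_def by blast
    define r where "r = norm z"
    define u where "u = cis (Arg z)"
    \<comment> \<open>The angle from \<open>z\<close> to \<open>w\<close> in the representative that
      \<open>B_box\<close> declares small; \<open>k\<close> disappears from \<open>cis\<close> by
      periodicity.\<close>
    define a where "a = - (Arg z - Arg w + 2 * pi * of_int k)"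
    define u' where "u' = u * cis a"
    have u: "norm u = 1" "norm u' = 1" by (simp_all add: u_def u'_def norm_mult)
    have r: "0 \<le> r" "r < 1" using z by (simp_all add: r_def)
    have zr: "z = of_real r * u" using rcis_cmod_Arg[of z] by (simp add: r_def u_def rcis_def)
    have "u' = cis (Arg w) * cis (2 * pi * of_int (- k))"
      unfolding u'_def u_def a_def cis_mult by (simp add: algebra_simps)
    also have "cis (2 * pi * of_int (- k)) = 1" by (rule cis_multiple_2pi) simp
    finally have wr: "w = of_real (norm w) * u'" using rcis_cmod_Arg[of w] by (simp add: rcis_def)
    have a: "\<bar>a\<bar> \<le> pi * (1 - r)" using k by (simp add: a_def r_def)
    have "norm (f w - f (of_real r * u')) \<le> len u' r (norm w)"
      using radial[OF u(2) r(1), of "norm w"] w wr by (simp add: r_def)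
    also have "\<dots> \<le> C1 * v (of_real r * u')" using dec[OF u(2) r(1)] w by (simp add: r_def)
    also have "v (of_real r * u') \<le> C2 * v z"
    proof -
      have "v (of_real r * u') = (1 - r) * D (of_real r * u')" using radius_in_disk(3)[OF u(2) r] .
      also have "\<dots> \<le> (1 - r) * (C2 * D z)"
        using ang[OF u(1) r a] r by (intro mult_left_mono) (auto simp: u'_def zr)
      finally show ?thesis by (simp add: v_def r_def mult_ac)
    qed
    finally have 1: "norm (f w - f (of_real r * u')) \<le> C1 * (C2 * v z)"
      using C1 by (simp add: mult_left_mono)
    have 2: "norm (f (of_real r * u') - f z) \<le> C2 * v z"
      using ang[OF u(1) r a] by (simp add: u'_def zr)
    have "norm (f z - f w) \<le> norm (f w - f (of_real r * u')) + norm (f (of_real r * u') - f z)"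
      using norm_triangle_ineq[of "f w - f (of_real r * u')" "f (of_real r * u') - f z"]
      by (simp add: norm_minus_commute)
    then show "norm (f z - f w) \<le> (C1 * C2 + C2) * v z" using 1 2 by (simp add: algebra_simps)
  qed
qed

lemma box_subset_B_box:
  assumes u: "norm u = 1" and r: "0 \<le> r" "r < 1"
  shows "polar_box r u (1/2) \<subseteq> B_box (of_real r * u)"
proof
  fix w assume w: "w \<in> polar_box r u (1/2)"
  then have nw: "r < norm w" "norm w < 1" and lt: "norm (w - of_real (norm w) * u) < 1/2 * (1 - r) * norm w"
    by (auto simp: polar_box_def)
  let ?z = "of_real r * u"
  note nz = radius_in_disk(2)[OF u r]
  have "\<exists>k::int. \<bar>Arg ?z - Arg w + 2 * pi * of_int k\<bar> \<le> pi * (1 - r)"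
  proof (cases "r = 0")
    case True
    have "\<bar>Arg w\<bar> \<le> pi" using Arg_bounded[of w] by auto
    then show ?thesis using True by (intro exI[of _ 0]) (simp add: Arg_zero)
  next
    case False
    then have "r > 0" using r by simp
    define b where "b = Arg ?z - Arg w"
    have uc: "u = cis (Arg ?z)"
      using rcis_cmod_Arg[of ?z] nz \<open>r > 0\<close> by (simp add: rcis_def)
    have wc: "w = of_real (norm w) * cis (Arg w)" using rcis_cmod_Arg[of w] by (simp add: rcis_def)
    have "w - of_real (norm w) * u = - (of_real (norm w) * cis (Arg w)) * (cis b - 1)"
      by (subst wc, subst uc) (simp add: b_def algebra_simps cis_mult)
    then have "norm w * norm (cis b - 1) < norm w * (1/2 * (1 - r))"
      using lt by (simp add: norm_mult mult_ac)
    then have q: "norm (cis b - 1) < 1/2 * (1 - r)" by (metis mult_less_cancel_left_pos nw(1) order.strict_trans \<open>r > 0\<close>)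
    then have "norm (Ln (1 + (cis b - 1))) \<le> 2 * norm (cis b - 1)" using r by (intro norm_Ln_le) auto
    then have L: "norm (Ln (cis b)) \<le> 1 - r" using q by simp
    have "exp (\<i> * of_real b) = exp (Ln (cis b))" by (simp add: cis_conv_exp)
    then obtain n :: int where "\<i> * of_real b = Ln (cis b) + (of_int (2 * n) * pi) * \<i>"
      using exp_eq by blast
    then have "Im (\<i> * of_real b) = Im (Ln (cis b) + (of_int (2 * n) * pi) * \<i>)" by (rule arg_cong)
    then have "b + 2 * pi * of_int (- n) = Im (Ln (cis b))" by (simp add: algebra_simps)
    then have "\<bar>b + 2 * pi * of_int (- n)\<bar> \<le> 1 - r" using L abs_Im_le_cmod[of "Ln (cis b)"] by simp
    also have "\<dots> \<le> pi * (1 - r)" using r pi_gt3 mult_right_mono[of 1 pi "1 - r"] by simp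
    finally show ?thesis unfolding b_def by blast
  qed
  then show "w \<in> B_box ?z" using nw nz by (simp add: B_box_def)
qed

text \<open>The images of the boxes \<open>polar_box (dyadic r n) u (1/2)\<close> have area comparable to the square of
  \<open>v\<close>, and each omits a disk of comparable area contained in the preceding one; hence the areas
  decay geometrically.\<close>

lemma B_box_bound_imp_radial_decay:
  assumes "\<And>z w. z \<in> \<D> \<Longrightarrow> w \<in> B_box z \<Longrightarrow> norm (f z - f w) \<le> C * v z"
  shows radial_decay
proof -
  \<comment> \<open>Strictly above \<open>C\<close>, so that the image boxes lie in open discs, and
    at least 1, which gives \<open>c1 \<le> C'\<close> and hence \<open>0 \<le> q\<close>.\<close>
  define C' where "C' = max C 0 + 1"
  have C': "1 \<le> C'" "C < C'" by (simp_all add: C'_def)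
  define c1 where "c1 = c * \<delta> * (1/2) / 8"
  have "c * \<delta> \<le> 1 * 1" using c \<delta> by (intro mult_mono) auto
  then have c1: "0 < c1" "c1 \<le> C'" using c \<delta> C' by (simp_all add: c1_def)
  \<comment> \<open>Each step loses \<open>V * (c1 * x n)\<^sup>2\<close> from an area of at most
    \<open>V * (C' * x n)\<^sup>2\<close>, a share of at least \<open>(c1 / C')\<^sup>2\<close>. As
    areas are comparable to squares of \<open>v\<close>, the ratio for \<open>v\<close> becomes
    \<open>sqrt q\<close>.\<close>
  define q where "q = 1 - (c1 / C')\<^sup>2"
  have "(c1 / C')\<^sup>2 \<le> 1" "0 < (c1 / C')\<^sup>2" using c1 C' by (simp_all add: power_le_one)
  then have q: "0 \<le> q" "q < 1" by (simp_all add: q_def)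
  define V where "V = measure lebesgue (ball (0::complex) 1)"
  have V: "V > 0" unfolding V_def by (rule area_unit_ball_pos)
  show ?thesis
  proof (rule geometric_imp_radial_decay[of "C' / c1" "sqrt q"])
    fix u :: complex and r :: real and n :: nat
    assume u: "norm u = 1" and r: "0 \<le> r" "r < 1"
    note dy = dyadic_bounds[OF r]
    define x where "x n = v (of_real (dyadic r n) * u)" for n
    define A where "A n = f ` polar_box (dyadic r n) u (1/2)" for n
    have x0: "0 < x n" for n unfolding x_def using v_radius_pos[OF u dy(4,1)] .
    have sub: "A n \<subseteq> ball (f (of_real (dyadic r n) * u)) (C' * x n)" for n
    proof
      fix y assume "y \<in> A n"
      then obtain w where w: "w \<in> polar_box (dyadic r n) u (1/2)" "y = f w" by (auto simp: A_def)
      then have "norm (f (of_real (dyadic r n) * u) - f w) \<le> C * x n"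
        using assms[of "of_real (dyadic r n) * u" w] box_subset_B_box[OF u dy(4,1)]
          radius_in_disk(1)[OF u dy(4,1)] by (auto simp: x_def)
      also have "\<dots> < C' * x n" using C' x0[of n] by simp
      finally show "y \<in> ball (f (of_real (dyadic r n) * u)) (C' * x n)"
        using w by (simp add: dist_norm)
    qed
    have bd: "bounded (A n)" for n using sub bounded_ball bounded_subset by blast
    have up: "measure lebesgue (A n) \<le> V * (C' * x n)\<^sup>2" for n
      using area_mono[OF _ open_ball bounded_ball sub[of n]] area_ball[of "C' * x n"] C' x0[of n]
        open_image_box by (simp add: A_def V_def)
    have dS: "(1 + dyadic r n) / 2 = dyadic r (Suc n)" for n using dyadic_Suc[of r n] by (simp add: field_simps)
    have step: "V * (c1 * x n)\<^sup>2 + measure lebesgue (A (Suc n)) \<le> measure lebesgue (A n)" for n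
      using image_box_area_ge[OF u dy(4,1), of "1/2" n] bd[of n]
      unfolding dS V_def[symmetric] A_def x_def c1_def by simp
    have dec: "measure lebesgue (A (Suc n)) \<le> q * measure lebesgue (A n)" for n
    proof -
      have "(c1 / C')\<^sup>2 * measure lebesgue (A n) \<le> (c1 / C')\<^sup>2 * (V * (C' * x n)\<^sup>2)"
        using up by (intro mult_left_mono) auto
      also have "\<dots> = V * (c1 * x n)\<^sup>2" using C' by (simp add: power_mult_distrib power_divide)
      finally show ?thesis using step[of n] by (simp add: q_def algebra_simps)
    qed
    have geo: "measure lebesgue (A n) \<le> q ^ n * measure lebesgue (A 0)" for n
    proof (induction n)
      case (Suc n)
      have "measure lebesgue (A (Suc n)) \<le> q * measure lebesgue (A n)" by (rule dec)
      also have "\<dots> \<le> q * (q ^ n * measure lebesgue (A 0))" using Suc q by (intro mult_left_mono)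
      finally show ?case by (simp add: mult.assoc)
    qed simp
    have "(sqrt q ^ n)\<^sup>2 = q ^ n"
      using q by (metis mult.commute power_mult real_sqrt_pow2)
    then have sq: "(sqrt q ^ n * y)\<^sup>2 = q ^ n * y\<^sup>2" for y by (simp add: power_mult_distrib)
    have "V * (c1 * x n)\<^sup>2 \<le> measure lebesgue (A n)"
      using step[of n] measure_nonneg[of lebesgue "A (Suc n)"] by linarith
    also have "\<dots> \<le> q ^ n * measure lebesgue (A 0)" by (rule geo)
    also have "\<dots> \<le> q ^ n * (V * (C' * x 0)\<^sup>2)" using up q by (intro mult_left_mono) auto
    also have "\<dots> = V * (sqrt q ^ n * (C' * x 0))\<^sup>2"
      unfolding sq by simp
    finally have "(c1 * x n)\<^sup>2 \<le> (sqrt q ^ n * (C' * x 0))\<^sup>2" using V by simp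
    then have "c1 * x n \<le> sqrt q ^ n * (C' * x 0)"
      by (rule power2_le_imp_le) (use q C' x0[of 0] in auto)
    then show "v (of_real (dyadic r n) * u) \<le> C' / c1 * sqrt q ^ n * v (of_real r * u)"
      using c1 by (simp add: x_def field_simps)
  qed (use c1 C' q in auto)
qed

end

section \<open>Radial John disks\<close>

lemma partition_sum_le_curve_length:
  assumes "t 0 = a" "t n = b" "\<And>i. i < n \<Longrightarrow> t i \<le> t (Suc i)"
  shows "ereal (\<Sum>i<n. dist (\<gamma> (t i)) (\<gamma> (t (Suc i)))) \<le> curve_length \<gamma> a b"
proof -
  have "(n, t) \<in> {(n::nat, t::nat \<Rightarrow> real). t 0 = a \<and> t n = b \<and> (\<forall>i<n. t i \<le> t (Suc i))}"
    using assms by simp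
  from SUP_upper[OF this, of "\<lambda>(n, t). ereal (\<Sum>i<n. dist (\<gamma> (t i)) (\<gamma> (t (Suc i))))"]
  show ?thesis unfolding curve_length_def by simp
qed

text \<open>The witness is the point at angle t where \<open>\<sigma> = 2 * sin (t / 2)\<close>,
  written without trigonometric functions.\<close>

lemma unit_at_distance:
  fixes \<sigma> :: real
  assumes "0 \<le> \<sigma>" "\<sigma> \<le> 2"
  shows "\<exists>e::complex. norm e = 1 \<and> norm (e - 1) = \<sigma>"
proof -
  define e where "e = Complex (1 - \<sigma>\<^sup>2 / 2) (\<sigma> * sqrt (1 - \<sigma>\<^sup>2 / 4))"
  have "\<sigma>\<^sup>2 \<le> 2\<^sup>2" using assms by (intro power_mono) auto
  then have s: "(sqrt (1 - \<sigma>\<^sup>2 / 4))\<^sup>2 = 1 - \<sigma>\<^sup>2 / 4" by simp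
  have "(norm e)\<^sup>2 = 1" "(norm (e - 1))\<^sup>2 = \<sigma>\<^sup>2"
    unfolding e_def cmod_power2 by (simp_all add: power_mult_distrib s) (simp_all add: power2_eq_square field_simps)
  then show ?thesis using assms power2_eq_iff_nonneg[of "norm e" 1] power2_eq_iff_nonneg[of "norm (e - 1)" \<sigma>]
    by (intro exI[of _ e]) simp
qed

context koebe_like
begin

abbreviation \<Omega> :: "complex set" where "\<Omega> \<equiv> f ` \<D>"

lemma inverse_homeomorphism: "\<exists>F. homeomorphism \<D> \<Omega> f F"
  using invariance_of_domain_homeomorphism[OF open_ball cont_f _ inj_f] by auto

lemma boundary_dist_nonneg: "0 \<le> boundary_dist G w"
  by (simp add: boundary_dist_def infdist_nonneg)

lemma boundary_dist_le_add: "boundary_dist G w \<le> boundary_dist G w' + norm (w - w')"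
  using infdist_triangle[of w "frontier G" w'] by (simp add: boundary_dist_def dist_norm)

text \<open>The points of \<open>\<Omega>\<close> at distance at least \<open>\<epsilon>\<close>
  from the frontier form a compact set, whose preimage under the homeomorphism \<open>f\<close> is
  compact and so stays away from the unit circle.\<close>

lemma boundary_dist_tendsto_zero:
  assumes "bounded \<Omega>" "0 < \<epsilon>"
  shows "\<exists>\<rho><1. \<forall>z\<in>\<D>. \<rho> < norm z \<longrightarrow> boundary_dist \<Omega> (f z) < \<epsilon>"
proof -
  define X where "X = {y \<in> closure \<Omega>. \<epsilon> \<le> infdist y (frontier \<Omega>)}"
  have "closed X"
    unfolding X_def by (intro closed_Collect_conj closed_Collect_le continuous_intros) auto
  then have "compact X"
    using assms(1) by (auto simp: compact_eq_bounded_closed X_def intro: bounded_subset[OF bounded_closure])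
  have "X \<subseteq> interior \<Omega>"
  proof
    fix y assume y: "y \<in> X"
    then have "y \<notin> frontier \<Omega>" using \<open>0 < \<epsilon>\<close> infdist_zero[of y "frontier \<Omega>"] by (auto simp: X_def)
    then show "y \<in> interior \<Omega>" using y by (simp add: X_def frontier_def)
  qed
  then have X: "X \<subseteq> \<Omega>" using interior_subset by blast
  obtain F where F: "homeomorphism \<D> \<Omega> f F" using inverse_homeomorphism by blast
  then have "compact (F ` X)"
    using \<open>compact X\<close> X by (intro compact_continuous_image) (auto simp: homeomorphism_def intro: continuous_on_subset)
  moreover have FX: "F ` X \<subseteq> \<D>" using F X by (auto simp: homeomorphism_def)
  ultimately obtain \<rho> where \<rho>: "\<rho> < 1" "\<And>z. z \<in> F ` X \<Longrightarrow> norm z \<le> \<rho>"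
  proof (cases "F ` X = {}")
    case False
    then obtain x where "x \<in> F ` X" "\<And>z. z \<in> F ` X \<Longrightarrow> norm z \<le> norm x"
      using continuous_attains_sup[OF \<open>compact (F ` X)\<close> False continuous_on_norm_id] by blast
    then show ?thesis using FX that[of "norm x"] by auto
  qed (use that[of 0] in auto)
  have "boundary_dist \<Omega> (f z) < \<epsilon>" if z: "z \<in> \<D>" "\<rho> < norm z" for z
  proof (rule ccontr)
    assume "\<not> boundary_dist \<Omega> (f z) < \<epsilon>"
    then have "f z \<in> X" using z closure_subset[of \<Omega>] by (auto simp: X_def boundary_dist_def)
    then have "F (f z) \<in> F ` X" by blast
    moreover have "F (f z) = z" using F z by (simp add: homeomorphism_def)
    ultimately show False using \<rho>(2) z(2) by fastforce
  qed
  then show ?thesis using \<rho>(1) by blast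
qed

section \<open>From radial decay to the John condition\<close>

lemma curve_length_le_len:
  assumes u: "norm u = 1" and R: "0 \<le> R" "R < 1" and s: "0 \<le> s" "s \<le> 1"
  shows "curve_length (\<lambda>t. f (of_real t * (of_real R * u))) s 1 \<le> ereal (len u (s * R) R)"
  unfolding curve_length_def
proof (rule SUP_least, clarify)
  fix n and t :: "nat \<Rightarrow> real"
  assume t: "s = t 0" "t n = 1" "\<forall>i<n. t i \<le> t (Suc i)"
  have main: "m \<le> n \<Longrightarrow> t 0 \<le> t m \<and>
      (\<Sum>i<m. dist (f (of_real (t i) * (of_real R * u))) (f (of_real (t (Suc i)) * (of_real R * u))))
        \<le> len u (t 0 * R) (t m * R)" for m
  proof (induction m)
    case (Suc m)
    then have IH: "t 0 \<le> t m" "(\<Sum>i<m. dist (f (of_real (t i) * (of_real R * u))) (f (of_real (t (Suc i)) * (of_real R * u))))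
        \<le> len u (t 0 * R) (t m * R)" and le: "t m \<le> t (Suc m)" using t by auto
    have up: "t i \<le> 1" if "i \<le> n" for i
    proof -
      have "t i \<le> t n" using that t(3) by (induction rule: inc_induct) (auto intro: order_trans)
      then show ?thesis using t by simp
    qed
    have *: "0 \<le> t 0 * R" "t 0 * R \<le> t m * R" "t m * R \<le> t (Suc m) * R" "t (Suc m) * R < 1"
      using IH(1) le R s t mult_right_mono[OF up[OF Suc.prems] R(1)] by (auto intro: mult_right_mono)
    have "dist (f (of_real (t m) * (of_real R * u))) (f (of_real (t (Suc m)) * (of_real R * u)))
        \<le> len u (t m * R) (t (Suc m) * R)"
      using radial[OF u _ *(3,4)] * by (simp add: dist_norm norm_minus_commute mult.assoc)
    then show ?case using IH le len_combine[OF u *] by simp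
  qed simp
  show "ereal (\<Sum>i<n. dist (f (of_real (t i) * (of_real R * u))) (f (of_real (t (Suc i)) * (of_real R * u))))
      \<le> ereal (len u (t 0 * R) R)"
    using main[of n] unfolding t(2) by simp
qed

text \<open>\<open>v\<close> mediates: it bounds the subarc beyond a point by the decay, and is
  itself bounded by the distance to the boundary through \<open>boundary_dist_ge\<close>. Decay
  starting from 0 is used beforehand to see that \<open>\<Omega>\<close> is bounded.\<close>

lemma radial_decay_imp_John:
  assumes radial_decay
  shows "radial_John_disk f"
proof -
  obtain C where C: "0 \<le> C" and dec: "\<And>u r R. norm u = 1 \<Longrightarrow> 0 \<le> r \<Longrightarrow> r \<le> R \<Longrightarrow> R < 1 \<Longrightarrow>
      len u r R \<le> C * v (of_real r * u)"
    using radial_decayD[OF assms] by blast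
  have polar: "\<exists>u. norm u = 1 \<and> z = of_real (norm z) * u" for z :: complex
    by (rule exI[of _ "cis (Arg z)"]) (use rcis_cmod_Arg[of z] in \<open>simp add: rcis_def\<close>)
  have "norm (f z - f 0) \<le> C * v 0" if "z \<in> \<D>" for z
  proof -
    obtain u where u: "norm u = 1" "z = of_real (norm z) * u" using polar by blast
    have "norm (f z - f 0) \<le> len u 0 (norm z)"
      using radial[OF u(1), of 0 "norm z"] u(2) that by simp
    also have "\<dots> \<le> C * v 0" using dec[OF u(1), of 0 "norm z"] that by simp
    finally show ?thesis .
  qed
  then have "\<Omega> \<subseteq> cball (f 0) (C * v 0)" by (auto simp: dist_norm norm_minus_commute)
  then have bd: "bounded \<Omega>" using bounded_subset bounded_cball by blast
  define K where "K = max 1 (C / (c * \<delta>))"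
  have curve: "curve_length (\<lambda>s. f (of_real s * z)) s 1 \<le> ereal (C * v (of_real s * z))"
    if "z \<in> \<D>" "s \<in> {0..1}" for z s
  proof -
    obtain u where u: "norm u = 1" "z = of_real (norm z) * u" using polar by blast
    have "s * norm z \<le> norm z" using that by (simp add: mult_left_le_one_le)
    have "curve_length (\<lambda>s. f (of_real s * z)) s 1 \<le> ereal (len u (s * norm z) (norm z))"
      using curve_length_le_len[OF u(1), of "norm z" s, folded u(2)] that by simp
    also have "len u (s * norm z) (norm z) \<le> C * v (of_real (s * norm z) * u)"
      using dec[OF u(1), of "s * norm z" "norm z"] that \<open>s * norm z \<le> norm z\<close>
      by (simp del: of_real_mult)
    also have "of_real (s * norm z) * u = of_real s * z" by (subst (2) u(2)) simp
    finally show ?thesis by simp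
  qed
  have le: "C * v w \<le> K * boundary_dist \<Omega> (f w)" if "w \<in> \<D>" for w
  proof -
    have "C * v w = C / (c * \<delta>) * (c * \<delta> * v w)" using c \<delta> by simp
    also have "\<dots> \<le> C / (c * \<delta>) * boundary_dist \<Omega> (f w)"
      using boundary_dist_ge[OF that bd] C c \<delta> by (intro mult_left_mono) auto
    also have "\<dots> \<le> K * boundary_dist \<Omega> (f w)"
      using boundary_dist_nonneg by (intro mult_right_mono) (auto simp: K_def)
    finally show ?thesis .
  qed
  obtain F where "homeomorphism \<D> \<Omega> f F" using inverse_homeomorphism by blast
  then have "simply_connected \<Omega>"
    using homeomorphic_simply_connected[of \<D> \<Omega>] convex_imp_simply_connected[of \<D>]
    by (auto simp: homeomorphic_def)
  moreover have "curve_length (\<lambda>s. f (of_real s * z)) 0 1 < \<infinity>" if "z \<in> \<D>" for z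
    using curve[OF that, of 0] by (auto intro: le_less_trans)
  moreover have "curve_length (\<lambda>s. f (of_real s * z)) s 1
      \<le> ereal (K * boundary_dist \<Omega> (f (of_real s * z)))" if "z \<in> \<D>" "s \<in> {0..1}" for z s
  proof -
    have "s * norm z \<le> norm z" using that by (simp add: mult_left_le_one_le)
    then have "of_real s * z \<in> \<D>" using that by (simp add: norm_mult)
    from le[OF this] show ?thesis by (intro order_trans[OF curve[OF that]]) simp
  qed
  moreover have "open \<Omega>" by (rule open_image) auto
  ultimately have "radial_c_John_disk K f"
    using bd unfolding radial_c_John_disk_def Let_def by blast
  moreover have "K \<ge> 1" by (simp add: K_def)
  ultimately show ?thesis unfolding radial_John_disk_def by blast
qed

text \<open>At a quarter of the depth the half-width is \<open>\<delta> * (1 - r) / 4\<close>. Boxes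
  around two directions at chord twice that width are disjoint, and both fit into the original box
  since 1/4 + 1/2 < 1; one of the images has at most half the area. The change of direction stays in
  the range of \<open>near\<close>.\<close>

lemma half_area_subbox:
  assumes u: "norm u = 1" and r: "0 \<le> r" "r < 1" and bd: "bounded \<Omega>"
  shows "\<exists>u'. norm u' = 1 \<and> norm (u' - u) \<le> \<delta> * (1 - r) / 2 \<and>
    measure lebesgue (f ` polar_box (1 - (1 - r) / 4) u' \<delta>) \<le> measure lebesgue (f ` polar_box r u \<delta>) / 2"
proof -
  define \<sigma> where "\<sigma> = \<delta> * (1 - r) / 2"
  have "\<delta> * (1 - r) \<le> 1/4 * 1" using \<delta> r by (intro mult_mono) auto
  then have \<sigma>: "0 \<le> \<sigma>" "\<sigma> \<le> 2" using \<delta> r by (simp_all add: \<sigma>_def)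
  then obtain e :: complex where e: "norm e = 1" "norm (e - 1) = \<sigma>" using unit_at_distance by blast
  define w where "w = u * e"
  have "w - u = u * (e - 1)" by (simp add: w_def algebra_simps)
  then have w: "norm w = 1" "norm (w - u) = \<sigma>" using u e by (simp_all add: w_def norm_mult)
  let ?r = "1 - (1 - r) / 4"
  have sub: "polar_box ?r u' \<delta> \<subseteq> polar_box r u \<delta>" if u': "norm (u' - u) \<le> \<sigma>" for u'
  proof
    fix z assume z: "z \<in> polar_box ?r u' \<delta>"
    have zu: "z - of_real (norm z) * u = (z - of_real (norm z) * u') + of_real (norm z) * (u' - u)"
      by (simp add: algebra_simps)
    have "norm (z - of_real (norm z) * u) \<le> norm (z - of_real (norm z) * u') + norm z * norm (u' - u)"
      unfolding zu by (rule order_trans[OF norm_triangle_ineq]) (simp add: norm_mult)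
    also have "\<dots> < \<delta> * (1 - ?r) * norm z + norm z * \<sigma>"
      using z u' by (intro add_less_le_mono mult_left_mono) (auto simp: polar_box_def)
    also have "\<dots> = (3/4) * (\<delta> * (1 - r) * norm z)" by (simp add: \<sigma>_def algebra_simps)
    also have "\<dots> \<le> \<delta> * (1 - r) * norm z" using \<delta> r by simp
    finally have "norm (z - of_real (norm z) * u) < \<delta> * (1 - r) * norm z" .
    moreover have "r \<le> ?r" using r by (simp add: field_simps)
    ultimately show "z \<in> polar_box r u \<delta>" using z by (auto simp: polar_box_def intro: le_less_trans)
  qed
  have "polar_box ?r u \<delta> \<inter> polar_box ?r w \<delta> = {}"
  proof (rule ccontr)
    assume "polar_box ?r u \<delta> \<inter> polar_box ?r w \<delta> \<noteq> {}"
    then obtain z where z: "z \<in> polar_box ?r u \<delta>" "z \<in> polar_box ?r w \<delta>" by blast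
    then have "0 < norm z" using r by (auto simp: polar_box_def)
    have zu: "of_real (norm z) * (w - u) = (z - of_real (norm z) * u) - (z - of_real (norm z) * w)"
      by (simp add: algebra_simps)
    have "norm z * \<sigma> = norm (of_real (norm z) * (w - u))" using w by (simp add: norm_mult)
    also have "\<dots> \<le> norm (z - of_real (norm z) * u) + norm (z - of_real (norm z) * w)"
      unfolding zu by (rule norm_triangle_ineq4)
    also have "\<dots> < \<delta> * (1 - ?r) * norm z + \<delta> * (1 - ?r) * norm z"
      using z by (intro add_strict_mono) (auto simp: polar_box_def)
    also have "\<dots> = norm z * \<sigma>" by (simp add: \<sigma>_def)
    finally show False by simp
  qed
  then have disj: "f ` polar_box ?r u \<delta> \<inter> f ` polar_box ?r w \<delta> = {}"
    using inj_on_image_Int[OF inj_f polar_box_subset_disk polar_box_subset_disk, of ?r u \<delta> ?r w \<delta>] by simp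
  have "measure lebesgue (f ` polar_box ?r u \<delta>) + measure lebesgue (f ` polar_box ?r w \<delta>) \<le> measure lebesgue (f ` polar_box r u \<delta>)"
    using sub[of u] sub[of w] w \<sigma> disj open_image_box bounded_subset[OF bd image_mono[OF polar_box_subset_disk]]
    by (intro area_add_le) auto
  then have "measure lebesgue (f ` polar_box ?r u \<delta>) \<le> measure lebesgue (f ` polar_box r u \<delta>) / 2 \<or>
      measure lebesgue (f ` polar_box ?r w \<delta>) \<le> measure lebesgue (f ` polar_box r u \<delta>) / 2" by linarith
  then show ?thesis
  proof
    assume "measure lebesgue (f ` polar_box ?r u \<delta>) \<le> measure lebesgue (f ` polar_box r u \<delta>) / 2"
    then show ?thesis using u \<sigma> by (intro exI[of _ u]) (simp add: \<sigma>_def)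
  next
    assume "measure lebesgue (f ` polar_box ?r w \<delta>) \<le> measure lebesgue (f ` polar_box r u \<delta>) / 2"
    then show ?thesis using w by (intro exI[of _ w]) (simp add: \<sigma>_def)
  qed
qed

text \<open>Choosing repeatedly the half of smaller image area, one reaches the boundary of \<open>\<Omega>\<close> along
  points where \<open>v\<close> decays geometrically relative to \<open>boundary_dist\<close>; only boundedly many of them
  matter, and there \<open>v\<close> is controlled by its initial value.\<close>

lemma boundary_dist_le:
  assumes bd: "bounded \<Omega>" and "0 \<le> C"
    and ball: "\<And>u r. norm u = 1 \<Longrightarrow> 0 \<le> r \<Longrightarrow> r < 1 \<Longrightarrow>
      f ` polar_box r u \<delta> \<subseteq> cball (f (of_real r * u)) (C * boundary_dist \<Omega> (f (of_real r * u)))"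
  shows "\<exists>B\<ge>0. \<forall>u r. norm u = 1 \<longrightarrow> 0 \<le> r \<longrightarrow> r < 1 \<longrightarrow>
      boundary_dist \<Omega> (f (of_real r * u)) \<le> B * v (of_real r * u)"
proof -
  obtain H where H: "1 \<le> H" and har: "\<And>u r \<rho>. norm u = 1 \<Longrightarrow> 0 \<le> r \<Longrightarrow> r \<le> \<rho> \<Longrightarrow> \<rho> < 1 \<Longrightarrow>
      1/4 * (1 - r) \<le> 1 - \<rho> \<Longrightarrow> D (of_real \<rho> * u) \<le> H * D (of_real r * u) \<and> D (of_real r * u) \<le> H * D (of_real \<rho> * u)"
    using harnack[of "1/4"] by auto
  define c1 where "c1 = c * \<delta> * \<delta> / 8"
  have "c1 > 0" using c \<delta> by (simp add: c1_def)
  define L where "L = (C + 1) / c1"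
  \<comment> \<open>One step of the path costs 2 times \<open>v\<close> for the arc and
    \<open>2 * H\<close> times \<open>v\<close> for the radial segment.\<close>
  define E where "E = 2 * H + 2"
  define \<theta> where "\<theta> = sqrt (1/2)"
  have "0 < L" "0 < E" using \<open>0 \<le> C\<close> \<open>c1 > 0\<close> H by (simp_all add: L_def E_def)
  have \<theta>: "0 < \<theta>" "\<theta> < 1" by (simp_all add: \<theta>_def real_sqrt_divide)
  \<comment> \<open>\<open>s\<close> is chosen so that the images of all steps after the first
    \<open>s\<close> move by at most a quarter of the initial distance to the boundary.\<close>
  have "0 < (1 - \<theta>) / (4 * E * L)" using \<theta> \<open>0 < L\<close> \<open>0 < E\<close> by simp
  then obtain s where "\<theta> ^ s < (1 - \<theta>) / (4 * E * L)" using real_arch_pow_inv \<theta>(2) by blast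
  then have s: "E * L * (\<theta> ^ s / (1 - \<theta>)) \<le> 1/4"
    using \<theta> \<open>0 < L\<close> \<open>0 < E\<close> by (simp add: field_simps)
  define S where "S = (\<Sum>n<s. (2 * H) ^ n)"
  have "0 \<le> S" using H by (simp add: S_def sum_nonneg)
  define V where "V = measure lebesgue (ball (0::complex) 1)"
  have V: "V > 0" unfolding V_def by (rule area_unit_ball_pos)
  show ?thesis
  proof (intro exI[of _ "2 * E * S"] conjI allI impI)
    show "0 \<le> 2 * E * S" using \<open>0 \<le> S\<close> \<open>0 < E\<close> by simp
    fix u :: complex and r :: real
    assume u: "norm u = 1" and r: "0 \<le> r" "r < 1"
    define \<rho> where "\<rho> n = 1 - (1 - r) / 4 ^ n" for n :: nat
    have \<rho>S: "\<rho> (Suc n) = 1 - (1 - \<rho> n) / 4" for n by (simp add: \<rho>_def)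
    have \<rho>1: "\<rho> n < 1" for n using r by (simp add: \<rho>_def)
    have \<rho>le: "\<rho> n \<le> \<rho> (Suc n)" for n using \<rho>S[of n] \<rho>1[of n] by (simp add: field_simps)
    have \<rho>0: "0 \<le> \<rho> n" for n
      using lift_Suc_mono_le[of \<rho> 0 n] \<rho>le r(1) by (simp add: \<rho>_def[of 0])
    define area where "area n u = measure lebesgue (f ` polar_box (\<rho> n) u \<delta>)" for n u
    have "\<exists>U. \<forall>n. (norm (U n) = 1 \<and> (n = 0 \<longrightarrow> U n = u)) \<and>
        (norm (U (Suc n) - U n) \<le> \<delta> * (1 - \<rho> n) / 2 \<and> area (Suc n) (U (Suc n)) \<le> area n (U n) / 2)"
    proof (rule dependent_nat_choice)
      fix x :: complex and n :: nat
      assume "norm x = 1 \<and> (n = 0 \<longrightarrow> x = u)"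
      then show "\<exists>y. (norm y = 1 \<and> (Suc n = 0 \<longrightarrow> y = u)) \<and>
          (norm (y - x) \<le> \<delta> * (1 - \<rho> n) / 2 \<and> area (Suc n) y \<le> area n x / 2)"
        using half_area_subbox[OF _ \<rho>0 \<rho>1 bd, of x n] unfolding area_def \<rho>S by auto
    qed (use u in auto)
    then obtain U where U: "\<And>n. norm (U n) = 1" "U 0 = u"
      "\<And>n. norm (U (Suc n) - U n) \<le> \<delta> * (1 - \<rho> n) / 2"
      "\<And>n. area (Suc n) (U (Suc n)) \<le> area n (U n) / 2" by metis
    define p where "p n = of_real (\<rho> n) * U n" for n
    have pd: "p n \<in> \<D>" "norm (p n) = \<rho> n" "v (p n) = (1 - \<rho> n) * D (p n)" for n
      unfolding p_def using radius_in_disk[OF U(1) \<rho>0 \<rho>1, of n n] by auto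
    have p0: "p 0 = of_real r * u" by (simp add: p_def \<rho>_def U(2))
    define d where "d = boundary_dist \<Omega> (f (p 0))"
    have "0 < c * \<delta> * v (p 0)" using c \<delta> v_pos[OF pd(1)] by simp
    then have "d > 0" using boundary_dist_ge[OF pd(1)[of 0] bd] unfolding d_def by linarith
    have v0: "0 < v (p n)" for n using v_pos[OF pd(1)] .
    have area_le: "area n (U n) \<le> area 0 u / 2 ^ n" for n
    proof (induction n)
      case (Suc n)
      have "area (Suc n) (U (Suc n)) \<le> area n (U n) / 2" by (rule U(4))
      also have "\<dots> \<le> area 0 u / 2 ^ n / 2" using Suc by (rule divide_right_mono) simp
      finally show ?case by (simp add: mult.commute)
    qed (simp add: U(2))
    have "f ` polar_box (\<rho> 0) u \<delta> \<subseteq> ball (f (p 0)) ((C + 1) * d)"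
    proof
      fix y assume "y \<in> f ` polar_box (\<rho> 0) u \<delta>"
      then have "dist (f (p 0)) y \<le> C * d"
        using ball[OF u r] by (auto simp: d_def p0 \<rho>_def)
      also have "\<dots> < (C + 1) * d" using \<open>d > 0\<close> by simp
      finally show "y \<in> ball (f (p 0)) ((C + 1) * d)" by simp
    qed
    from area_mono[OF open_image_box open_ball bounded_ball this]
    have area0: "area 0 u \<le> V * ((C + 1) * d)\<^sup>2"
      using area_ball[of "(C + 1) * d" "f (p 0)"] \<open>d > 0\<close> \<open>0 \<le> C\<close>
      by (simp add: area_def V_def)
    \<comment> \<open>The bound is in terms of \<open>d\<close>, because the hypothesis
      \<open>ball\<close> controls the initial area by \<open>d\<close>; comparing \<open>d\<close>
      with \<open>v (p 0)\<close> is the goal.\<close>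
    have v_geo: "v (p n) \<le> L * \<theta> ^ n * d" for n
    proof -
      have "V * (c1 * v (p n))\<^sup>2 + measure lebesgue (f ` polar_box ((1 + \<rho> n) / 2) (U n) \<delta>) \<le> area n (U n)"
        using image_box_area_ge[OF U(1) \<rho>0 \<rho>1, of \<delta> n n] \<delta> bounded_subset[OF bd image_mono[OF polar_box_subset_disk]]
        unfolding V_def[symmetric] c1_def[symmetric] p_def[symmetric] area_def by simp
      then have "V * (c1 * v (p n))\<^sup>2 \<le> area n (U n)"
        using measure_nonneg[of lebesgue "f ` polar_box ((1 + \<rho> n) / 2) (U n) \<delta>"] by linarith
      also have "\<dots> \<le> V * ((C + 1) * d)\<^sup>2 / 2 ^ n"
        using area_le[of n] divide_right_mono[OF area0, of "2 ^ n"] by simp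
      also have "\<dots> = V * ((C + 1) * \<theta> ^ n * d)\<^sup>2"
      proof -
        have "(\<theta> ^ n)\<^sup>2 = (\<theta>\<^sup>2) ^ n" by (metis mult.commute power_mult)
        then have "(\<theta> ^ n)\<^sup>2 = 1 / 2 ^ n" by (simp add: \<theta>_def power_one_over)
        then show ?thesis by (simp add: power_mult_distrib)
      qed
      finally have "(c1 * v (p n))\<^sup>2 \<le> ((C + 1) * \<theta> ^ n * d)\<^sup>2" using V by simp
      then have "c1 * v (p n) \<le> (C + 1) * \<theta> ^ n * d"
        by (rule power2_le_imp_le) (use \<open>0 \<le> C\<close> \<theta> \<open>d > 0\<close> in auto)
      then show ?thesis using \<open>c1 > 0\<close> by (simp add: L_def field_simps)
    qed
    have step: "norm (f (p (Suc n)) - f (p n)) \<le> E * v (p n) \<and> v (p (Suc n)) \<le> 2 * H * v (p n)" for n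
    proof -
      define w where "w = of_real (\<rho> n) * U (Suc n)"
      note wd = radius_in_disk[OF U(1) \<rho>0 \<rho>1, of n "Suc n", folded w_def]
      have "w - p n = of_real (\<rho> n) * (U (Suc n) - U n)" by (simp add: w_def p_def algebra_simps)
      then have "norm (w - p n) = \<rho> n * norm (U (Suc n) - U n)" using \<rho>0 by (simp add: norm_mult)
      also have "\<dots> \<le> 1 * (\<delta> * (1 - \<rho> n) / 2)" using U(3) \<rho>0 \<rho>1[of n] by (intro mult_mono) auto
      finally have wp: "norm (w - p n) \<le> \<delta> * (1 - \<rho> n) / 2" by simp
      have pos: "0 < \<delta> * (1 - \<rho> n)" "\<delta> * (1 - \<rho> n) \<le> 1 * (1 - \<rho> n)"
        using \<delta> \<rho>1[of n] by (simp, intro mult_right_mono) auto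
      have nr: "D w \<le> 2 * D (p n)" "norm (f w - f (p n)) \<le> 2 * D (p n) * norm (w - p n)"
        using near[OF pd(1)[of n], of w] wp pos pd(2)[of n] by auto
      have "2 * D (p n) * norm (w - p n) \<le> 2 * D (p n) * (1 - \<rho> n)"
        using wp pos less_imp_le[OF D_pos[OF pd(1)]] by (intro mult_left_mono) auto
      then have 1: "norm (f w - f (p n)) \<le> 2 * v (p n)" using nr pd(3)[of n] by (simp add: mult_ac)
      have vw: "v w \<le> 2 * v (p n)" using nr(1) wd(3) pd(3)[of n] \<rho>1[of n] by (simp add: mult_left_mono)
      have hU: "D (of_real t * U (Suc n)) \<le> H * D w" if "\<rho> n \<le> t" "t \<le> \<rho> (Suc n)" for t
      proof -
        have "1/4 * (1 - \<rho> n) \<le> 1 - t" using that \<rho>S[of n] by (simp add: field_simps)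
        moreover have "t < 1" using that \<rho>1[of "Suc n"] by simp
        ultimately show ?thesis using har[OF U(1) \<rho>0[of n] that(1), of "Suc n"] unfolding w_def by blast
      qed
      have "norm (f (p (Suc n)) - f w) \<le> len (U (Suc n)) (\<rho> n) (\<rho> (Suc n))"
        unfolding p_def w_def by (rule radial[OF U(1) \<rho>0 \<rho>le \<rho>1])
      also have "\<dots> \<le> H * v w"
        using len_le_v[of "\<rho> n" "\<rho> (Suc n)" "U (Suc n)" H] hU U(1) \<rho>0 \<rho>1 \<rho>le H unfolding w_def by simp
      also have "\<dots> \<le> H * (2 * v (p n))" using vw H by (intro mult_left_mono) auto
      finally have 2: "norm (f (p (Suc n)) - f w) \<le> H * (2 * v (p n))" .
      have "norm (f (p (Suc n)) - f (p n)) \<le> norm (f (p (Suc n)) - f w) + norm (f w - f (p n))"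
        using norm_triangle_ineq[of "f (p (Suc n)) - f w" "f w - f (p n)"] by simp
      then have A: "norm (f (p (Suc n)) - f (p n)) \<le> E * v (p n)"
        using 1 2 by (simp add: E_def algebra_simps)
      have "v (p (Suc n)) = (1 - \<rho> (Suc n)) * D (p (Suc n))" by (rule pd(3))
      also have "\<dots> \<le> (1 - \<rho> n) * (H * D w)"
        using hU[of "\<rho> (Suc n)"] \<rho>le[of n] \<rho>1 D_pos[OF pd(1)[of "Suc n"]] less_imp_le[OF \<rho>1]
        by (intro mult_mono) (auto simp: p_def)
      also have "\<dots> = H * v w" using wd(3) by simp
      also have "\<dots> \<le> H * (2 * v (p n))" using vw H by (intro mult_left_mono) auto
      finally show ?thesis using A by simp
    qed
    \<comment> \<open>A growing bound, but by \<open>v (p 0)\<close>; it is used for the first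
      \<open>s\<close> steps and \<open>v_geo\<close> for the later ones.\<close>
    have v_pow: "v (p n) \<le> (2 * H) ^ n * v (p 0)" for n
    proof (induction n)
      case (Suc n)
      have "v (p (Suc n)) \<le> 2 * H * v (p n)" using step by blast
      also have "\<dots> \<le> 2 * H * ((2 * H) ^ n * v (p 0))" using Suc H by (intro mult_left_mono) auto
      finally show ?case by (simp add: mult.assoc)
    qed simp
    have dist1: "norm (f (p n) - f (p 0)) \<le> (\<Sum>j<n. E * v (p j))" for n
    proof (induction n)
      case (Suc n)
      have "norm (f (p (Suc n)) - f (p 0)) \<le> norm (f (p (Suc n)) - f (p n)) + norm (f (p n) - f (p 0))"
        using norm_triangle_ineq[of "f (p (Suc n)) - f (p n)" "f (p n) - f (p 0)"] by simp
      then show ?case using Suc step[of n] by simp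
    qed simp
    have dist2: "norm (f (p (s + m)) - f (p 0)) \<le> E * S * v (p 0) + d / 4" for m
    proof -
      have "(\<Sum>j<s + m. E * v (p j)) = (\<Sum>j<s. E * v (p j)) + (\<Sum>j<m. E * v (p (s + j)))"
        by (induction m) auto
      also have "\<dots> \<le> (\<Sum>j<s. E * ((2 * H) ^ j * v (p 0))) + (\<Sum>j<m. E * (L * \<theta> ^ (s + j) * d))"
        using v_pow v_geo \<open>0 < E\<close> by (intro add_mono sum_mono mult_left_mono) auto
      also have "(\<Sum>j<s. E * ((2 * H) ^ j * v (p 0))) = E * S * v (p 0)"
        by (simp add: S_def sum_distrib_left sum_distrib_right mult_ac)
      also have "(\<Sum>j<m. E * (L * \<theta> ^ (s + j) * d)) = E * L * (\<theta> ^ s * (\<Sum>j<m. \<theta> ^ j)) * d"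
        by (simp add: sum_distrib_left sum_distrib_right mult_ac power_add)
      also have "\<dots> \<le> E * L * (\<theta> ^ s * (1 / (1 - \<theta>))) * d"
      proof (intro mult_left_mono mult_right_mono)
        have "(\<Sum>j<m. \<theta> ^ j) \<le> (\<Sum>j. \<theta> ^ j)"
          using \<theta> by (intro sum_le_suminf summable_geometric) auto
        then show "(\<Sum>j<m. \<theta> ^ j) \<le> 1 / (1 - \<theta>)" using \<theta> by (simp add: suminf_geometric)
      qed (use \<theta> \<open>0 < E\<close> \<open>0 < L\<close> \<open>d > 0\<close> in auto)
      also have "\<dots> \<le> 1/4 * d" using s \<open>d > 0\<close> by (intro mult_right_mono) auto
      finally show ?thesis using dist1[of "s + m"] by simp
    qed
    \<comment> \<open>The path ends within \<open>d / 4\<close> of the boundary and its late part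
      moves by at most \<open>d / 4\<close>, so the first \<open>s\<close> steps account for at
      least half of \<open>d\<close>.\<close>
    obtain \<rho>' where \<rho>': "\<rho>' < 1" "\<And>z. z \<in> \<D> \<Longrightarrow> \<rho>' < norm z \<Longrightarrow> boundary_dist \<Omega> (f z) < d / 4"
      using boundary_dist_tendsto_zero[OF bd, of "d / 4"] \<open>d > 0\<close> by auto
    obtain m where m: "(1/4::real) ^ m < 1 - \<rho>'" using real_arch_pow_inv[of "1 - \<rho>'" "1/4"] \<rho>'(1) by auto
    have "(1 - r) / 4 ^ (s + m) \<le> 1 / 4 ^ m"
      using r by (intro frac_le) (auto intro: power_increasing)
    then have "\<rho>' < \<rho> (s + m)" using m unfolding \<rho>_def power_one_over by linarith
    then have "boundary_dist \<Omega> (f (p (s + m))) < d / 4" using \<rho>'(2) pd by simp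
    moreover have "d \<le> boundary_dist \<Omega> (f (p (s + m))) + norm (f (p (s + m)) - f (p 0))"
      unfolding d_def using boundary_dist_le_add[of \<Omega> "f (p 0)" "f (p (s + m))"] by (simp add: norm_minus_commute)
    ultimately have "d \<le> 2 * (E * S * v (p 0))" using dist2[of m] \<open>d > 0\<close> by (simp add: field_simps)
    then show "boundary_dist \<Omega> (f (of_real r * u)) \<le> 2 * E * S * v (of_real r * u)"
      by (simp add: d_def p0 mult_ac)
  qed
qed

text \<open>The John condition bounds lengths by the distance to the boundary. It encloses the image
  boxes in discs of comparable radius, so that \<open>boundary_dist_le\<close> can exchange the
  distance for \<open>v\<close>; partition sums with steps adapted to \<open>near\<close> then
  recover \<open>len\<close>.\<close>

lemma John_imp_radial_decay:
  assumes "radial_John_disk f"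
  shows radial_decay
proof -
  obtain K where "K \<ge> 1" and bd: "bounded \<Omega>"
    and John: "\<And>z s. z \<in> \<D> \<Longrightarrow> s \<in> {0..1} \<Longrightarrow>
      curve_length (\<lambda>t. f (of_real t * z)) s 1 \<le> ereal (K * boundary_dist \<Omega> (f (of_real s * z)))"
    using assms unfolding radial_John_disk_def radial_c_John_disk_def Let_def by blast
  let ?d = "\<lambda>z. boundary_dist \<Omega> (f z)"
  \<comment> \<open>Dividing the radii \<open>b i\<close> by \<open>b n\<close> turns them into a
    partition, ending at 1, of the curve that leads to the point of radius
    \<open>b n\<close>.\<close>
  have partial: "(\<Sum>i<n. norm (f (of_real (b (Suc i)) * u) - f (of_real (b i) * u))) \<le> K * ?d (of_real (b 0) * u)"
    if u: "norm u = 1" and b: "0 \<le> b 0" "\<And>i. b i \<le> b (Suc i)" "0 < b n" "b n < 1"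
    for u n and b :: "nat \<Rightarrow> real"
  proof -
    define t where "t i = b i / b n" for i
    have "b 0 \<le> b n" using lift_Suc_mono_le[of b 0 n] b(2) by simp
    have bt: "of_real (t i) * (of_real (b n) * u) = of_real (b i) * u" for i
      using b(3) by (simp add: t_def)
    have "ereal (\<Sum>i<n. dist (f (of_real (t i) * (of_real (b n) * u))) (f (of_real (t (Suc i)) * (of_real (b n) * u))))
        \<le> curve_length (\<lambda>t. f (of_real t * (of_real (b n) * u))) (t 0) 1"
      by (rule partition_sum_le_curve_length[of t]) (use b in \<open>auto simp: t_def divide_right_mono\<close>)
    also have "\<dots> \<le> ereal (K * ?d (of_real (t 0) * (of_real (b n) * u)))"
      using \<open>b 0 \<le> b n\<close> b u by (intro John) (auto simp: t_def norm_mult)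
    finally show ?thesis unfolding bt by (simp add: dist_norm norm_minus_commute)
  qed
  have chord: "norm (f (of_real b * u) - f (of_real a * u)) \<le> K * ?d (of_real a * u)"
    if "norm u = 1" "0 \<le> a" "a \<le> b" "b < 1" for u a b
  proof (cases "b = 0")
    case True
    then show ?thesis using that \<open>K \<ge> 1\<close> boundary_dist_nonneg by simp
  next
    case False
    then show ?thesis
      using partial[of u "\<lambda>i. if i = 0 then a else b" 1] that by simp
  qed
  \<comment> \<open>Rotating at radius \<open>r\<close> to the direction of \<open>z\<close> costs
    \<open>2 / (c * \<delta>)\<close> times the boundary distance; going out radially costs
    \<open>K\<close> times the distance at the turning point.\<close>
  define C where "C = 2 / (c * \<delta>) + K * (1 + 2 / (c * \<delta>))"
  have "0 \<le> C" using c \<delta> \<open>K \<ge> 1\<close> by (simp add: C_def)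
  have "f ` polar_box r u \<delta> \<subseteq> cball (f (of_real r * u)) (C * ?d (of_real r * u))"
    if u: "norm u = 1" and r: "0 \<le> r" "r < 1" for u r
  proof
    fix y assume "y \<in> f ` polar_box r u \<delta>"
    then obtain z where z: "r < norm z" "norm z < 1" "norm (z - of_real (norm z) * u) < \<delta> * (1 - r) * norm z"
      and y: "y = f z" by (auto simp: polar_box_def)
    have "0 < norm z" using z r by linarith
    define e where "e = sgn z"
    have "z \<noteq> 0" using \<open>0 < norm z\<close> by simp
    then have e: "norm e = 1" "z = of_real (norm z) * e"
      by (simp add: e_def norm_sgn) (simp add: e_def sgn_eq)
    have "z - of_real (norm z) * u = of_real (norm z) * (e - u)"
      by (subst e(2)) (simp add: algebra_simps)
    then have "norm z * norm (e - u) < norm z * (\<delta> * (1 - r))"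
      using z(3) by (simp add: norm_mult mult_ac)
    then have "norm (e - u) \<le> \<delta> * (1 - r)" using \<open>0 < norm z\<close> by (simp add: mult_less_cancel_left)
    have "norm (of_real r * e - of_real r * u) = r * norm (e - u)"
      using r by (simp add: norm_mult flip: right_diff_distrib)
    also have "\<dots> \<le> 1 * (\<delta> * (1 - r))" using \<open>norm (e - u) \<le> _\<close> r by (intro mult_mono) auto
    finally have en: "norm (of_real r * e - of_real r * u) \<le> \<delta> * (1 - r)" by simp
    note ru = radius_in_disk[OF u r]
    have "norm (f (of_real r * e) - f (of_real r * u)) \<le> 2 * D (of_real r * u) * norm (of_real r * e - of_real r * u)"
      using near[OF ru(1)] en ru(2) by simp
    also have "\<dots> \<le> 2 * D (of_real r * u) * (\<delta> * (1 - r))"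
      using en D_radius_pos[OF u r] by (intro mult_left_mono) auto
    also have "\<dots> = 2 / c * (c * \<delta> * v (of_real r * u))" using ru(3) c by simp
    also have "\<dots> \<le> 2 / c * ?d (of_real r * u)"
      using boundary_dist_ge[OF ru(1) bd] c by (intro mult_left_mono) auto
    also have "\<dots> \<le> 2 / (c * \<delta>) * ?d (of_real r * u)"
      using c \<delta> boundary_dist_nonneg by (intro mult_right_mono divide_left_mono) auto
    finally have 1: "norm (f (of_real r * e) - f (of_real r * u)) \<le> 2 / (c * \<delta>) * ?d (of_real r * u)" .
    have "norm (f z - f (of_real r * e)) \<le> K * ?d (of_real r * e)"
      using chord[OF e(1) r(1), of "norm z"] z e(2) by simp
    also have "\<dots> \<le> K * (?d (of_real r * u) + 2 / (c * \<delta>) * ?d (of_real r * u))"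
      using boundary_dist_le_add[of \<Omega> "f (of_real r * e)" "f (of_real r * u)"] 1 \<open>K \<ge> 1\<close>
      by (intro mult_left_mono) auto
    finally have "norm (f z - f (of_real r * e)) + norm (f (of_real r * e) - f (of_real r * u)) \<le> C * ?d (of_real r * u)"
      using 1 by (simp add: C_def algebra_simps)
    then have "norm (f z - f (of_real r * u)) \<le> C * ?d (of_real r * u)"
      using norm_triangle_ineq[of "f z - f (of_real r * e)" "f (of_real r * e) - f (of_real r * u)"] by simp
    then show "y \<in> cball (f (of_real r * u)) (C * ?d (of_real r * u))"
      by (simp add: y dist_norm norm_minus_commute)
  qed
  from boundary_dist_le[OF bd \<open>0 \<le> C\<close> this]
  obtain B where B: "0 \<le> B" "\<And>u r. norm u = 1 \<Longrightarrow> 0 \<le> r \<Longrightarrow> r < 1 \<Longrightarrow> ?d (of_real r * u) \<le> B * v (of_real r * u)"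
    by blast
  show ?thesis
    unfolding radial_decay_def
  proof (intro exI[of _ "2 / (c * \<delta>) * (K * B)"] conjI allI impI)
    show "0 \<le> 2 / (c * \<delta>) * (K * B)" using c \<delta> \<open>K \<ge> 1\<close> B by simp
    fix u :: complex and r R :: real
    assume u: "norm u = 1" and rR: "0 \<le> r" "r \<le> R" "R < 1"
    then have r: "0 \<le> r" "r < 1" by auto
    \<comment> \<open>Each step is exactly the radius allowed in \<open>near\<close>, whose lower
      bound makes the chord comparable to \<open>len\<close> over the step.\<close>
    define \<rho> where "\<rho> n = 1 - (1 - r) * (1 - \<delta>) ^ n" for n :: nat
    have \<rho>S: "\<rho> (Suc n) - \<rho> n = \<delta> * (1 - \<rho> n)" for n by (simp add: \<rho>_def algebra_simps)
    have \<rho>1: "\<rho> n < 1" for n using r \<delta> by (simp add: \<rho>_def)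
    have \<rho>le: "\<rho> n \<le> \<rho> (Suc n)" for n
    proof -
      have "0 \<le> \<delta> * (1 - \<rho> n)" using \<delta> \<rho>1[of n] by simp
      then show ?thesis using \<rho>S[of n] by linarith
    qed
    have \<rho>0: "0 \<le> \<rho> n" for n
      using lift_Suc_mono_le[of \<rho> 0 n] \<rho>le r(1) by (simp add: \<rho>_def[of 0])
    have piece: "len u (\<rho> n) (\<rho> (Suc n)) \<le> 2 / (c * \<delta>) * norm (f (of_real (\<rho> (Suc n)) * u) - f (of_real (\<rho> n) * u))" for n
    proof -
      note pn = radius_in_disk[OF u \<rho>0[of n] \<rho>1]
      have nrm: "norm (of_real t * u - of_real (\<rho> n) * u) = t - \<rho> n" if "\<rho> n \<le> t" for t
        using u that by (simp add: norm_mult flip: left_diff_distrib of_real_diff)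
      have "len u (\<rho> n) (\<rho> (Suc n)) \<le> 2 * D (of_real (\<rho> n) * u) * (\<rho> (Suc n) - \<rho> n)"
      proof (rule len_le[OF u \<rho>0 \<rho>le \<rho>1])
        fix t assume t: "\<rho> n \<le> t" "t \<le> \<rho> (Suc n)"
        then show "D (of_real t * u) \<le> 2 * D (of_real (\<rho> n) * u)"
          using near[OF pn(1), of "of_real t * u"] nrm[OF t(1)] \<rho>S[of n] pn(2) by simp
      qed
      also have "\<dots> = 2 / c * (c * D (of_real (\<rho> n) * u) * (\<rho> (Suc n) - \<rho> n))" using c by simp
      also have "\<dots> \<le> 2 / c * norm (f (of_real (\<rho> (Suc n)) * u) - f (of_real (\<rho> n) * u))"
        using near[OF pn(1), of "of_real (\<rho> (Suc n)) * u"] nrm[OF \<rho>le] \<rho>S[of n] pn(2) c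
        by (intro mult_left_mono) auto
      also have "\<dots> \<le> 2 / (c * \<delta>) * norm (f (of_real (\<rho> (Suc n)) * u) - f (of_real (\<rho> n) * u))"
        using c \<delta> by (intro mult_right_mono divide_left_mono) auto
      finally show ?thesis .
    qed
    have total: "len u r (\<rho> n) \<le> 2 / (c * \<delta>) * (\<Sum>i<n. norm (f (of_real (\<rho> (Suc i)) * u) - f (of_real (\<rho> i) * u)))" for n
    proof (induction n)
      case (Suc n)
      have "r \<le> \<rho> n" using lift_Suc_mono_le[of \<rho> 0 n] \<rho>le by (simp add: \<rho>_def[of 0])
      then have "len u r (\<rho> (Suc n)) = len u r (\<rho> n) + len u (\<rho> n) (\<rho> (Suc n))"
        using len_combine[OF u r(1) _ \<rho>le \<rho>1] by simp
      then show ?case using Suc piece[of n] by (simp add: distrib_left)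
    qed (simp add: \<rho>_def)
    have "0 < 1 - R" using rR by simp
    then obtain n where n: "(1 - \<delta>) ^ n < 1 - R" using real_arch_pow_inv[of "1 - R" "1 - \<delta>"] \<delta> by auto
    have "(1 - r) * (1 - \<delta>) ^ Suc n \<le> 1 * (1 - \<delta>) ^ n"
      using r \<delta> by (intro mult_mono power_decreasing) auto
    then have "R \<le> \<rho> (Suc n)" using n unfolding \<rho>_def by linarith
    have "0 < \<rho> (Suc n)"
    proof -
      have "0 < \<delta> * (1 - \<rho> n)" using \<delta> \<rho>1[of n] by simp
      then show ?thesis using \<rho>S[of n] \<rho>0[of n] by linarith
    qed
    have "len u r R \<le> len u r (\<rho> (Suc n))" by (rule len_mono[OF u rR(1,2) \<open>R \<le> _\<close> \<rho>1])
    also have "\<dots> \<le> 2 / (c * \<delta>) * (\<Sum>i<Suc n. norm (f (of_real (\<rho> (Suc i)) * u) - f (of_real (\<rho> i) * u)))"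
      by (rule total)
    also have "\<dots> \<le> 2 / (c * \<delta>) * (K * ?d (of_real (\<rho> 0) * u))"
      using partial[of u \<rho> "Suc n"] u \<rho>0 \<rho>le \<rho>1 \<open>0 < \<rho> (Suc n)\<close> c \<delta> by (intro mult_left_mono) auto
    also have "\<dots> \<le> 2 / (c * \<delta>) * (K * (B * v (of_real r * u)))"
      using B(2)[OF u r] c \<delta> \<open>K \<ge> 1\<close> by (intro mult_left_mono) (auto simp: \<rho>_def)
    finally show "len u r R \<le> 2 / (c * \<delta>) * (K * B) * v (of_real r * u)" by (simp add: mult_ac)
  qed
qed

end

section \<open>The equivalences\<close>

lemma AE_open_imp_all:
  fixes G :: "complex set"
  assumes "open G" "open {z \<in> G. \<not> P z}" "AE z in lborel. z \<in> G \<longrightarrow> P z" "z \<in> G"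
  shows "P z"
proof -
  let ?N = "{z \<in> G. \<not> P z}"
  have "AE z in lborel. z \<notin> ?N" using assms(3) by eventually_elim auto
  then have "?N \<in> null_sets lborel"
    using AE_iff_null_sets[of ?N lborel] borel_open[OF assms(2)] by simp
  then have "negligible ?N" by (simp add: negligible_iff_null_sets null_sets_completionI)
  then have "?N = {}" using assms(2) open_not_negligible by blast
  then show ?thesis using assms(4) by blast
qed

text \<open>For \<open>a = norm (deriv h z)\<close> and \<open>b = norm (deriv g z)\<close> with
  \<open>b < a\<close>, the inequality
  \<open>(a + b)\<^sup>2 \<le> K * (a\<^sup>2 - b\<^sup>2)\<close> reduces to
  \<open>b \<le> k * a\<close> with \<open>k = (K - 1) / (K + 1)\<close>. Continuity of both sides
  turns almost everywhere into everywhere.\<close>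

lemma S_H0_qc_imp_harmonic_qc:
  assumes "K \<ge> 1" "f \<in> S_H0_qc K"
  shows "\<exists>h g k. harmonic_qc f h g k"
proof -
  have qc: "quasiconformal_on K \<D> f" and SH: "f \<in> S_H"
    using assms by (auto simp: S_H0_qc_def S_H0_def)
  then obtain h g where inj: "inj_on f \<D>" and sp: "sense_preserving_on \<D> f"
    and can: "canonical_decomposition f h g" by (auto simp: S_H_def)
  interpret harmonic_map f h g
    using can by unfold_locales (auto simp: canonical_decomposition_def)
  define k where "k = (K - 1) / (K + 1)"
  have k: "0 \<le> k" "k < 1" using assms(1) by (simp_all add: k_def)
  have lt: "norm (deriv g z) < norm (deriv h z)" if "z \<in> \<D>" for z
  proof -
    have "(norm (deriv g z))\<^sup>2 < (norm (deriv h z))\<^sup>2"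
      using bspec[OF sp[unfolded sense_preserving_on_def] that] jacobian_eq[OF that] by simp
    then show ?thesis by (rule power2_less_imp_less) simp
  qed
  have AE: "AE z in lborel. z \<in> \<D> \<longrightarrow> norm (deriv g z) \<le> k * norm (deriv h z)"
  proof -
    have "AE z in lborel. z \<in> \<D> \<longrightarrow> (Dnorm f z)\<^sup>2 \<le> K * \<bar>jacobian f z\<bar>"
      using qc unfolding quasiconformal_on_def by (auto elim!: eventually_mono)
    then show ?thesis
    proof eventually_elim
      case (elim z)
      show ?case
      proof
        assume z: "z \<in> \<D>"
        define a where "a = norm (deriv h z)"
        define b where "b = norm (deriv g z)"
        have ab: "0 \<le> b" "b < a" using lt[OF z] by (simp_all add: a_def b_def)
        then have "b\<^sup>2 < a\<^sup>2" by (simp add: power_strict_mono)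
        then have "(a + b)\<^sup>2 \<le> K * (a\<^sup>2 - b\<^sup>2)"
          using elim z Dnorm_eq[OF z] jacobian_eq[OF z] by (simp add: a_def b_def)
        also have "a\<^sup>2 - b\<^sup>2 = (a + b) * (a - b)" by (simp add: power2_eq_square algebra_simps)
        finally have "(a + b) * (a + b) \<le> (a + b) * (K * (a - b))" by (simp add: power2_eq_square mult_ac)
        then have "a + b \<le> K * (a - b)" using ab by simp
        then have "b \<le> k * a" using assms(1) by (simp add: k_def field_simps)
        then show "norm (deriv g z) \<le> k * norm (deriv h z)" by (simp add: a_def b_def)
      qed
    qed
  qed
  have "open {z \<in> \<D>. \<not> norm (deriv g z) \<le> k * norm (deriv h z)}"
  proof -
    have "continuous_on \<D> (\<lambda>z. norm (deriv g z) - k * norm (deriv h z))"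
      using holh holg by (intro continuous_intros holomorphic_on_imp_continuous_on holomorphic_deriv) auto
    then have "open (\<D> \<inter> (\<lambda>z. norm (deriv g z) - k * norm (deriv h z)) -` {0<..})"
      by (intro continuous_open_preimage) auto
    moreover have "\<D> \<inter> (\<lambda>z. norm (deriv g z) - k * norm (deriv h z)) -` {0<..}
        = {z \<in> \<D>. \<not> norm (deriv g z) \<le> k * norm (deriv h z)}" by auto
    ultimately show ?thesis by simp
  qed
  then have dil: "norm (deriv g z) \<le> k * norm (deriv h z)" if "z \<in> \<D>" for z
    using AE_open_imp_all[OF open_ball _ AE that] by blast
  have "harmonic_qc f h g k"
  proof
    show "deriv h z \<noteq> 0" if "z \<in> \<D>" for z using lt[OF that] by auto
  qed (use inj k dil in auto)
  then show ?thesis by blast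
qed

text \<open>The nonnegative value at \<open>a0\<close>, \<open>b0\<close> keeps the supremum from
  being minus infinity, so below \<open>M\<close> it is a real number. Used with
  \<open>M = 1\<close> for (ii) and \<open>M = \<infinity>\<close> for (iii).\<close>

lemma SUP2_less_ereal_iff:
  fixes F :: "'a \<Rightarrow> 'b \<Rightarrow> real" and M :: ereal
  assumes nonneg: "\<And>a b. a \<in> A \<Longrightarrow> b \<in> B a \<Longrightarrow> 0 \<le> F a b" and "a0 \<in> A" "b0 \<in> B a0"
  shows "(SUP a\<in>A. SUP b\<in>B a. ereal (F a b)) < M \<longleftrightarrow>
    (\<exists>q\<ge>0. ereal q < M \<and> (\<forall>a\<in>A. \<forall>b\<in>B a. F a b \<le> q))"
proof
  let ?S = "SUP a\<in>A. SUP b\<in>B a. ereal (F a b)"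
  have up: "ereal (F a b) \<le> ?S" if "a \<in> A" "b \<in> B a" for a b
    using that by (intro SUP_upper2[of a] SUP_upper)
  assume less: "?S < M"
  have "0 \<le> ?S" using up[OF assms(2,3)] nonneg[OF assms(2,3)] by (meson ereal_less_eq(5) order_trans)
  moreover have "?S \<noteq> \<infinity>" using less by auto
  ultimately obtain q where q: "?S = ereal q" "0 \<le> q" by (cases ?S) auto
  then show "\<exists>q\<ge>0. ereal q < M \<and> (\<forall>a\<in>A. \<forall>b\<in>B a. F a b \<le> q)"
    using up less by (intro exI[of _ q]) auto
next
  assume "\<exists>q\<ge>0. ereal q < M \<and> (\<forall>a\<in>A. \<forall>b\<in>B a. F a b \<le> q)"
  then obtain q where "ereal q < M" "\<forall>a\<in>A. \<forall>b\<in>B a. F a b \<le> q" by blast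
  then have "(SUP a\<in>A. SUP b\<in>B a. ereal (F a b)) \<le> ereal q"
    by (intro SUP_least) auto
  then show "(SUP a\<in>A. SUP b\<in>B a. ereal (F a b)) < M"
    using \<open>ereal q < M\<close> by (rule le_less_trans)
qed

context koebe_like
begin

lemma John_iff_radial_decay: "radial_John_disk f \<longleftrightarrow> radial_decay"
  using John_imp_radial_decay radial_decay_imp_John by blast

lemma radial_decay_iff_SUP_less_one:
  "radial_decay \<longleftrightarrow> (\<exists>x::real. 0 < x \<and> x < 1 \<and>
     (SUP \<zeta>\<in>sphere (0::complex) 1. SUP r\<in>{0<..<1::real}.
        let \<rho> = (x + r) / (1 + x * r) in
        ereal (((1 - \<rho>\<^sup>2) * D (of_real \<rho> * \<zeta>)) / ((1 - r\<^sup>2) * D (of_real r * \<zeta>)))) < 1)"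
    (is "_ \<longleftrightarrow> (\<exists>x. _ x \<and> _ x \<and> ?S x < 1)")
proof -
  have weight_pos: "0 < (1 - r\<^sup>2) * D (of_real r * u)" if "norm u = 1" "0 \<le> r" "r < 1" for u r
    using weight_bounds(1)[OF that] v_radius_pos[OF that] by linarith
  have "?S x < 1 \<longleftrightarrow> (\<exists>q\<ge>0. q < 1 \<and> contraction x q)" if x: "0 < x" "x < 1" for x
  proof -
    define F where "F u r = (let \<rho> = (x + r) / (1 + x * r) in
        ((1 - \<rho>\<^sup>2) * D (of_real \<rho> * u)) / ((1 - r\<^sup>2) * D (of_real r * u)))" for u r
    have S: "?S x = (SUP u\<in>sphere 0 1. SUP r\<in>{0<..<1}. ereal (F u r))"
      by (simp add: F_def Let_def)
    have F: "0 \<le> F u r" "F u r \<le> q \<longleftrightarrow> (let \<rho> = (x + r) / (1 + x * r) in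
        (1 - \<rho>\<^sup>2) * D (of_real \<rho> * u) \<le> q * ((1 - r\<^sup>2) * D (of_real r * u)))"
      if "norm u = 1" "0 < r" "r < 1" for u r q
    proof -
      have "0 \<le> (x + r) / (1 + x * r)" "(x + r) / (1 + x * r) < 1"
        using hyperbolic_translation(1,2)[of x r] x that by auto
      note 1 = weight_pos[OF that(1) this]
      have 2: "0 < (1 - r\<^sup>2) * D (of_real r * u)" using weight_pos that by simp
      show "0 \<le> F u r" using 1 2 unfolding F_def Let_def by (intro divide_nonneg_nonneg) auto
      show "F u r \<le> q \<longleftrightarrow> (let \<rho> = (x + r) / (1 + x * r) in
        (1 - \<rho>\<^sup>2) * D (of_real \<rho> * u) \<le> q * ((1 - r\<^sup>2) * D (of_real r * u)))"
        unfolding F_def Let_def by (rule pos_divide_le_eq[OF 2])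
    qed
    have "?S x < 1 \<longleftrightarrow> (\<exists>q\<ge>0. ereal q < 1 \<and> (\<forall>u\<in>sphere 0 1. \<forall>r\<in>{0<..<1}. F u r \<le> q))"
      unfolding S by (rule SUP2_less_ereal_iff[of _ _ _ 1 "1/2"]) (use F in auto)
    also have "\<dots> \<longleftrightarrow> (\<exists>q\<ge>0. q < 1 \<and> contraction x q)"
      unfolding contraction_def using F(2) by (auto simp: one_ereal_def)
    finally show ?thesis .
  qed
  then have "(\<exists>x. 0 < x \<and> x < 1 \<and> ?S x < 1) \<longleftrightarrow> (\<exists>x. 0 < x \<and> x < 1 \<and> (\<exists>q\<ge>0. q < 1 \<and> contraction x q))"
    by blast
  also have "\<dots> \<longleftrightarrow> radial_decay"
  proof
    assume radial_decay
    then obtain x where "0 < x" "x < 1" "contraction x (1/2)"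
      using radial_decay_imp_contraction by blast
    then show "\<exists>x. 0 < x \<and> x < 1 \<and> (\<exists>q\<ge>0. q < 1 \<and> contraction x q)"
      by (intro exI[of _ x] conjI exI[of _ "1/2"]) auto
  qed (use contraction_imp_radial_decay in blast)
  finally show ?thesis by simp
qed

text \<open>\<open>1 - (norm z)\<^sup>2\<close> lies between \<open>1 - norm z\<close> and twice
  that, so the denominator can be exchanged for \<open>v z\<close>.\<close>

lemma radial_decay_iff_SUP_finite:
  "radial_decay \<longleftrightarrow>
     (SUP z\<in>\<D>. SUP w\<in>B_box z. ereal (norm (f z - f w) / ((1 - (norm z)\<^sup>2) * D z))) < \<infinity>"
proof -
  have w: "0 < v z" "v z \<le> (1 - (norm z)\<^sup>2) * D z" "(1 - (norm z)\<^sup>2) * D z \<le> 2 * v z" if "z \<in> \<D>" for z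
  proof -
    have z: "z = of_real (norm z) * cis (Arg z)" using rcis_cmod_Arg[of z] by (simp add: rcis_def)
    show "0 < v z" "v z \<le> (1 - (norm z)\<^sup>2) * D z" "(1 - (norm z)\<^sup>2) * D z \<le> 2 * v z"
      using weight_bounds[of "cis (Arg z)" "norm z", folded z] v_pos[OF that] that by auto
  qed
  have "(SUP z\<in>\<D>. SUP w\<in>B_box z. ereal (norm (f z - f w) / ((1 - (norm z)\<^sup>2) * D z))) < \<infinity> \<longleftrightarrow>
      (\<exists>q\<ge>0. ereal q < \<infinity> \<and> (\<forall>z\<in>\<D>. \<forall>w\<in>B_box z. norm (f z - f w) / ((1 - (norm z)\<^sup>2) * D z) \<le> q))"
  proof (rule SUP2_less_ereal_iff[of _ _ _ 0 0])
    show "0 \<le> norm (f z - f w) / ((1 - (norm z)\<^sup>2) * D z)" if "z \<in> \<D>" for z w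
      using w[OF that] by (intro divide_nonneg_nonneg) auto
    show "0 \<in> B_box 0" by (auto simp: B_box_def intro: exI[of _ 0])
  qed simp
  also have "\<dots> \<longleftrightarrow> radial_decay"
  proof
    assume "\<exists>q\<ge>0. ereal q < \<infinity> \<and> (\<forall>z\<in>\<D>. \<forall>w\<in>B_box z. norm (f z - f w) / ((1 - (norm z)\<^sup>2) * D z) \<le> q)"
    then obtain q where q: "0 \<le> q"
      "\<And>z w. z \<in> \<D> \<Longrightarrow> w \<in> B_box z \<Longrightarrow> norm (f z - f w) / ((1 - (norm z)\<^sup>2) * D z) \<le> q" by blast
    show radial_decay
    proof (rule B_box_bound_imp_radial_decay)
      fix z w' assume z: "z \<in> \<D>" "w' \<in> B_box z"
      have "norm (f z - f w') \<le> q * ((1 - (norm z)\<^sup>2) * D z)"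
        using q(2)[OF z] w[OF z(1)] by (subst (asm) pos_divide_le_eq) auto
      also have "\<dots> \<le> q * (2 * v z)" using w[OF z(1)] q(1) by (intro mult_left_mono)
      finally show "norm (f z - f w') \<le> 2 * q * v z" by simp
    qed
  next
    assume radial_decay
    then obtain C where C: "\<And>z w. z \<in> \<D> \<Longrightarrow> w \<in> B_box z \<Longrightarrow> norm (f z - f w) \<le> C * v z"
      using radial_decay_imp_B_box_bound by blast
    have "norm (f z - f w') / ((1 - (norm z)\<^sup>2) * D z) \<le> \<bar>C\<bar>" if z: "z \<in> \<D>" "w' \<in> B_box z" for z w'
    proof -
      have "norm (f z - f w') \<le> C * v z" by (rule C[OF z])
      also have "\<dots> \<le> \<bar>C\<bar> * ((1 - (norm z)\<^sup>2) * D z)" using w[OF z(1)] by (intro mult_mono) auto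
      finally show ?thesis using w[OF z(1)] by (subst pos_divide_le_eq) auto
    qed
    then show "\<exists>q\<ge>0. ereal q < \<infinity> \<and> (\<forall>z\<in>\<D>. \<forall>w\<in>B_box z. norm (f z - f w) / ((1 - (norm z)\<^sup>2) * D z) \<le> q)"
      by (intro exI[of _ "\<bar>C\<bar>"]) auto
  qed
  finally show ?thesis by simp
qed

end

theorem theorem2:
  fixes K :: real and f :: "complex \<Rightarrow> complex"
  assumes "K \<ge> 1" and "f \<in> S_H0_qc K"
  shows "(radial_John_disk f \<longleftrightarrow>
           (\<exists>x::real. 0 < x \<and> x < 1 \<and>
              (SUP \<zeta>\<in>sphere (0::complex) 1. SUP r\<in>{0<..<1::real}.
                 let \<rho> = (x + r) / (1 + x * r) in
                 ereal (((1 - \<rho>\<^sup>2) * Dnorm f (of_real \<rho> * \<zeta>)) /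
                        ((1 - r\<^sup>2) * Dnorm f (of_real r * \<zeta>)))) < 1))
         \<and> (radial_John_disk f \<longleftrightarrow>
           (SUP z\<in>\<D>. SUP w\<in>B_box z.
              ereal (norm (f z - f w) / ((1 - (norm z)\<^sup>2) * Dnorm f z))) < \<infinity>)"
proof -
  obtain h g k where "harmonic_qc f h g k" using S_H0_qc_imp_harmonic_qc[OF assms] by blast
  then obtain \<delta> where "koebe_like f (Dnorm f) \<delta> ((1 - k) / 4)"
    using harmonic_qc.koebe_like_Dnorm by blast
  then interpret koebe_like f "Dnorm f" \<delta> "(1 - k) / 4" .
  show ?thesis
    using John_iff_radial_decay radial_decay_iff_SUP_less_one radial_decay_iff_SUP_finite by blast
qed

end
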